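(* Let $\Sigma$ be a simple closed curve with length $L=2\pi r_0>0$, and let $k$ be a smooth function on $\Sigma$ which is either positive everywhere or identically zero. Then there exists an asymptotically locally hyperbolic $2$-manifold $(M,g)$, diffeomorphic to $\Sigma\times[r_0,\infty)$, such that: i) the Gauss curvature $K(g)$ of $g$ equals $-1$; ii) $\partial M$ with the induced metric is isometric to $\Sigma$ (a circle of length $2\pi r_0$), and under the isometry the geodesic curvature of $\partial M$ in $(M,g)$ equals $k$; iii) $(M,g)$ is foliated by a $1$-parameter family of closed curves with positive geodesic curvature (where, in the case $k\equiv0$, the boundary leaf $\partial M$, whose geodesic curvature is $0$, is excepted); iv) the Hamiltonian mass satisfies $H^0(g)\le 1+r_0^2$. Consequently, the $(2+1)$-dimensional hyperbolic Bartnik mass satisfies $$\mathfrak{m}_{\mathrm{HB}}(\Sigma,r_0,k)\le 1+r_0^2 .$$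
   Context: Let $g_{-1}=\frac{dr^2}{1+r^2}+r^2d\varphi^2$, $\varphi\in[0,2\pi)$ periodic, be the hyperbolic metric in polar coordinates. Asymptotically locally hyperbolic (ALH): $(M,g)$ is ALH if, outside a compact set, it has coordinates $(r,\varphi)$, $r\to\infty$, in which $$g=g_{-1}+\frac{\mu_{ij}\theta^i\theta^j}{r^2}+\mathcal{O}(r^{-3}),$$ where $\theta^1=r\,d\varphi$, $\theta^2=\frac{dr}{\sqrt{1+r^2}}$, $\mu_{ij}=\mu_{ij}(\varphi)$, and the error refers to components in the coframe $\theta^i$. Its Hamiltonian mass, computed in these coordinates, is $$H^0(g)=\frac{1}{2\pi}\int_0^{2\pi}\left(\mu_{22}+2\mu_{11}\right)d\varphi .$$ Geodesic curvature of $\partial M$ and of the leaves is taken with respect to the unit normal pointing towards infinity, $g(\nabla_{e_1}e_2,e_1)$ with $e_1$ unit tangent and $e_2$ that unit normal (so that round circles in hyperbolic space have positive geodesic curvature). Hyperbolic Bartnik mass: for a simple closed curve $\Sigma$ of length $2\pi r_0$ and a function $k$ on $\Sigma$, $$\mathfrak{m}_{\mathrm{HB}}(\Sigma,r_0,k)=\inf\left\{H^0(g)\ :\ (M,g)\text{ is an admissible hyperbolic extension of }(\Sigma,r_0,k)\right\}.$$ An ALH $2$-manifold $(M,g)$ with boundary $\partial M$ is an admissible hyperbolic extension of $(\Sigma,r_0,k)$ if (a) the Gauss curvature satisfies $K(g)\ge-1$; (b) $\partial M$ with the induced metric is isometric to $\Sigma$ and, under the isometry, the geodesic curvature of $\partial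 M$ in $(M,g)$ equals $k$; and (c) $(M,g)$ satisfies a non-degeneracy condition preventing $H^0(g)$ from being arbitrarily small, for instance one of: $(M,g)$ contains no closed geodesic (other than possibly $\partial M$ itself) enclosing $\partial M$; or $\partial M$ is outer-minimising in $(M,g)$, i.e. no closed curve enclosing $\partial M$ has length smaller than that of $\partial M$. The bound on $\mathfrak{m}_{\mathrm{HB}}$ is asserted for either choice of condition (c). *)

theory Defs
  imports "HOL-Analysis.Analysis"
begin

section \<open>Smooth maps\<close>

text \<open>
  \<open>ck_on n W f\<close>: \<open>f\<close> is of class \<open>C\<close>-\<open>n\<close> on the open set \<open>W\<close>. In the recursion \<open>D p h\<close> is the
  directional derivative of \<open>f\<close> at \<open>p\<close> in direction \<open>h\<close>.
\<close>

primrec ck_on :: "nat \<Rightarrow> 'a::euclidean_space set \<Rightarrow> ('a \<Rightarrow> 'b::real_normed_vector) \<Rightarrow> bool" where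
  "ck_on 0 = (\<lambda>W f. continuous_on W f)"
| "ck_on (Suc n) = (\<lambda>W f. \<exists>D. (\<forall>p\<in>W. (f has_derivative D p) (at p)) \<and> (\<forall>h. ck_on n W (\<lambda>p. D p h)))"

text \<open>
  Smoothness on an arbitrary subset \<open>S\<close> of a Euclidean space means local extendability to smooth
  functions on open sets; this is the usual notion on relatively open subsets of a half-plane.
\<close>

definition smooth_on :: "'a::euclidean_space set \<Rightarrow> ('a \<Rightarrow> 'b::real_normed_vector) \<Rightarrow> bool" where
  "smooth_on S f \<longleftrightarrow>
     (\<forall>p\<in>S. \<exists>W F. open W \<and> p \<in> W \<and> (\<forall>n. ck_on n W F) \<and> (\<forall>q\<in>S \<inter> W. F q = f q))"


section \<open>Local Riemannian geometry in coordinates\<close>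

text \<open>
  \<open>S\<close> is the coordinate domain, relatively open in a plane or a closed half-plane, and \<open>G\<close> is the
  matrix of metric components. Derivatives are taken within \<open>S\<close>, hence one-sided in the transversal
  direction at boundary points.
\<close>

definition pdiff :: "(real^2) set \<Rightarrow> 2 \<Rightarrow> (real^2 \<Rightarrow> real) \<Rightarrow> real^2 \<Rightarrow> real" where
  "pdiff S i f x = frechet_derivative f (at x within S) (axis i 1)"

definition christoffel ::
    "(real^2) set \<Rightarrow> (real^2 \<Rightarrow> real^2^2) \<Rightarrow> 2 \<Rightarrow> 2 \<Rightarrow> 2 \<Rightarrow> real^2 \<Rightarrow> real" where
  "christoffel S G k i j x = (1/2) * (\<Sum>l\<in>UNIV. matrix_inv (G x) $ k $ l *
      (pdiff S i (\<lambda>y. G y $ j $ l) x + pdiff S j (\<lambda>y. G y $ i $ l) x - pdiff S l (\<lambda>y. G y $ i $ j) x))"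

definition inner_g :: "real^2^2 \<Rightarrow> real^2 \<Rightarrow> real^2 \<Rightarrow> real" where
  "inner_g A v w = v \<bullet> (A *v w)"

text \<open>The components of the covariant derivative \<open>\<nabla>\<^sub>X Y\<close>.\<close>

definition nabla :: "(real^2) set \<Rightarrow> (real^2 \<Rightarrow> real^2^2) \<Rightarrow> (real^2 \<Rightarrow> real^2) \<Rightarrow> (real^2 \<Rightarrow> real^2)
    \<Rightarrow> real^2 \<Rightarrow> real^2" where
  "nabla S G X Y x = (\<chi> k. (\<Sum>i\<in>UNIV. X x $ i * pdiff S i (\<lambda>y. Y y $ k) x) +
      (\<Sum>i\<in>UNIV. \<Sum>j\<in>UNIV. christoffel S G k i j x * X x $ i * Y x $ j))"

definition coord_field :: "2 \<Rightarrow> real^2 \<Rightarrow> real^2" where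
  "coord_field i x = axis i 1"

text \<open>
  \<open>K = g(R(\<partial>\<^sub>1,\<partial>\<^sub>2)\<partial>\<^sub>2, \<partial>\<^sub>1) / det g\<close>, where \<open>R(\<partial>\<^sub>1,\<partial>\<^sub>2) = \<nabla>\<^sub>1\<nabla>\<^sub>2 - \<nabla>\<^sub>2\<nabla>\<^sub>1\<close> because coordinate fields commute.
\<close>

definition gauss_coord :: "(real^2) set \<Rightarrow> (real^2 \<Rightarrow> real^2^2) \<Rightarrow> real^2 \<Rightarrow> real" where
  "gauss_coord S G x =
     inner_g (G x)
       (nabla S G (coord_field 1) (nabla S G (coord_field 2) (coord_field 2)) x
         - nabla S G (coord_field 2) (nabla S G (coord_field 1) (coord_field 2)) x)
       (coord_field 1 x)
     / det (G x)"

text \<open>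
  Along the coordinate lines \<open>x $ 2 = const\<close>: the unit tangent, and the unit normal
  \<open>(\<partial>\<^sub>2 - (G\<^sub>1\<^sub>2/G\<^sub>1\<^sub>1) \<partial>\<^sub>1)\<close>, normalised, which points in the direction of increasing \<open>x $ 2\<close>.
\<close>

definition line_tangent :: "(real^2 \<Rightarrow> real^2^2) \<Rightarrow> real^2 \<Rightarrow> real^2" where
  "line_tangent G x = (1 / sqrt (G x $ 1 $ 1)) *\<^sub>R axis 1 1"

definition line_normal :: "(real^2 \<Rightarrow> real^2^2) \<Rightarrow> real^2 \<Rightarrow> real^2" where
  "line_normal G x = (1 / sqrt (G x $ 1 $ 1 * det (G x))) *\<^sub>R vector [- (G x $ 1 $ 2), G x $ 1 $ 1]"

text \<open>Geodesic curvature at \<open>x\<close> of the coordinate line \<open>x $ 2 = const\<close>, w.r.t. that normal.\<close>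

definition geod_curv_coord :: "(real^2) set \<Rightarrow> (real^2 \<Rightarrow> real^2^2) \<Rightarrow> real^2 \<Rightarrow> real" where
  "geod_curv_coord S G x =
     inner_g (G x) (nabla S G (line_tangent G) (line_normal G) x) (line_tangent G x)"


section \<open>Riemannian surfaces with boundary\<close>

text \<open>
  A chart is a pair of its domain and its coordinate map, with values in the half-plane
  \<open>x $ 2 \<ge> 0\<close>; values of the map outside the domain are irrelevant. Atlases need not be maximal.
  \<open>gmetric M c x\<close> is the component matrix in chart \<open>c\<close> at the point with coordinates \<open>x\<close>.
\<close>

type_synonym 'p chart = "'p set \<times> ('p \<Rightarrow> real^2)"

record 'p surface =
  sspace :: "'p topology"
  charts :: "'p chart set"
  gmetric :: "'p chart \<Rightarrow> real^2 \<Rightarrow> real^2^2"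

definition halfplane :: "(real^2) set" where
  "halfplane = {x. 0 \<le> x $ 2}"

definition chart_inv :: "'p chart \<Rightarrow> real^2 \<Rightarrow> 'p" where
  "chart_inv c = inv_into (fst c) (snd c)"

definition transition :: "'p chart \<Rightarrow> 'p chart \<Rightarrow> real^2 \<Rightarrow> real^2" where
  "transition c d = snd d \<circ> chart_inv c"

definition smooth_surface :: "'p surface \<Rightarrow> bool" where
  "smooth_surface M \<longleftrightarrow>
     Hausdorff_space (sspace M) \<and> second_countable (sspace M) \<and> connected_space (sspace M) \<and>
     (\<Union>c\<in>charts M. fst c) = topspace (sspace M) \<and>
     (\<forall>c\<in>charts M.
        openin (sspace M) (fst c) \<and>
        openin (top_of_set halfplane) (snd c ` fst c) \<and>
        homeomorphic_map (subtopology (sspace M) (fst c)) (top_of_set (snd c ` fst c)) (snd c)) \<and>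
     (\<forall>c\<in>charts M. \<forall>d\<in>charts M. smooth_on (snd c ` (fst c \<inter> fst d)) (transition c d))"

text \<open>
  Since images of charts are relatively open in the half-plane, derivatives at \<open>x\<close> within the image
  and within the half-plane agree; the latter is used throughout.
\<close>

definition riemannian_surface :: "'p surface \<Rightarrow> bool" where
  "riemannian_surface M \<longleftrightarrow>
     smooth_surface M \<and>
     (\<forall>c\<in>charts M.
        smooth_on (snd c ` fst c) (gmetric M c) \<and>
        (\<forall>x\<in>snd c ` fst c. transpose (gmetric M c x) = gmetric M c x \<and>
           (\<forall>v. v \<noteq> 0 \<longrightarrow> 0 < inner_g (gmetric M c x) v v))) \<and>
     (\<forall>c\<in>charts M. \<forall>d\<in>charts M. \<forall>x\<in>snd c ` (fst c \<inter> fst d).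
        let J = jacobian (transition c d) (at x within halfplane)
        in gmetric M c x = transpose J ** gmetric M d (transition c d x) ** J)"

definition bdry :: "'p surface \<Rightarrow> 'p set" where
  "bdry M = {p. \<exists>c\<in>charts M. p \<in> fst c \<and> snd c p $ 2 = 0}"

text \<open>Some chart around \<open>p\<close>; the quantities below do not depend on the choice.\<close>

definition chart_at :: "'p surface \<Rightarrow> 'p \<Rightarrow> 'p chart" where
  "chart_at M p = (SOME c. c \<in> charts M \<and> p \<in> fst c)"

definition gauss_curvature :: "'p surface \<Rightarrow> 'p \<Rightarrow> real" where
  "gauss_curvature M p =
     (let c = chart_at M p in gauss_coord halfplane (gmetric M c) (snd c p))"

text \<open>
  In a chart the boundary is the line \<open>x $ 2 = 0\<close> and the normal in the direction of increasing
  \<open>x $ 2\<close> is the inward one, i.e. (the boundary being the inner one) the normal towards infinity.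
\<close>

definition bdry_geod_curv :: "'p surface \<Rightarrow> 'p \<Rightarrow> real" where
  "bdry_geod_curv M p =
     (let c = chart_at M p in geod_curv_coord halfplane (gmetric M c) (snd c p))"

definition smooth_into :: "'d::euclidean_space set \<Rightarrow> 'p surface \<Rightarrow> ('d \<Rightarrow> 'p) \<Rightarrow> bool" where
  "smooth_into D M f \<longleftrightarrow>
     continuous_map (top_of_set D) (sspace M) f \<and>
     (\<forall>c\<in>charts M. smooth_on {x\<in>D. f x \<in> fst c} (snd c \<circ> f))"

definition pullback_metric :: "(real^2) set \<Rightarrow> 'p surface \<Rightarrow> (real^2 \<Rightarrow> 'p) \<Rightarrow> real^2 \<Rightarrow> real^2^2" where
  "pullback_metric D M f x =
     (let c = chart_at M (f x); J = jacobian (snd c \<circ> f) (at x within D)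
      in transpose J ** gmetric M c (snd c (f x)) ** J)"


section \<open>Curves in a surface\<close>

definition speed :: "'p surface \<Rightarrow> (real \<Rightarrow> 'p) \<Rightarrow> real \<Rightarrow> real" where
  "speed M \<gamma> t =
     (let c = chart_at M (\<gamma> t); v = vector_derivative (snd c \<circ> \<gamma>) (at t)
      in sqrt (inner_g (gmetric M c (snd c (\<gamma> t))) v v))"

text \<open>Piecewise smooth closed curves, parametrised by the unit interval.\<close>

definition closed_curve :: "'p surface \<Rightarrow> (real \<Rightarrow> 'p) \<Rightarrow> bool" where
  "closed_curve M \<gamma> \<longleftrightarrow>
     continuous_map (top_of_set {0..1}) (sspace M) \<gamma> \<and> \<gamma> 0 = \<gamma> 1 \<and>
     (\<exists>T. finite T \<and>
        (\<forall>a b. 0 \<le> a \<and> a < b \<and> b \<le> 1 \<and> {a<..<b} \<inter> T = {} \<longrightarrow> smooth_into {a..b} M \<gamma>))"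

definition len :: "'p surface \<Rightarrow> (real \<Rightarrow> 'p) \<Rightarrow> real" where
  "len M \<gamma> = integral {0..1} (speed M \<gamma>)"

text \<open>
  For a surface with compact boundary and one end: \<open>C\<close> separates the boundary from infinity, i.e.
  no component of the complement of \<open>C\<close> meeting the boundary is unbounded. \<open>C\<close> may touch the boundary.
\<close>

definition encloses_bdry :: "'p surface \<Rightarrow> 'p set \<Rightarrow> bool" where
  "encloses_bdry M C \<longleftrightarrow>
     (\<forall>p\<in>bdry M - C.
        compactin (sspace M)
          (sspace M closure_of
             connected_component_of_set (subtopology (sspace M) (topspace (sspace M) - C)) p))"

definition closed_geodesic :: "'p surface \<Rightarrow> (real \<Rightarrow> 'p) \<Rightarrow> bool" where
  "closed_geodesic M \<gamma> \<longleftrightarrow>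
     smooth_into UNIV M \<gamma> \<and> (\<forall>t. \<gamma> (t + 1) = \<gamma> t) \<and> (\<forall>t. speed M \<gamma> t \<noteq> 0) \<and>
     (\<forall>t. \<forall>c\<in>charts M. \<gamma> t \<in> fst c \<longrightarrow>
        (let x = snd c \<circ> \<gamma>; v = (\<lambda>s. vector_derivative x (at s)) in
         \<forall>k. vector_derivative v (at t) $ k +
           (\<Sum>i\<in>UNIV. \<Sum>j\<in>UNIV. christoffel halfplane (gmetric M c) k i j (x t) * v t $ i * v t $ j) = 0))"

definition no_enclosing_geodesic :: "'p surface \<Rightarrow> bool" where
  "no_enclosing_geodesic M \<longleftrightarrow>
     \<not> (\<exists>\<gamma>. closed_geodesic M \<gamma> \<and> range \<gamma> \<noteq> bdry M \<and> encloses_bdry M (range \<gamma>))"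

text \<open>\<open>\<beta>\<close> is a simple parametrisation of the boundary, so \<open>len M \<beta>\<close> is the length of the boundary.\<close>

definition outer_minimising :: "'p surface \<Rightarrow> bool" where
  "outer_minimising M \<longleftrightarrow>
     (\<exists>\<beta>. closed_curve M \<beta> \<and> inj_on \<beta> {0..<1} \<and> \<beta> ` {0..1} = bdry M \<and>
        (\<forall>\<gamma>. closed_curve M \<gamma> \<and> encloses_bdry M (\<gamma> ` {0..1}) \<longrightarrow> len M \<beta> \<le> len M \<gamma>))"


section \<open>The curve \<open>\<Sigma>\<close> and cylinders over it\<close>

text \<open>
  \<open>\<Sigma>\<close> is the image \<open>range \<sigma>\<close> of a regular smooth curve \<open>\<sigma>\<close> of period 1, with the induced
  Riemannian metric.
\<close>

definition simple_closed_curve :: "(real \<Rightarrow> 'e::euclidean_space) \<Rightarrow> bool" where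
  "simple_closed_curve \<sigma> \<longleftrightarrow>
     smooth_on UNIV \<sigma> \<and> (\<forall>t. vector_derivative \<sigma> (at t) \<noteq> 0) \<and>
     (\<forall>t. \<sigma> (t + 1) = \<sigma> t) \<and> inj_on \<sigma> {0..<1}"

definition curve_length :: "(real \<Rightarrow> 'e::euclidean_space) \<Rightarrow> real" where
  "curve_length \<sigma> = integral {0..1} (\<lambda>t. norm (vector_derivative \<sigma> (at t)))"

definition cyl_coords :: "(real \<Rightarrow> 'e) \<Rightarrow> ('e \<times> real \<Rightarrow> 'p) \<Rightarrow> real^2 \<Rightarrow> 'p" where
  "cyl_coords \<sigma> \<Phi> x = \<Phi> (\<sigma> (x $ 1), x $ 2)"

text \<open>
  \<open>\<Phi>\<close> is a diffeomorphism of the cylinder \<open>range \<sigma> \<times> I\<close> onto the subset \<open>U\<close> of \<open>M\<close>: a bijection,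
  smooth in the coordinates of the cylinder given by \<open>\<sigma>\<close>, with smooth inverse.
\<close>

definition cyl_diffeo ::
    "(real \<Rightarrow> 'e::euclidean_space) \<Rightarrow> real set \<Rightarrow> 'p surface \<Rightarrow> 'p set \<Rightarrow> ('e \<times> real \<Rightarrow> 'p) \<Rightarrow> bool" where
  "cyl_diffeo \<sigma> I M U \<Phi> \<longleftrightarrow>
     openin (sspace M) U \<and>
     bij_betw \<Phi> (range \<sigma> \<times> I) U \<and>
     smooth_into {x. x $ 2 \<in> I} M (cyl_coords \<sigma> \<Phi>) \<and>
     (\<forall>c\<in>charts M. smooth_on (snd c ` (fst c \<inter> U)) (inv_into (range \<sigma> \<times> I) \<Phi> \<circ> chart_inv c))"

text \<open>
  Geodesic curvature, at the point \<open>\<Phi> (\<sigma> u, \<tau>)\<close>, of the leaf \<open>\<Phi> ` (range \<sigma> \<times> {\<tau>})\<close> of the foliation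
  of \<open>M\<close> defined by a diffeomorphism \<open>\<Phi>\<close> from \<open>range \<sigma> \<times> {r0..}\<close>, w.r.t. the unit normal in the direction
  of increasing \<open>\<tau>\<close>, i.e. towards infinity.
\<close>

definition leaf_geod_curv ::
    "(real \<Rightarrow> 'e) \<Rightarrow> real \<Rightarrow> 'p surface \<Rightarrow> ('e \<times> real \<Rightarrow> 'p) \<Rightarrow> real \<Rightarrow> real \<Rightarrow> real" where
  "leaf_geod_curv \<sigma> r0 M \<Phi> u \<tau> =
     (let D = {x. r0 \<le> x $ 2}
      in geod_curv_coord D (pullback_metric D M (cyl_coords \<sigma> \<Phi>)) (vector [u, \<tau>]))"

text \<open>
  The boundary is isometric to \<open>range \<sigma>\<close>, by \<open>F\<close>, and its geodesic curvature corresponds to \<open>k\<close>.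
\<close>

definition boundary_data :: "'p surface \<Rightarrow> (real \<Rightarrow> 'e::euclidean_space) \<Rightarrow> ('e \<Rightarrow> real) \<Rightarrow> bool" where
  "boundary_data M \<sigma> k \<longleftrightarrow>
     (\<exists>F. bij_betw F (range \<sigma>) (bdry M) \<and>
        smooth_into UNIV M (F \<circ> \<sigma>) \<and>
        (\<forall>t. speed M (F \<circ> \<sigma>) t = norm (vector_derivative \<sigma> (at t))) \<and>
        (\<forall>q\<in>range \<sigma>. bdry_geod_curv M (F q) = k q))"


section \<open>Asymptotically locally hyperbolic surfaces and the Bartnik mass\<close>

text \<open>
  Coordinates at infinity are \<open>x = (\<phi>, r)\<close>, so that the index 1 belongs to \<open>\<theta>\<^sup>1 = r d\<phi>\<close> and 2 to
  \<open>\<theta>\<^sup>2 = dr / sqrt (1 + r^2)\<close>. The component of a bilinear form \<open>h\<close> on \<open>\<theta>\<^sup>i\<theta>\<^sup>j\<close> is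
  \<open>coframe_scale r i * coframe_scale r j * h $ i $ j\<close>; the hyperbolic metric has components \<open>mat 1\<close>.
\<close>

definition coframe_scale :: "real \<Rightarrow> 2 \<Rightarrow> real" where
  "coframe_scale r i = (if i = 1 then 1 / r else sqrt (1 + r^2))"

text \<open>
  \<open>Q (cis \<phi>, r)\<close> parametrises a neighbourhood of infinity. Every set \<open>{r > R'}\<close> has compact complement:
  the chart covers everything outside a compact set, and infinity is where \<open>r\<close> tends to infinity.
  The expansion determines \<open>\<mu>\<close>, and makes it continuous, symmetric and \<open>2 * pi\<close>-periodic.
\<close>

definition alh :: "'p surface \<Rightarrow> (complex \<times> real \<Rightarrow> 'p) \<Rightarrow> (real \<Rightarrow> real^2^2) \<Rightarrow> bool" where
  "alh M Q \<mu> \<longleftrightarrow>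
     (\<exists>R C. 0 < R \<and>
        cyl_diffeo cis {R<..} M (Q ` (range cis \<times> {R<..})) Q \<and>
        (\<forall>R'\<ge>R. compactin (sspace M) (topspace (sspace M) - Q ` (range cis \<times> {R'<..}))) \<and>
        (\<forall>\<phi> r i j. R < r \<longrightarrow>
           \<bar>coframe_scale r i * coframe_scale r j *
               pullback_metric {x. R < x $ 2} M (cyl_coords cis Q) (vector [\<phi>, r]) $ i $ j
             - mat 1 $ i $ j - \<mu> \<phi> $ i $ j / r^2\<bar> \<le> C / r^3))"

definition hamiltonian_mass :: "(real \<Rightarrow> real^2^2) \<Rightarrow> real" where
  "hamiltonian_mass \<mu> = 1 / (2 * pi) * integral {0..2*pi} (\<lambda>\<phi>. \<mu> \<phi> $ 2 $ 2 + 2 * \<mu> \<phi> $ 1 $ 1)"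

text \<open>
  The mass depends on the coordinates at infinity, which are therefore part of the data of an extension.
  \<open>nondeg\<close> is the non-degeneracy condition.
\<close>

definition admissible_extension ::
    "('p surface \<Rightarrow> bool) \<Rightarrow> (real \<Rightarrow> 'e::euclidean_space) \<Rightarrow> real \<Rightarrow> ('e \<Rightarrow> real) \<Rightarrow>
     'p surface \<Rightarrow> (complex \<times> real \<Rightarrow> 'p) \<Rightarrow> (real \<Rightarrow> real^2^2) \<Rightarrow> bool" where
  "admissible_extension nondeg \<sigma> r0 k M Q \<mu> \<longleftrightarrow>
     riemannian_surface M \<and> alh M Q \<mu> \<and>
     (\<forall>p\<in>topspace (sspace M). gauss_curvature M p \<ge> -1) \<and>
     curve_length \<sigma> = 2 * pi * r0 \<and> boundary_data M \<sigma> k \<and>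
     nondeg M"

text \<open>
  The points of all surfaces are taken from one fixed type, used only as a set of the cardinality of
  the continuum (the topology of a surface is a field of the record): every connected second countable
  surface can be transported to a subset of it, so all of them take part in the infimum.
\<close>

type_synonym point = "complex \<times> real"

definition bartnik_mass ::
    "(point surface \<Rightarrow> bool) \<Rightarrow> (real \<Rightarrow> 'e::euclidean_space) \<Rightarrow> real \<Rightarrow> ('e \<Rightarrow> real) \<Rightarrow> ereal" where
  "bartnik_mass nondeg \<sigma> r0 k =
     Inf {ereal (hamiltonian_mass \<mu>) | M Q \<mu>. admissible_extension nondeg \<sigma> r0 k M Q \<mu>}"

end

theory Submission
  imports Defs
begin

text \<open>
  Attach to \<open>\<Sigma>\<close>, with arc length element \<open>v du\<close>, the hyperbolic collar \<open>dt\<^sup>2 + \<rho>\<^sup>2 du\<^sup>2\<close> with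
  \<open>\<rho> = v (cosh t + k sinh t)\<close>. The second \<open>t\<close>-derivative of \<open>\<rho>\<close> is \<open>\<rho>\<close>, so \<open>K = -1\<close>, and the
  curvature of the leaf at distance \<open>t\<close> is the \<open>t\<close>-derivative of \<open>ln \<rho>\<close>, which equals \<open>k\<close> for \<open>t = 0\<close>
  and is positive for \<open>t > 0\<close>. Write \<open>\<rho> = a exp t + b exp (-t)\<close>, where \<open>a = v (1 + k) / 2\<close> and
  \<open>b = v (1 - k) / 2\<close>, and let \<open>A\<close>, \<open>B\<close> be the integrals of \<open>a\<close> and \<open>b\<close> over a period. With
  \<open>c = A / (2 \<pi>)\<close>, \<open>d\<phi> = (a / c) du\<close> and \<open>r = c exp t\<close> the expansion at infinity has
  \<open>\<mu>\<^sub>1\<^sub>1 = 2 c\<^sup>2 b / a\<close> and \<open>\<mu>\<^sub>2\<^sub>2 = 1\<close>. Hence the mass is \<open>1 + 4 A B / (2 \<pi>)\<^sup>2\<close>, at most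
  \<open>1 + ((A + B) / (2 \<pi>))\<^sup>2 = 1 + r0\<^sup>2\<close>.

  An enclosing curve meets every ray \<open>u = const\<close>, so its projection to the boundary covers it, and the
  projection does not increase length because \<open>\<rho> \<ge> v\<close>. Along a geodesic \<open>t\<close> is convex, so a closed
  geodesic stays at constant \<open>t\<close>, which forces \<open>t = 0\<close>.
\<close>

section \<open>Calculus of smooth maps\<close>

text \<open>The collar is realised on the unit circle times [0, \<infinity>), with charts that cut
  the circle at a point and an angle of period 1, as for \<open>\<sigma>\<close>. Chart changes are
  locally integer translations, so one formula for the metric serves every chart, and maps and
  curves are handled through real-valued lifts of their angle.

  The sign of k enters as \<open>0 \<le> \<kappa>\<close>. A value of k below -1 would make the
  density vanish at a finite distance; for k \<ge> 0 the density never drops below v, and a is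
  positive with |b| \<le> a. Hence a can serve as the density of the angle at infinity, and the
  error of the expansion is uniform in the angle.

  That angle is forced: the expansion must start with r^2 d\<phi>^2, so the non-constant a has to be
  absorbed by a reparametrisation, and total angle 2 pi fixes c. Against d\<phi> the quotient b / a
  integrates to B / c, so the mass depends on A and B alone. The final bound is 4 A B \<le> (A +
  B)^2, valid for either sign of B, and A + B is the length because a + b = v.

  The length comparison needs no winding number: the maximum and the minimum of a lift of an
  enclosing curve differ by at least one period.\<close>

declare ck_on.simps(2) [simp del]

lemma ck_on_SucI:
  "(\<And>p. p \<in> W \<Longrightarrow> (f has_derivative D p) (at p)) \<Longrightarrow> (\<And>h. ck_on n W (\<lambda>p. D p h)) \<Longrightarrow> ck_on (Suc n) W f"
  unfolding ck_on.simps(2) by blast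

lemma ck_on_SucE:
  assumes "ck_on (Suc n) W f"
  obtains D where "\<And>p. p \<in> W \<Longrightarrow> (f has_derivative D p) (at p)" "\<And>h. ck_on n W (\<lambda>p. D p h)"
  using assms unfolding ck_on.simps(2) by blast

text \<open>Product and chain rules return undifferentiated factors next to derivatives, so
  inductions on the order have to lower it for these factors.\<close>

lemma ck_on_mono: "ck_on (Suc n) W f \<Longrightarrow> ck_on n W f"
proof (induction n arbitrary: f)
  case 0
  then show ?case
    by (auto elim!: ck_on_SucE intro!: continuous_at_imp_continuous_on dest: has_derivative_continuous)
next
  case (Suc n)
  then show ?case by (blast elim!: ck_on_SucE[of "Suc n"] intro: ck_on_SucI)
qed

lemma ck_on_imp_continuous_on: "ck_on n W f \<Longrightarrow> continuous_on W f"
proof (induction n)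
  case (Suc n)
  then show ?case using ck_on_mono by blast
qed simp

lemma ck_on_subset: "ck_on n W f \<Longrightarrow> W' \<subseteq> W \<Longrightarrow> ck_on n W' f"
proof (induction n arbitrary: f)
  case (Suc n)
  from Suc.prems(1) obtain D where "\<And>p. p \<in> W \<Longrightarrow> (f has_derivative D p) (at p)" "\<And>h. ck_on n W (\<lambda>p. D p h)"
    by (rule ck_on_SucE) blast
  with Suc.IH Suc.prems(2) show ?case by (intro ck_on_SucI[where D=D]) blast+
qed (auto intro: continuous_on_subset)

lemma ck_on_cong:
  assumes "open W" "\<And>x. x \<in> W \<Longrightarrow> f x = g x" "ck_on n W f"
  shows "ck_on n W g"
  using assms(2,3)
proof (induction n arbitrary: f g)
  case 0
  then show ?case using continuous_on_cong by fastforce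
next
  case (Suc n)
  from Suc.prems(2) obtain D where D: "\<And>p. p \<in> W \<Longrightarrow> (f has_derivative D p) (at p)" "\<And>h. ck_on n W (\<lambda>p. D p h)"
    by (rule ck_on_SucE) blast
  have "(g has_derivative D p) (at p)" if "p \<in> W" for p
    using has_derivative_transform_within_open[OF D(1)[OF that] assms(1) that] Suc.prems(1) by blast
  then show ?case using D(2) by (rule ck_on_SucI)
qed

lemma ck_on_const: "ck_on n W (\<lambda>x. c)"
  by (induction n arbitrary: c) (auto intro!: ck_on_SucI[where D="\<lambda>p h. 0"])

lemma ck_on_linear:
  assumes "bounded_linear L" "ck_on n W f"
  shows "ck_on n W (\<lambda>x. L (f x))"
  using assms(2)
proof (induction n arbitrary: f)
  case 0
  then show ?case by (simp add: bounded_linear.continuous_on[OF assms(1)])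
next
  case (Suc n)
  from Suc.prems obtain D where D: "\<And>p. p \<in> W \<Longrightarrow> (f has_derivative D p) (at p)" "\<And>h. ck_on n W (\<lambda>p. D p h)"
    by (rule ck_on_SucE) blast
  then show ?case
    by (intro ck_on_SucI[where D="\<lambda>p h. L (D p h)"] bounded_linear.has_derivative[OF assms(1)] Suc.IH)
qed

lemma ck_on_add:
  assumes "ck_on n W f" "ck_on n W g"
  shows "ck_on n W (\<lambda>x. f x + g x)"
  using assms
proof (induction n arbitrary: f g)
  case 0
  then show ?case by (simp add: continuous_on_add)
next
  case (Suc n)
  from Suc.prems(1) obtain D where D: "\<And>p. p \<in> W \<Longrightarrow> (f has_derivative D p) (at p)" "\<And>h. ck_on n W (\<lambda>p. D p h)"
    by (rule ck_on_SucE) blast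
  from Suc.prems(2) obtain D' where D': "\<And>p. p \<in> W \<Longrightarrow> (g has_derivative D' p) (at p)" "\<And>h. ck_on n W (\<lambda>p. D' p h)"
    by (rule ck_on_SucE) blast
  from D D' show ?case
    by (intro ck_on_SucI[where D="\<lambda>p h. D p h + D' p h"] has_derivative_add Suc.IH)
qed

lemma ck_on_sum: "finite A \<Longrightarrow> (\<And>i. i \<in> A \<Longrightarrow> ck_on n W (f i)) \<Longrightarrow> ck_on n W (\<lambda>x. \<Sum>i\<in>A. f i x)"
  by (induction rule: finite_induct) (auto intro: ck_on_const ck_on_add)

lemma ck_on_bilinear:
  assumes "bounded_bilinear B" "ck_on n W f" "ck_on n W g"
  shows "ck_on n W (\<lambda>x. B (f x) (g x))"
  using assms(2,3)
proof (induction n arbitrary: f g)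
  case 0
  then show ?case by (simp add: bounded_bilinear.continuous_on[OF assms(1)])
next
  case (Suc n)
  from Suc.prems(1) obtain D where D: "\<And>p. p \<in> W \<Longrightarrow> (f has_derivative D p) (at p)" "\<And>h. ck_on n W (\<lambda>p. D p h)"
    by (rule ck_on_SucE) blast
  from Suc.prems(2) obtain D' where D': "\<And>p. p \<in> W \<Longrightarrow> (g has_derivative D' p) (at p)" "\<And>h. ck_on n W (\<lambda>p. D' p h)"
    by (rule ck_on_SucE) blast
  from D D' show ?case
    by (intro ck_on_SucI[where D="\<lambda>p h. B (f p) (D' p h) + B (D p h) (g p)"] ck_on_add
         bounded_bilinear.FDERIV[OF assms(1)] Suc.IH ck_on_mono[OF Suc.prems(1)] ck_on_mono[OF Suc.prems(2)])
qed

lemma ck_on_compose: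
  fixes f :: "'a::euclidean_space \<Rightarrow> 'b::euclidean_space" and g :: "'b \<Rightarrow> 'c::real_normed_vector"
  assumes "ck_on n W f" "ck_on n V g" "f ` W \<subseteq> V"
  shows "ck_on n W (\<lambda>x. g (f x))"
  using assms(1,2)
proof (induction n arbitrary: g)
  case 0
  then show ?case using assms(3) by (auto intro: continuous_on_compose2)
next
  case (Suc n)
  from Suc.prems(1) obtain D where D: "\<And>p. p \<in> W \<Longrightarrow> (f has_derivative D p) (at p)" "\<And>h. ck_on n W (\<lambda>p. D p h)"
    by (rule ck_on_SucE) blast
  from Suc.prems(2) obtain D' where D': "\<And>p. p \<in> V \<Longrightarrow> (g has_derivative D' p) (at p)" "\<And>h. ck_on n V (\<lambda>p. D' p h)"
    by (rule ck_on_SucE) blast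
  \<comment> \<open>The hypothesis on g controls its derivative only in fixed directions, whereas
    the direction \<open>D p h\<close> varies with p. Expanding it in the basis leaves a finite sum
    of products to which the induction hypothesis applies.\<close>
  have eq: "D' (f p) (D p h) = (\<Sum>b\<in>Basis. (D p h \<bullet> b) *\<^sub>R D' (f p) b)" if "p \<in> W" for p h
  proof -
    from that D'(1) assms(3) have "bounded_linear (D' (f p))"
      by (intro has_derivative_bounded_linear) blast
    then interpret bounded_linear "D' (f p)" .
    have "D' (f p) (D p h) = D' (f p) (\<Sum>b\<in>Basis. (D p h \<bullet> b) *\<^sub>R b)"
      by (simp add: euclidean_representation)
    then show ?thesis by (simp add: sum scale)
  qed
  have "((\<lambda>x. g (f x)) has_derivative (\<lambda>h. \<Sum>b\<in>Basis. (D p h \<bullet> b) *\<^sub>R D' (f p) b)) (at p)" if p: "p \<in> W" for p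
  proof -
    have "(g has_derivative D' (f p)) (at (f p))" using D'(1) p assms(3) by blast
    from diff_chain_at[OF D(1)[OF p] this] show ?thesis
      by (simp add: o_def eq[OF p])
  qed
  moreover have "ck_on n W (\<lambda>p. \<Sum>b\<in>Basis. (D p h \<bullet> b) *\<^sub>R D' (f p) b)" for h
    by (intro ck_on_sum finite_Basis ck_on_bilinear[OF bounded_bilinear_scaleR]
         ck_on_linear[OF bounded_linear_inner_left, of n W "\<lambda>p. D p h"] Suc.IH D D' ck_on_mono[OF Suc.prems(1)])
  ultimately show ?case by (rule ck_on_SucI)
qed

text \<open>The derivatives supplied on different neighbourhoods are unrelated witnesses; the
  Frechet derivative is a canonical choice that agrees with each of them and so glues them
  together.\<close>

lemma ck_on_local:
  assumes "\<And>p. p \<in> S \<Longrightarrow> \<exists>W. open W \<and> p \<in> W \<and> ck_on n W f"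
  shows "ck_on n S f"
  using assms
proof (induction n arbitrary: f)
  case 0
  have "continuous (at p) f" if "p \<in> S" for p
    using 0[OF that] by (auto simp: continuous_on_eq_continuous_at)
  then show ?case by (simp add: continuous_at_imp_continuous_on)
next
  case (Suc n)
  have "(f has_derivative frechet_derivative f (at p)) (at p)" if "p \<in> S" for p
    using Suc.prems[OF that]
    by (auto simp: frechet_derivative_works[symmetric] differentiable_def elim!: ck_on_SucE)
  moreover have "ck_on n S (\<lambda>p. frechet_derivative f (at p) h)" for h
  proof (rule Suc.IH)
    fix p assume "p \<in> S"
    then obtain W where W: "open W" "p \<in> W" "ck_on (Suc n) W f" using Suc.prems by blast
    from W(3) obtain D where D: "\<And>p. p \<in> W \<Longrightarrow> (f has_derivative D p) (at p)" "\<And>h. ck_on n W (\<lambda>p. D p h)"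
      by (rule ck_on_SucE) blast
    have "D p h = frechet_derivative f (at p) h" if "p \<in> W" for p
      using frechet_derivative_at[OF D(1)[OF that]] by simp
    from ck_on_cong[OF W(1) this D(2)] W
    show "\<exists>W. open W \<and> p \<in> W \<and> ck_on n W (\<lambda>p. frechet_derivative f (at p) h)" by blast
  qed
  ultimately show ?case by (rule ck_on_SucI)
qed

lemma ck_on_Suc_real:
  fixes f :: "real \<Rightarrow> 'b::real_normed_vector"
  assumes "\<And>p. p \<in> W \<Longrightarrow> (f has_vector_derivative f' p) (at p)" "ck_on n W f'"
  shows "ck_on (Suc n) W f"
  using assms unfolding has_vector_derivative_def
  by (intro ck_on_SucI[where D="\<lambda>p h. h *\<^sub>R f' p"] ck_on_linear[OF bounded_linear_scaleR_right])

section \<open>Smoothness on arbitrary subsets\<close>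

lemma smooth_on_if_ck_on:
  "open W \<Longrightarrow> S \<subseteq> W \<Longrightarrow> (\<And>n. ck_on n W f) \<Longrightarrow> smooth_on S f"
  unfolding smooth_on_def by blast

lemma smooth_onE:
  assumes "smooth_on S f" "p \<in> S"
  obtains W F where "open W" "p \<in> W" "\<And>n. ck_on n W F" "\<And>q. q \<in> S \<Longrightarrow> q \<in> W \<Longrightarrow> F q = f q"
proof -
  from assms have "\<exists>W F. open W \<and> p \<in> W \<and> (\<forall>n. ck_on n W F) \<and> (\<forall>q\<in>S \<inter> W. F q = f q)"
    unfolding smooth_on_def by (rule bspec)
  then show thesis by (elim exE conjE) (rule that, assumption, assumption, erule spec, erule bspec, simp)
qed

lemma smooth_onI:
  assumes "\<And>p. p \<in> S \<Longrightarrow> \<exists>W F. open W \<and> p \<in> W \<and> (\<forall>n. ck_on n W F) \<and> (\<forall>q. q \<in> S \<longrightarrow> q \<in> W \<longrightarrow> F q = f q)"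
  shows "smooth_on S f"
  using assms unfolding smooth_on_def Ball_def Int_iff imp_conjL by simp

text \<open>Near a point of an open set a local extension coincides with the function itself, and
  the order of differentiability is a local property.\<close>

lemma smooth_on_open_iff:
  assumes "open S"
  shows "smooth_on S f \<longleftrightarrow> (\<forall>n. ck_on n S f)"
proof
  assume L: "smooth_on S f"
  show "\<forall>n. ck_on n S f"
  proof (intro allI ck_on_local)
    fix n p assume "p \<in> S"
    with L obtain W F where W: "open W" "p \<in> W" "\<And>n. ck_on n W F" "\<And>q. q \<in> S \<Longrightarrow> q \<in> W \<Longrightarrow> F q = f q"
      by (rule smooth_onE) blast
    have "ck_on n (S \<inter> W) f"
      by (rule ck_on_cong[of _ F]) (use W assms in \<open>auto intro: ck_on_subset\<close>)
    then show "\<exists>W. open W \<and> p \<in> W \<and> ck_on n W f"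
      using W \<open>p \<in> S\<close> assms by (intro exI[of _ "S \<inter> W"]) auto
  qed
next
  assume "\<forall>n. ck_on n S f"
  then show "smooth_on S f" using assms by (intro smooth_on_if_ck_on) auto
qed

lemma smooth_on_subset:
  assumes "smooth_on S f" "S' \<subseteq> S" shows "smooth_on S' f"
proof (rule smooth_onI)
  fix p assume "p \<in> S'"
  then have "p \<in> S" using assms(2) by blast
  with assms(1) obtain W F where W: "open W" "p \<in> W" "\<And>n. ck_on n W F" "\<And>q. q \<in> S \<Longrightarrow> q \<in> W \<Longrightarrow> F q = f q"
    by (rule smooth_onE) blast
  then show "\<exists>W F. open W \<and> p \<in> W \<and> (\<forall>n. ck_on n W F) \<and> (\<forall>q. q \<in> S' \<longrightarrow> q \<in> W \<longrightarrow> F q = f q)"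
    using assms(2) by (intro exI[of _ W] exI[of _ F]) auto
qed

lemma smooth_on_cong:
  assumes "smooth_on S f" "\<And>x. x \<in> S \<Longrightarrow> f x = g x" shows "smooth_on S g"
proof (rule smooth_onI)
  fix p assume "p \<in> S"
  with assms(1) obtain W F where W: "open W" "p \<in> W" "\<And>n. ck_on n W F" "\<And>q. q \<in> S \<Longrightarrow> q \<in> W \<Longrightarrow> F q = f q"
    by (rule smooth_onE) blast
  then show "\<exists>W F. open W \<and> p \<in> W \<and> (\<forall>n. ck_on n W F) \<and> (\<forall>q. q \<in> S \<longrightarrow> q \<in> W \<longrightarrow> F q = g q)"
    using assms(2) by (intro exI[of _ W] exI[of _ F]) auto
qed

lemma smooth_on_local:
  assumes "\<And>p. p \<in> S \<Longrightarrow> \<exists>W. open W \<and> p \<in> W \<and> smooth_on (S \<inter> W) f"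
  shows "smooth_on S f"
proof (rule smooth_onI)
  fix p assume p: "p \<in> S"
  then obtain W where W: "open W" "p \<in> W" "smooth_on (S \<inter> W) f" using assms by blast
  from W(3) obtain V F where V: "open V" "p \<in> V" "\<And>n. ck_on n V F" "\<And>q. q \<in> S \<inter> W \<Longrightarrow> q \<in> V \<Longrightarrow> F q = f q"
    by (rule smooth_onE) (use p W in blast)+
  show "\<exists>W F. open W \<and> p \<in> W \<and> (\<forall>n. ck_on n W F) \<and> (\<forall>q. q \<in> S \<longrightarrow> q \<in> W \<longrightarrow> F q = f q)"
    using V W by (intro exI[of _ "W \<inter> V"] exI[of _ F]) (auto intro: ck_on_subset)
qed

lemma smooth_on_imp_continuous_on:
  assumes "smooth_on S f" shows "continuous_on S f"
proof -
  have "continuous (at p within S) f" if p: "p \<in> S" for p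
  proof -
    from assms p obtain W F where W: "open W" "p \<in> W" "\<And>n. ck_on n W F" "\<And>q. q \<in> S \<Longrightarrow> q \<in> W \<Longrightarrow> F q = f q"
      by (rule smooth_onE) blast
    have "continuous (at p within S) F"
      using W ck_on_imp_continuous_on[OF W(3)]
      by (simp add: continuous_on_eq_continuous_at continuous_at_imp_continuous_at_within)
    moreover have "eventually (\<lambda>q. F q = f q) (at p within S)"
      unfolding eventually_at_topological using W by blast
    moreover have "F p = f p" using W p by blast
    ultimately show ?thesis
      unfolding continuous_within by (auto elim: Lim_transform_eventually)
  qed
  then show ?thesis by (simp add: continuous_on_eq_continuous_within)
qed

lemma smooth_on_const: "smooth_on S (\<lambda>x. c)"
  by (rule smooth_on_if_ck_on[of UNIV]) (auto intro: ck_on_const)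

lemma smooth_on_linear:
  assumes "bounded_linear L" "smooth_on S f" shows "smooth_on S (\<lambda>x. L (f x))"
proof (rule smooth_onI)
  fix p assume "p \<in> S"
  with assms(2) obtain W F where W: "open W" "p \<in> W" "\<And>n. ck_on n W F" "\<And>q. q \<in> S \<Longrightarrow> q \<in> W \<Longrightarrow> F q = f q"
    by (rule smooth_onE) blast
  then show "\<exists>W F. open W \<and> p \<in> W \<and> (\<forall>n. ck_on n W F) \<and> (\<forall>q. q \<in> S \<longrightarrow> q \<in> W \<longrightarrow> F q = L (f q))"
    by (intro exI[of _ W] exI[of _ "\<lambda>x. L (F x)"]) (auto intro: ck_on_linear[OF assms(1)])
qed

lemma smooth_on_bilinear:
  assumes "bounded_bilinear B" "smooth_on S f" "smooth_on S g" shows "smooth_on S (\<lambda>x. B (f x) (g x))"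
proof (rule smooth_onI)
  fix p assume p: "p \<in> S"
  from assms(2) p obtain W F where W: "open W" "p \<in> W" "\<And>n. ck_on n W F" "\<And>q. q \<in> S \<Longrightarrow> q \<in> W \<Longrightarrow> F q = f q"
    by (rule smooth_onE) blast
  from assms(3) p obtain V H where V: "open V" "p \<in> V" "\<And>n. ck_on n V H" "\<And>q. q \<in> S \<Longrightarrow> q \<in> V \<Longrightarrow> H q = g q"
    by (rule smooth_onE) blast
  show "\<exists>W F. open W \<and> p \<in> W \<and> (\<forall>n. ck_on n W F) \<and> (\<forall>q. q \<in> S \<longrightarrow> q \<in> W \<longrightarrow> F q = B (f q) (g q))"
    using V W by (intro exI[of _ "W \<inter> V"] exI[of _ "\<lambda>x. B (F x) (H x)"])
      (auto intro!: ck_on_bilinear[OF assms(1)] intro: ck_on_subset)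
qed

lemma smooth_on_add:
  assumes "smooth_on S f" "smooth_on S g" shows "smooth_on S (\<lambda>x. f x + g x)"
proof (rule smooth_onI)
  fix p assume p: "p \<in> S"
  from assms(1) p obtain W F where W: "open W" "p \<in> W" "\<And>n. ck_on n W F" "\<And>q. q \<in> S \<Longrightarrow> q \<in> W \<Longrightarrow> F q = f q"
    by (rule smooth_onE) blast
  from assms(2) p obtain V H where V: "open V" "p \<in> V" "\<And>n. ck_on n V H" "\<And>q. q \<in> S \<Longrightarrow> q \<in> V \<Longrightarrow> H q = g q"
    by (rule smooth_onE) blast
  show "\<exists>W F. open W \<and> p \<in> W \<and> (\<forall>n. ck_on n W F) \<and> (\<forall>q. q \<in> S \<longrightarrow> q \<in> W \<longrightarrow> F q = f q + g q)"
    using V W by (intro exI[of _ "W \<inter> V"] exI[of _ "\<lambda>x. F x + H x"])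
      (auto intro!: ck_on_add intro: ck_on_subset)
qed

lemma smooth_on_sum: "finite A \<Longrightarrow> (\<And>i. i \<in> A \<Longrightarrow> smooth_on S (f i)) \<Longrightarrow> smooth_on S (\<lambda>x. \<Sum>i\<in>A. f i x)"
  by (induction rule: finite_induct) (auto intro: smooth_on_const smooth_on_add)

lemma smooth_on_mult:
  fixes f g :: "'a::euclidean_space \<Rightarrow> real"
  shows "smooth_on S f \<Longrightarrow> smooth_on S g \<Longrightarrow> smooth_on S (\<lambda>x. f x * g x)"
  by (rule smooth_on_bilinear[OF bounded_bilinear_mult])

lemma smooth_on_scaleR:
  "smooth_on S f \<Longrightarrow> smooth_on S g \<Longrightarrow> smooth_on S (\<lambda>x. f x *\<^sub>R g x)"
  by (rule smooth_on_bilinear[OF bounded_bilinear_scaleR])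

lemma smooth_on_uminus: "smooth_on S f \<Longrightarrow> smooth_on S (\<lambda>x. - f x)"
  by (rule smooth_on_linear[OF bounded_linear_minus[OF bounded_linear_ident]])

lemma smooth_on_minus: "smooth_on S f \<Longrightarrow> smooth_on S g \<Longrightarrow> smooth_on S (\<lambda>x. f x - g x)"
  using smooth_on_add[of S f "\<lambda>x. - g x"] smooth_on_uminus[of S g] by simp

lemma smooth_on_power:
  fixes f :: "'a::euclidean_space \<Rightarrow> real"
  shows "smooth_on S f \<Longrightarrow> smooth_on S (\<lambda>x. f x ^ n)"
  by (induction n) (auto intro: smooth_on_const smooth_on_mult)

lemma smooth_on_compose:
  fixes f :: "'a::euclidean_space \<Rightarrow> 'b::euclidean_space" and g :: "'b \<Rightarrow> 'c::real_normed_vector"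
  assumes "smooth_on S f" "smooth_on V g" "open V" "f ` S \<subseteq> V"
  shows "smooth_on S (\<lambda>x. g (f x))"
proof (rule smooth_onI)
  fix p assume p: "p \<in> S"
  from assms(1) p obtain W F where W: "open W" "p \<in> W" "\<And>n. ck_on n W F" "\<And>q. q \<in> S \<Longrightarrow> q \<in> W \<Longrightarrow> F q = f q"
    by (rule smooth_onE) blast
  have o: "open (W \<inter> F -` V)"
    using W(1) assms(3) ck_on_imp_continuous_on[OF W(3)] by (metis continuous_on_open_vimage inf_commute)
  have g: "ck_on n V g" for n using assms(2,3) smooth_on_open_iff by blast
  have "p \<in> W \<inter> F -` V" using W p assms(4) by auto
  moreover have "ck_on n (W \<inter> F -` V) (\<lambda>x. g (F x))" for n
    by (rule ck_on_compose[OF ck_on_subset[OF W(3)] g]) auto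
  ultimately show "\<exists>W F. open W \<and> p \<in> W \<and> (\<forall>n. ck_on n W F) \<and> (\<forall>q. q \<in> S \<longrightarrow> q \<in> W \<longrightarrow> F q = g (f q))"
    using W(4) o by (intro exI[of _ "W \<inter> F -` V"] exI[of _ "\<lambda>x. g (F x)"]) auto
qed

lemma smooth_on_id: "smooth_on S (\<lambda>x. x)"
proof (rule smooth_on_if_ck_on[of UNIV])
  show "ck_on n UNIV (\<lambda>x::'a. x)" for n
    by (cases n) (auto intro!: ck_on_SucI[where D="\<lambda>p h. h"] ck_on_const)
qed auto

lemma smooth_on_nth: "smooth_on S f \<Longrightarrow> smooth_on S (\<lambda>x. f x $ i)"
  by (rule smooth_on_linear[OF bounded_linear_vec_nth])

lemma smooth_on_vec:
  fixes f :: "'a::euclidean_space \<Rightarrow> 'b::real_normed_vector^'n"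
  assumes "\<And>i. smooth_on S (\<lambda>x. f x $ i)" shows "smooth_on S f"
proof -
  have lin: "bounded_linear (\<lambda>y::'b. axis i y :: 'b^'n)" for i
  proof (rule bounded_linear_intro[where K=1])
    show "norm (axis i x :: 'b^'n) \<le> norm x * 1" for x :: 'b
      by (simp add: norm_vec_def L2_set_def axis_def if_distrib[of norm] if_distrib[of "\<lambda>x. x^2"] cong: if_cong)
  qed (auto simp: axis_def vec_eq_iff)
  have "f x = (\<Sum>i\<in>UNIV. axis i (f x $ i))" for x
    by (simp add: vec_eq_iff axis_def if_distrib cong: if_cong)
  moreover have "smooth_on S (\<lambda>x. \<Sum>i\<in>UNIV. axis i (f x $ i) :: 'b^'n)"
    by (intro smooth_on_sum finite smooth_on_linear[OF lin] assms)
  ultimately show ?thesis by simp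
qed

lemma smooth_on_Pair:
  assumes "smooth_on S f" "smooth_on S g" shows "smooth_on S (\<lambda>x. (f x, g x))"
proof -
  have "smooth_on S (\<lambda>x. (f x, 0) + (0, g x))"
    by (intro smooth_on_add smooth_on_linear[OF bounded_linear_Pair[OF bounded_linear_ident bounded_linear_zero]]
       smooth_on_linear[OF bounded_linear_Pair[OF bounded_linear_zero bounded_linear_ident]] assms)
  then show ?thesis by simp
qed

lemma smooth_on_real_deriv:
  fixes f :: "real \<Rightarrow> 'b::real_normed_vector"
  assumes "open S" "\<And>p. p \<in> S \<Longrightarrow> (f has_vector_derivative f' p) (at p)" "smooth_on S f'"
  shows "smooth_on S f"
  unfolding smooth_on_open_iff[OF assms(1)]
proof
  fix n
  show "ck_on n S f"
    by (rule ck_on_mono, rule ck_on_Suc_real[OF assms(2)]) (use assms in \<open>auto simp: smooth_on_open_iff\<close>)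
qed

lemma smooth_on_real_derivD:
  fixes f :: "real \<Rightarrow> 'b::real_normed_vector"
  assumes "open S" "smooth_on S f"
  shows "\<And>p. p \<in> S \<Longrightarrow> (f has_vector_derivative vector_derivative f (at p)) (at p)"
    and "smooth_on S (\<lambda>p. vector_derivative f (at p))"
proof -
  have ck: "ck_on n S f" for n using assms smooth_on_open_iff by blast
  show 1: "(f has_vector_derivative vector_derivative f (at p)) (at p)" if p: "p \<in> S" for p
  proof -
    from ck[of "Suc 0"] p have "f differentiable (at p)"
      by (auto simp: differentiable_def elim!: ck_on_SucE)
    then show ?thesis using vector_derivative_works by blast
  qed
  have "ck_on n S (\<lambda>p. vector_derivative f (at p))" for n
  proof -
    from ck[of "Suc n"] obtain D where D: "\<And>p. p \<in> S \<Longrightarrow> (f has_derivative D p) (at p)" "\<And>h. ck_on n S (\<lambda>p. D p h)"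
      by (rule ck_on_SucE) blast
    have "D p 1 = vector_derivative f (at p)" if "p \<in> S" for p
    proof -
      have "D p = (\<lambda>h. h *\<^sub>R vector_derivative f (at p))"
        using D(1) that 1[OF that] has_derivative_unique unfolding has_vector_derivative_def by blast
      then show ?thesis by simp
    qed
    from ck_on_cong[OF assms(1) this D(2)] show ?thesis .
  qed
  then show "smooth_on S (\<lambda>p. vector_derivative f (at p))" using assms(1) smooth_on_open_iff by blast
qed

text \<open>Bootstrapping: the derivative \<open>g (f p)\<close> inherits the order of f, which
  raises the order of f by one. The exponential, \<open>cis\<close>, the reciprocal and later the
  inverse of the angle at infinity all solve such an equation.\<close>

lemma smooth_on_autonomous:
  fixes f :: "real \<Rightarrow> 'b::euclidean_space"
  assumes "open S" "open V" "f ` S \<subseteq> V" "smooth_on V g"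
    and "\<And>p. p \<in> S \<Longrightarrow> (f has_vector_derivative g (f p)) (at p)"
  shows "smooth_on S f"
  unfolding smooth_on_open_iff[OF assms(1)]
proof
  have g: "ck_on n V g" for n using assms smooth_on_open_iff by blast
  fix n show "ck_on n S f"
  proof (induction n)
    case 0
    then show ?case
      using assms(5) by (auto intro!: continuous_at_imp_continuous_on has_vector_derivative_continuous)
  next
    case (Suc n)
    then show ?case by (intro ck_on_Suc_real[OF assms(5)] ck_on_compose[OF _ g assms(3)])
  qed
qed

section \<open>Smoothness of elementary functions\<close>

lemma smooth_on_exp: "smooth_on UNIV (exp :: real \<Rightarrow> real)"
  by (rule smooth_on_autonomous[of UNIV UNIV _ "\<lambda>x. x"])
    (auto intro!: smooth_on_id DERIV_exp simp: has_real_derivative_iff_has_vector_derivative[symmetric])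

lemma smooth_on_cis: "smooth_on UNIV cis"
  by (rule smooth_on_autonomous[of UNIV UNIV _ "\<lambda>z. \<i> * z"])
    (auto intro!: smooth_on_linear[OF bounded_linear_mult_left] smooth_on_id derivative_eq_intros
      simp: has_vector_derivative_def scaleR_conv_of_real mult_ac cis_conv_exp)

lemma smooth_on_cosh: "smooth_on UNIV (cosh :: real \<Rightarrow> real)"
  and smooth_on_sinh: "smooth_on UNIV (sinh :: real \<Rightarrow> real)"
proof -
  have "smooth_on UNIV (\<lambda>x::real. exp (- x))"
    by (intro smooth_on_compose[OF _ smooth_on_exp] smooth_on_linear[OF bounded_linear_minus[OF bounded_linear_ident]]
        smooth_on_id) auto
  then have "smooth_on UNIV (\<lambda>x::real. (1/2) * (exp x + exp (- x)))"
    "smooth_on UNIV (\<lambda>x::real. (1/2) * (exp x - exp (- x)))"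
    by (intro smooth_on_mult smooth_on_const smooth_on_add smooth_on_minus smooth_on_exp; simp)+
  then show "smooth_on UNIV (cosh :: real \<Rightarrow> real)" "smooth_on UNIV (sinh :: real \<Rightarrow> real)"
    by (simp_all add: cosh_field_def[abs_def] sinh_field_def[abs_def])
qed

lemma smooth_on_inverse: "smooth_on {0<..} (inverse :: real \<Rightarrow> real)"
proof -
  have "smooth_on {0<..} (\<lambda>x. (inverse x :: real))"
    by (rule smooth_on_autonomous[of _ UNIV _ "\<lambda>x. - (x^2)"])
     (auto intro!: smooth_on_uminus smooth_on_mult smooth_on_id
       derivative_eq_intros
       simp: has_real_derivative_iff_has_vector_derivative[symmetric] power2_eq_square)
  then show ?thesis by simp
qed

lemma smooth_on_ln: "smooth_on {0<..} (ln :: real \<Rightarrow> real)"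
  by (rule smooth_on_real_deriv[of _ _ inverse])
    (auto intro!: smooth_on_inverse DERIV_ln simp: has_real_derivative_iff_has_vector_derivative[symmetric])

lemma smooth_on_sqrt: "smooth_on {0<..} sqrt"
proof (rule smooth_on_cong)
  show "smooth_on {0<..} (\<lambda>x::real. exp (ln x * (1/2)))"
    by (intro smooth_on_compose[OF _ smooth_on_exp] smooth_on_mult smooth_on_ln smooth_on_const) auto
next
  fix x :: real assume "x \<in> {0<..}"
  then have "ln x * (1/2) = ln (sqrt x)" "0 < sqrt x" by (simp_all add: ln_sqrt)
  then show "exp (ln x * (1/2)) = sqrt x" by (simp only: exp_ln)
qed

lemma smooth_on_divide:
  fixes f g :: "'a::euclidean_space \<Rightarrow> real"
  assumes "smooth_on S f" "smooth_on S g" "\<And>x. x \<in> S \<Longrightarrow> 0 < g x"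
  shows "smooth_on S (\<lambda>x. f x / g x)"
  unfolding divide_inverse
  by (intro smooth_on_mult assms smooth_on_compose[OF assms(2) smooth_on_inverse]) (use assms(3) in auto)

section \<open>Curvature of metrics in semigeodesic coordinates\<close>

text \<open>Room for small positive steps along both axes is all that uniqueness of a derivative
  within the set requires; this treats boundary points of a half-plane and interior points
  alike.\<close>

definition upward :: "(real^2) set \<Rightarrow> bool" where
  "upward S \<longleftrightarrow> (\<forall>x\<in>S. \<forall>i. \<forall>d>0. x + d *\<^sub>R axis i 1 \<in> S)"

lemma upward_halfplanes:
  "upward halfplane" "upward {x. c \<le> x $ 2}" "upward {x. c < x $ 2}" "upward {x. x $ 2 \<in> {c..}}"
  "upward {x. x $ 2 \<in> {c<..}}"
  by (auto simp: upward_def halfplane_def axis_def intro: add_increasing2 order_less_le_trans)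

lemma upward_has_derivative_unique:
  fixes f :: "real^2 \<Rightarrow> 'b::real_normed_vector"
  assumes "upward S" "x \<in> S" "(f has_derivative f') (at x within S)" "(f has_derivative f'') (at x within S)"
  shows "f' = f''"
  using assms(3,4)
proof (rule frechet_derivative_unique_within)
  fix i :: "real^2" and e :: real
  assume "i \<in> Basis" "e > 0"
  then obtain j where "i = axis j 1" by (auto simp: Basis_vec_def)
  with assms(1,2) \<open>e > 0\<close> show "\<exists>d. 0 < \<bar>d\<bar> \<and> \<bar>d\<bar> < e \<and> x + d *\<^sub>R i \<in> S"
    by (intro exI[of _ "e/2"]) (auto simp: upward_def)
qed

lemma upward_frechet_derivative:
  fixes f :: "real^2 \<Rightarrow> 'b::real_normed_vector"
  assumes "upward S" "x \<in> S" "(f has_derivative f') (at x within S)"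
  shows "frechet_derivative f (at x within S) = f'"
proof -
  have "(f has_derivative frechet_derivative f (at x within S)) (at x within S)"
    using assms(3) frechet_derivative_works differentiable_def by blast
  then show ?thesis using upward_has_derivative_unique assms by blast
qed

lemma pdiff_eq:
  assumes "upward S" "x \<in> S" "(g has_derivative g') (at x within S)" "\<And>y. y \<in> S \<Longrightarrow> f y = g y"
  shows "pdiff S i f x = g' (axis i 1)"
proof -
  have "(f has_derivative g') (at x within S)"
    using has_derivative_transform[OF assms(2,4,3)] .
  from upward_frechet_derivative[OF assms(1,2) this] show ?thesis by (simp add: pdiff_def)
qed

lemma pdiff_const: "upward S \<Longrightarrow> x \<in> S \<Longrightarrow> (\<And>y. y \<in> S \<Longrightarrow> f y = c) \<Longrightarrow> pdiff S i f x = 0"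
  using pdiff_eq[of S x "\<lambda>_. c" "\<lambda>_. 0" f i] by simp

definition dmat :: "real \<Rightarrow> real^2^2" where
  "dmat e = (\<chi> i j. if i = j then if i = 1 then e else 1 else 0)"

lemma dmat_nth [simp]:
  "dmat e $ 1 $ 1 = e" "dmat e $ 1 $ 2 = 0" "dmat e $ 2 $ 1 = 0" "dmat e $ 2 $ 2 = 1"
  by (simp_all add: dmat_def)

lemma dmat_mult: "dmat a ** dmat b = dmat (a * b)"
  by (simp add: matrix_matrix_mult_def dmat_def vec_eq_iff forall_2 sum_2)

lemma dmat_one: "dmat 1 = mat 1"
  by (simp add: dmat_def mat_def vec_eq_iff)

lemma matrix_inv_dmat:
  assumes "e \<noteq> 0" shows "matrix_inv (dmat e) = dmat (1 / e)"
  unfolding matrix_inv_def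
proof (rule some_equality)
  show *: "dmat e ** dmat (1 / e) = mat 1 \<and> dmat (1 / e) ** dmat e = mat 1"
    using assms by (simp add: dmat_mult dmat_one)
  show "B = dmat (1 / e)" if "dmat e ** B = mat 1 \<and> B ** dmat e = mat 1" for B :: "real^2^2"
    using that * by (metis matrix_mul_assoc matrix_mul_lid matrix_mul_rid)
qed

lemma inner_g_dmat: "inner_g (dmat e) v w = e * v $ 1 * w $ 1 + v $ 2 * w $ 2"
  by (simp add: inner_g_def inner_vec_def matrix_vector_mult_def sum_2)

text \<open>Fermi coordinates: the metric is E dx1^2 + dx2^2, and the lines x1 = const are unit
  speed geodesics. With \<open>D\<close> as a parameter the Christoffel symbols become explicit
  functions of the point, which can be differentiated once more for the curvature.\<close>

locale semigeodesic =
  fixes S :: "(real^2) set" and G :: "real^2 \<Rightarrow> real^2^2" and E :: "real^2 \<Rightarrow> real"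
    and D :: "real^2 \<Rightarrow> real^2 \<Rightarrow> real"
  assumes up: "upward S" and G: "\<And>y. y \<in> S \<Longrightarrow> G y = dmat (E y)" and E_pos: "\<And>y. y \<in> S \<Longrightarrow> 0 < E y"
    and D: "\<And>y. y \<in> S \<Longrightarrow> (E has_derivative D y) (at y within S)"
begin

lemma pdiff_G:
  assumes "x \<in> S"
  shows "pdiff S i (\<lambda>y. G y $ 1 $ 1) x = D x (axis i 1)" "pdiff S i (\<lambda>y. G y $ 1 $ 2) x = 0"
    "pdiff S i (\<lambda>y. G y $ 2 $ 1) x = 0" "pdiff S i (\<lambda>y. G y $ 2 $ 2) x = 0"
  using assms by (auto intro!: pdiff_eq[OF up assms D[OF assms]] pdiff_const[OF up assms] simp: G)

lemma christoffel_eq: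
  assumes "x \<in> S"
  shows "christoffel S G 1 1 1 x = D x (axis 1 1) / (2 * E x)"
    "christoffel S G 1 1 2 x = D x (axis 2 1) / (2 * E x)"
    "christoffel S G 1 2 1 x = D x (axis 2 1) / (2 * E x)"
    "christoffel S G 1 2 2 x = 0"
    "christoffel S G 2 1 1 x = - D x (axis 2 1) / 2"
    "christoffel S G 2 1 2 x = 0"
    "christoffel S G 2 2 1 x = 0"
    "christoffel S G 2 2 2 x = 0"
  using E_pos[OF assms] unfolding christoffel_def
  by (simp_all add: sum_2 pdiff_G[OF assms] G[OF assms] matrix_inv_dmat)

lemma nabla_coord_field:
  assumes "x \<in> S"
  shows "nabla S G (coord_field i) (coord_field j) x = (\<chi> k. christoffel S G k i j x)"
proof -
  have "pdiff S l (\<lambda>y. coord_field j y $ k) x = 0" for l k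
    by (rule pdiff_const[OF up assms]) (simp add: coord_field_def)
  then show ?thesis
    using exhaust_2[of i] exhaust_2[of j]
    by (auto simp: nabla_def sum_2 vec_eq_iff) (simp_all add: coord_field_def axis_def)
qed

text \<open>Put w = E_2 / (2 E). The derivative of the second coordinate field along itself
  vanishes, and along the first it is w times the first field; differentiating the latter along x2
  produces w_2 + w^2. This is the Riccati equation for the curvature w of the lines x2 =
  const.\<close>

lemma gauss_coord_eq:
  assumes x: "x \<in> S" and w: "((\<lambda>y. D y (axis 2 1) / (2 * E y)) has_derivative w') (at x within S)"
  shows "gauss_coord S G x = - (w' (axis 2 1) + (D x (axis 2 1) / (2 * E x))\<^sup>2)"
proof -
  have n12: "nabla S G (coord_field 1) (coord_field 2) y = axis 1 (D y (axis 2 1) / (2 * E y))" if "y \<in> S" for y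
    using that by (simp add: nabla_coord_field vec_eq_iff forall_2 christoffel_eq axis_def)
  have n22: "nabla S G (coord_field 2) (coord_field 2) y = 0" if "y \<in> S" for y
    using that by (simp add: nabla_coord_field vec_eq_iff forall_2 christoffel_eq)
  have "pdiff S l (\<lambda>y. nabla S G (coord_field 2) (coord_field 2) y $ k) x = 0" for l k
    by (rule pdiff_const[OF up x]) (simp add: n22)
  then have 1: "nabla S G (coord_field 1) (nabla S G (coord_field 2) (coord_field 2)) x = 0"
    using x by (simp add: nabla_def[of S G "coord_field 1"] n22 vec_eq_iff)
  have p1: "pdiff S 2 (\<lambda>y. nabla S G (coord_field 1) (coord_field 2) y $ 1) x = w' (axis 2 1)"
    by (rule pdiff_eq[OF up x w]) (simp add: n12)
  have "nabla S G (coord_field 2) (nabla S G (coord_field 1) (coord_field 2)) x $ 1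
      = w' (axis 2 1) + (D x (axis 2 1) / (2 * E x))\<^sup>2"
    using x by (simp add: nabla_def[of S G "coord_field 2"] sum_2 p1 n12 christoffel_eq coord_field_def axis_def power2_eq_square)
  then show ?thesis
    using E_pos[OF x] x
    by (simp add: gauss_coord_def 1 G inner_g_dmat det_2 coord_field_def axis_def)
qed

text \<open>The unit normal is the constant field \<open>axis 2 1\<close>, so only the Christoffel
  term of its covariant derivative survives.\<close>

lemma geod_curv_coord_eq:
  assumes x: "x \<in> S"
  shows "geod_curv_coord S G x = D x (axis 2 1) / (2 * E x)"
proof -
  have n: "line_normal G y = axis 2 1" if "y \<in> S" for y
    using E_pos[OF that] by (simp add: line_normal_def G[OF that] det_2 vec_eq_iff forall_2 axis_def)
  have p: "pdiff S l (\<lambda>y. line_normal G y $ k) x = 0" for l k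
    by (rule pdiff_const[OF up x, of _ "(axis 2 1 :: real^2) $ k"]) (simp add: n)
  have "nabla S G (line_tangent G) (line_normal G) x $ 1
     = D x (axis 2 1) / (2 * E x) * (1 / sqrt (E x))"
    using x by (simp add: nabla_def sum_2 p n christoffel_eq line_tangent_def axis_def G)
  then show ?thesis
    using E_pos[OF x] x
    by (simp add: geod_curv_coord_def inner_g_dmat G line_tangent_def axis_def real_sqrt_mult_self)
qed

end

section \<open>Charts of the cylinder\<close>

definition cylinder :: "point set" where
  "cylinder = {p. norm (fst p) = 1 \<and> 0 \<le> snd p}"

definition unroll :: "real^2 \<Rightarrow> point" where
  "unroll x = (cis (2 * pi * x $ 1), x $ 2)"

text \<open>The chart with cut at \<open>cis (2 * pi * b)\<close>; its angle takes values in \<open>(b, b + 1)\<close>.\<close>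

definition cyl_dom :: "real \<Rightarrow> point set" where
  "cyl_dom b = {p \<in> cylinder. fst p \<noteq> cis (2 * pi * b)}"

text \<open>Division by the antipode of the cut moves the cut to the negative real axis, where
  \<open>Arg\<close> has its jump; the summand \<open>b + 1/2\<close> restores the angle.\<close>

definition cyl_map :: "real \<Rightarrow> point \<Rightarrow> real^2" where
  "cyl_map b p = vector [b + 1/2 + Arg (fst p / cis (2 * pi * (b + 1/2))) / (2 * pi), snd p]"

definition strip :: "real \<Rightarrow> (real^2) set" where
  "strip b = {x. b < x $ 1 \<and> x $ 1 < b + 1 \<and> 0 \<le> x $ 2}"

lemma vector2_eq: "(vector [a, b] :: real^2) = a *\<^sub>R axis 1 1 + b *\<^sub>R axis 2 1"
  by (simp add: vec_eq_iff forall_2 axis_def)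

lemma vector2_nth: "(vector [x $ 1, x $ 2] :: real^2) = x"
  by (simp add: vec_eq_iff forall_2)

lemma smooth_on_vector2:
  "smooth_on S f \<Longrightarrow> smooth_on S g \<Longrightarrow> smooth_on S (\<lambda>x. vector [f x, g x] :: real^2)"
  unfolding vector2_eq by (intro smooth_on_add smooth_on_scaleR smooth_on_const)

lemma cis_2pi_eq_iff: "cis (2 * pi * x) = cis (2 * pi * y) \<longleftrightarrow> (\<exists>n::int. x = y + of_int n)"
proof -
  have "cis (2 * pi * x) = cis (2 * pi * y) \<longleftrightarrow> (\<exists>n::int. 2 * pi * x = 2 * pi * y + 2 * pi * of_int n)"
    using sin_cos_eq_iff[of "2 * pi * x" "2 * pi * y"] by (auto simp: complex_eq_iff)
  also have "\<dots> \<longleftrightarrow> (\<exists>n::int. 2 * pi * x = 2 * pi * (y + of_int n))"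
    by (simp add: ring_distribs)
  finally show ?thesis by simp
qed

lemma cis_2pi_shift: "cis (2 * pi * (x + of_int n)) = cis (2 * pi * x)"
  using cis_2pi_eq_iff by blast

lemma cylinder_cases:
  assumes "p \<in> cylinder" obtains u t where "p = (cis (2 * pi * u), t)" "0 \<le> t"
proof -
  from assms have "fst p = cis (2 * pi * (Arg (fst p) / (2 * pi)))"
    using rcis_cmod_Arg[of "fst p"] by (simp add: cylinder_def rcis_def)
  with assms show thesis
    by (intro that[of "Arg (fst p) / (2 * pi)" "snd p"]) (auto simp: cylinder_def prod_eq_iff)
qed

lemma unroll_in_cylinder: "0 \<le> x $ 2 \<Longrightarrow> unroll x \<in> cylinder"
  by (simp add: unroll_def cylinder_def)

lemma cis_in_cyl_dom_iff:
  "(cis (2 * pi * u), t) \<in> cyl_dom b \<longleftrightarrow> 0 \<le> t \<and> (\<exists>n::int. b + n < u \<and> u < b + n + 1)"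
proof -
  have "cis (2 * pi * u) \<noteq> cis (2 * pi * b) \<longleftrightarrow> (\<exists>n::int. b + n < u \<and> u < b + n + 1)"
  proof
    assume A: "cis (2 * pi * u) \<noteq> cis (2 * pi * b)"
    have "u \<noteq> b + of_int \<lfloor>u - b\<rfloor>" using A cis_2pi_eq_iff by blast
    then have "b + of_int \<lfloor>u - b\<rfloor> < u" "u < b + of_int \<lfloor>u - b\<rfloor> + 1" by linarith+
    then show "\<exists>n::int. b + n < u \<and> u < b + n + 1" by blast
  next
    assume "\<exists>n::int. b + n < u \<and> u < b + n + 1"
    then obtain n :: int where n: "b + n < u" "u < b + n + 1" by blast
    show "cis (2 * pi * u) \<noteq> cis (2 * pi * b)"
    proof
      assume "cis (2 * pi * u) = cis (2 * pi * b)"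
      then obtain m :: int where "u = b + of_int m" using cis_2pi_eq_iff by blast
      with n have "n < m" "m < n + 1" by linarith+
      then show False by simp
    qed
  qed
  then show ?thesis by (auto simp: cyl_dom_def cylinder_def)
qed

lemma cyl_map_cis:
  fixes n :: int and b u :: real
  assumes "b + n < u" "u < b + n + 1"
  shows "cyl_map b (cis (2 * pi * u), t) = vector [u - n, t]"
proof -
  define w where "w = 2 * pi * (u - of_int n - (b + 1/2))"
  have "cis (2 * pi * u) / cis (2 * pi * (b + 1/2)) = cis (2 * pi * ((u - n) + of_int n)) / cis (2 * pi * (b + 1/2))"
    by simp
  also have "\<dots> = cis w" unfolding cis_2pi_shift cis_divide w_def by (simp add: algebra_simps)
  finally have 1: "cis (2 * pi * u) / cis (2 * pi * (b + 1/2)) = cis w" .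
  have "(2 * pi) * (-1/2) < w" "w < (2 * pi) * (1/2)"
    unfolding w_def using assms by (intro mult_strict_left_mono; simp)+
  then have "Arg (cis w) = w" by (intro Arg_cis) auto
  then show ?thesis by (simp add: cyl_map_def 1) (simp add: w_def)
qed

lemma cyl_map_unroll: "x \<in> strip b \<Longrightarrow> cyl_map b (unroll x) = x"
  using cyl_map_cis[of b 0 "x $ 1" "x $ 2"] by (simp add: strip_def unroll_def vector2_nth)

lemma unroll_in_cyl_dom: "x \<in> strip b \<Longrightarrow> unroll x \<in> cyl_dom b"
  unfolding unroll_def cis_in_cyl_dom_iff strip_def by (auto intro: exI[of _ 0])

lemma cyl_dom_cases:
  assumes "p \<in> cyl_dom b" obtains x where "x \<in> strip b" "p = unroll x"
proof -
  have "p \<in> cylinder" using assms by (simp add: cyl_dom_def)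
  then obtain u t where p: "p = (cis (2 * pi * u), t)" "0 \<le> t" by (rule cylinder_cases)
  with assms obtain n :: int where n: "b + n < u" "u < b + n + 1"
    using cis_in_cyl_dom_iff by blast
  have "cis (2 * pi * (u - of_int n)) = cis (2 * pi * u)"
    using cis_2pi_shift[of "u - of_int n" n] by simp
  then show thesis
    using n p by (intro that[of "vector [u - n, t]"]) (auto simp: strip_def unroll_def)
qed

lemma unroll_cyl_map: "p \<in> cyl_dom b \<Longrightarrow> unroll (cyl_map b p) = p"
  by (metis cyl_dom_cases cyl_map_unroll)

lemma cyl_map_image: "cyl_map b ` cyl_dom b = strip b"
proof
  show "cyl_map b ` cyl_dom b \<subseteq> strip b"
    by (auto elim!: cyl_dom_cases simp: cyl_map_unroll)
  show "strip b \<subseteq> cyl_map b ` cyl_dom b"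
    using cyl_map_unroll unroll_in_cyl_dom by (metis image_eqI subsetI)
qed

lemma chart_inv_cyl:
  assumes "x \<in> strip b" shows "chart_inv (cyl_dom b, cyl_map b) x = unroll x"
proof -
  have "inj_on (cyl_map b) (cyl_dom b)"
    by (rule inj_on_inverseI[of _ unroll]) (rule unroll_cyl_map)
  then show ?thesis
    unfolding chart_inv_def fst_conv snd_conv
    by (rule inv_into_f_eq) (intro unroll_in_cyl_dom cyl_map_unroll assms)+
qed

lemma cyl_dom_nonempty: "p \<in> cylinder \<Longrightarrow> \<exists>b. p \<in> cyl_dom b"
proof (elim cylinder_cases)
  fix u t assume "p = (cis (2 * pi * u), t)" "0 \<le> (t::real)"
  then show ?thesis
    by (auto simp: cis_in_cyl_dom_iff intro!: exI[of _ "u - 1/2"] exI[of _ "0::int"])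
qed

lemma continuous_on_unroll: "continuous_on S unroll"
  unfolding unroll_def[abs_def] by (intro continuous_intros)

lemma continuous_on_cyl_map: "continuous_on (cyl_dom b) (cyl_map b)"
proof -
  have A: "fst p / cis (2 * pi * (b + 1/2)) \<notin> \<real>\<^sub>\<le>\<^sub>0" if "p \<in> cyl_dom b" for p
  proof -
    from that obtain x where x: "x \<in> strip b" "p = unroll x" by (rule cyl_dom_cases)
    define w where "w = 2 * pi * (x $ 1 - (b + 1/2))"
    have w: "fst p / cis (2 * pi * (b + 1/2)) = cis w"
      unfolding w_def x(2) unroll_def fst_conv cis_divide by (simp add: algebra_simps)
    have "(2 * pi) * (-1/2) < w" "w < (2 * pi) * (1/2)"
      unfolding w_def using x(1) by (intro mult_strict_left_mono; simp add: strip_def)+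
    then have wr: "- pi < w" "w < pi" by auto
    have "cis w \<notin> \<real>\<^sub>\<le>\<^sub>0"
    proof
      assume n: "cis w \<in> \<real>\<^sub>\<le>\<^sub>0"
      then have "Re (cis w) \<le> 0" "Im (cis w) = 0"
        using complex_nonpos_Reals_iff by blast+
      then have s: "sin w = 0" "cos w \<le> 0" by simp_all
      have "w = 0"
      proof (rule ccontr)
        assume "w \<noteq> 0"
        then have "w < 0 \<or> 0 < w" by linarith
        then show False using s(1) wr sin_gt_zero[of w] sin_gt_zero[of "- w"] by auto
      qed
      with s(2) show False by simp
    qed
    then show ?thesis unfolding w .
  qed
  then show ?thesis
    unfolding cyl_map_def[abs_def] vector2_eq by (intro continuous_intros) (auto simp del: cis_divide)
qed

lemma openin_strip: "openin (top_of_set halfplane) (strip b)"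
proof -
  have "strip b = halfplane \<inter> ({x. b < x $ 1} \<inter> {x. x $ 1 < b + 1})"
    by (auto simp: strip_def halfplane_def)
  moreover have "open ({x::real^2. b < x $ 1} \<inter> {x. x $ 1 < b + 1})"
    by (intro open_Int open_Collect_less continuous_intros)
  ultimately show ?thesis by auto
qed

lemma openin_cyl_dom: "openin (top_of_set cylinder) (cyl_dom b)"
proof -
  have "cyl_dom b = cylinder \<inter> {p. fst p \<noteq> cis (2 * pi * b)}" by (auto simp: cyl_dom_def)
  moreover have "open {p :: point. fst p \<noteq> cis (2 * pi * b)}"
    by (intro open_Collect_neq continuous_intros)
  ultimately show ?thesis by auto
qed

lemma homeomorphic_map_cyl:
  "homeomorphic_map (top_of_set (cyl_dom b)) (top_of_set (strip b)) (cyl_map b)"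
proof (rule homeomorphic_maps_imp_map)
  show "homeomorphic_maps (top_of_set (cyl_dom b)) (top_of_set (strip b)) (cyl_map b) unroll"
    unfolding homeomorphic_maps_def
    using continuous_on_cyl_map[of b] continuous_on_unroll[of "strip b"] cyl_map_image[of b]
    by (auto simp: continuous_map_in_subtopology unroll_cyl_map cyl_map_unroll unroll_in_cyl_dom)
qed

lemma cylinder_eq_unroll: "cylinder = unroll ` halfplane"
proof
  show "cylinder \<subseteq> unroll ` halfplane"
  proof
    fix p assume "p \<in> cylinder"
    then obtain u t where "p = (cis (2 * pi * u), t)" "0 \<le> t" by (rule cylinder_cases)
    then have "p = unroll (vector [u, t])" "vector [u, t] \<in> halfplane"
      by (simp_all add: unroll_def halfplane_def)
    then show "p \<in> unroll ` halfplane" by blast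
  qed
qed (auto simp: halfplane_def unroll_in_cylinder)

lemma connected_cylinder: "connected cylinder"
proof -
  have "convex halfplane"
    unfolding halfplane_def using convex_halfspace_ge[of 0 "axis 2 1 :: real^2"]
    by (simp add: inner_axis' )
  then show ?thesis
    unfolding cylinder_eq_unroll
    by (intro connected_continuous_image continuous_on_unroll convex_connected)
qed

text \<open>A continuous angle stays locally in one interval \<open>(b + n, b + n + 1)\<close>, so
  in the chart the map reads \<open>(u - n, t)\<close> with a fixed integer n. Every computation in
  charts rests on this.\<close>

lemma chart_of_lift:
  fixes u :: "'d::topological_space \<Rightarrow> real"
  assumes "continuous_on D u" "p \<in> D" "(cis (2 * pi * u p), t) \<in> cyl_dom b"
  obtains n :: int and W where "open W" "p \<in> W"
    "\<And>q. q \<in> D \<Longrightarrow> q \<in> W \<Longrightarrow> b + n < u q \<and> u q < b + n + 1"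
    "\<And>q t. q \<in> D \<Longrightarrow> q \<in> W \<Longrightarrow> cyl_map b (cis (2 * pi * u q), t) = vector [u q - n, t]"
    "\<And>q t. q \<in> D \<Longrightarrow> q \<in> W \<Longrightarrow> 0 \<le> t \<Longrightarrow> (cis (2 * pi * u q), t) \<in> cyl_dom b"
proof -
  from assms(3) obtain n :: int where n: "b + n < u p" "u p < b + n + 1"
    unfolding cis_in_cyl_dom_iff by blast
  have "open {b + n <..< b + n + 1}" by simp
  then obtain W where W: "open W" "W \<inter> D = u -` {b + n <..< b + n + 1} \<inter> D"
    using assms(1) unfolding continuous_on_open_invariant by meson
  have *: "b + n < u q \<and> u q < b + n + 1" if "q \<in> D" "q \<in> W" for q
    using that W(2) by auto
  show thesis
  proof (rule that[of W n])
    show "p \<in> W" using W(2) n assms(2) by auto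
    show "(cis (2 * pi * u q), t) \<in> cyl_dom b" if "q \<in> D" "q \<in> W" "0 \<le> t" for q t
      using *[OF that(1,2)] that(3) unfolding cis_in_cyl_dom_iff by blast
    show "cyl_map b (cis (2 * pi * u q), t) = vector [u q - n, t]" if "q \<in> D" "q \<in> W" for q t
      using *[OF that] by (intro cyl_map_cis) auto
  qed (use W(1) * in auto)
qed

section \<open>The metric on the cylinder\<close>

definition dens :: "(real \<Rightarrow> real) \<Rightarrow> (real \<Rightarrow> real) \<Rightarrow> real \<Rightarrow> real \<Rightarrow> real" where
  "dens v \<kappa> u t = v u * (cosh t + \<kappa> u * sinh t)"

text \<open>The metric matrix ignores the chart: charts differ by integer translations of the first
  coordinate, which leave the density unchanged once \<open>v\<close> and \<open>\<kappa>\<close>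
  have period 1.\<close>

definition cyl_surface :: "(real \<Rightarrow> real) \<Rightarrow> (real \<Rightarrow> real) \<Rightarrow> point surface" where
  "cyl_surface v \<kappa> = \<lparr>sspace = top_of_set cylinder, charts = range (\<lambda>b. (cyl_dom b, cyl_map b)),
     gmetric = (\<lambda>c x. dmat ((dens v \<kappa> (x $ 1) (x $ 2))\<^sup>2))\<rparr>"

lemma periodic_of_int:
  fixes g :: "real \<Rightarrow> 'b"
  assumes "\<And>u. g (u + 1) = g u"
  shows "g (u + of_int n) = g u"
proof (induction n rule: int_induct[of _ 0])
  case (step1 i)
  then show ?case using assms[of "u + of_int i"] by (simp add: add.assoc)
next
  case (step2 i)
  then show ?case using assms[of "u + of_int i - 1"] by (simp add: algebra_simps)
qed simp

lemma matrix_vector2: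
  "matrix (\<lambda>h::real^2. vector [a h, b h] :: real^2) =
     (\<chi> i j. if i = 1 then a (axis j 1) else b (axis j 1))"
  by (simp add: matrix_def vec_eq_iff forall_2)

lemma transpose_dmat: "transpose (dmat e) = dmat e"
  by (simp add: transpose_def dmat_def vec_eq_iff)

lemma pull_dmat:
  fixes J :: "real^2^2"
  shows "(transpose J ** dmat e ** J) $ i $ j = e * J $ 1 $ i * J $ 1 $ j + J $ 2 $ i * J $ 2 $ j"
  by (simp add: matrix_matrix_mult_def transpose_def sum_2 algebra_simps)

lemma cyl_surface_simps [simp]:
  "sspace (cyl_surface v \<kappa>) = top_of_set cylinder"
  "charts (cyl_surface v \<kappa>) = range (\<lambda>b. (cyl_dom b, cyl_map b))"
  "gmetric (cyl_surface v \<kappa>) c x = dmat ((dens v \<kappa> (x $ 1) (x $ 2))\<^sup>2)"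
  by (simp_all add: cyl_surface_def)

lemma chart_at_cyl:
  assumes "p \<in> cylinder"
  obtains b where "chart_at (cyl_surface v \<kappa>) p = (cyl_dom b, cyl_map b)" "p \<in> cyl_dom b"
proof -
  obtain b where "p \<in> cyl_dom b" using cyl_dom_nonempty[OF assms] by blast
  then have "\<exists>c. c \<in> charts (cyl_surface v \<kappa>) \<and> p \<in> fst c" by auto
  from someI_ex[OF this] show thesis
    unfolding chart_at_def[symmetric] by (auto intro: that)
qed

lemma smooth_into_cyl:
  fixes f :: "'d::euclidean_space \<Rightarrow> point"
  assumes "smooth_on D u" "smooth_on D \<tau>" "\<And>x. x \<in> D \<Longrightarrow> 0 \<le> \<tau> x"
    "\<And>x. x \<in> D \<Longrightarrow> f x = (cis (2 * pi * u x), \<tau> x)"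
  shows "smooth_into D (cyl_surface v \<kappa>) f"
proof -
  have cu: "continuous_on D u" "continuous_on D \<tau>"
    using assms(1,2) by (auto intro: smooth_on_imp_continuous_on)
  have "continuous_on D (\<lambda>x. (cis (2 * pi * u x), \<tau> x))"
    by (intro continuous_intros cu)
  then have "continuous_on D f" using assms(4) by (simp cong: continuous_on_cong)
  moreover have "f \<in> D \<rightarrow> cylinder" using assms(3,4) by (auto simp: cylinder_def)
  ultimately have "continuous_map (top_of_set D) (top_of_set cylinder) f"
    by (auto simp: continuous_map_in_subtopology)
  moreover have "smooth_on {x\<in>D. f x \<in> cyl_dom b} (cyl_map b \<circ> f)" (is "smooth_on ?D _") for b
  proof (rule smooth_on_local)
    fix p assume p: "p \<in> ?D"
    have "(cis (2 * pi * u p), \<tau> p) \<in> cyl_dom b" using p assms(4) by auto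
    with cu(1) p obtain n :: int and W where W: "open W" "p \<in> W"
      "\<And>q t. q \<in> D \<Longrightarrow> q \<in> W \<Longrightarrow> cyl_map b (cis (2 * pi * u q), t) = vector [u q - n, t]"
      by (elim chart_of_lift) auto
    have "smooth_on (?D \<inter> W) (\<lambda>q. vector [u q - n, \<tau> q] :: real^2)"
      by (intro smooth_on_vector2 smooth_on_minus smooth_on_const smooth_on_subset[OF assms(1)]
          smooth_on_subset[OF assms(2)]) auto
    then have "smooth_on (?D \<inter> W) (cyl_map b \<circ> f)"
      by (rule smooth_on_cong) (use W assms(4) in auto)
    with W show "\<exists>W. open W \<and> p \<in> W \<and> smooth_on (?D \<inter> W) (cyl_map b \<circ> f)" by blast
  qed
  ultimately show ?thesis by (auto simp: smooth_into_def)
qed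

lemma smooth_into_unroll: "smooth_into halfplane (cyl_surface v \<kappa>) unroll"
  by (rule smooth_into_cyl[of _ "\<lambda>x. x $ 1" "\<lambda>x. x $ 2"])
    (auto intro!: smooth_on_nth smooth_on_id simp: halfplane_def unroll_def)

text \<open>The integer ambiguity disappears on differentiation, so the differential in any chart is
  that of the lift. Pullbacks and speeds can therefore be computed without knowing which chart
  \<open>chart_at\<close> selects.\<close>

lemma chart_has_derivative:
  fixes f :: "'d::real_normed_vector \<Rightarrow> point"
  assumes "continuous_on S u" "x \<in> S" "f x \<in> cyl_dom b"
    and f: "\<And>y. y \<in> S \<Longrightarrow> f y = (cis (2 * pi * u y), \<tau> y)"
    and d: "(u has_derivative u') (at x within S)" "(\<tau> has_derivative \<tau>') (at x within S)"
  shows "((cyl_map b \<circ> f) has_derivative (\<lambda>h. vector [u' h, \<tau>' h])) (at x within S)"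
    and "\<exists>n::int. cyl_map b (f x) = vector [u x - n, \<tau> x]"
proof -
  from assms(3) f[OF assms(2)] have "(cis (2 * pi * u x), \<tau> x) \<in> cyl_dom b" by simp
  with assms(1,2) obtain n :: int and W where W: "open W" "x \<in> W"
    "\<And>q t. q \<in> S \<Longrightarrow> q \<in> W \<Longrightarrow> cyl_map b (cis (2 * pi * u q), t) = vector [u q - n, t]"
    by (elim chart_of_lift) auto
  obtain e where e: "0 < e" "\<And>y. dist y x < e \<Longrightarrow> y \<in> W"
    using W(1,2) open_dist by metis
  have "((\<lambda>q. vector [u q - n, \<tau> q] :: real^2) has_derivative (\<lambda>h. vector [u' h, \<tau>' h])) (at x within S)"
    unfolding vector2_eq by (auto intro!: derivative_eq_intros d)
  then show "((cyl_map b \<circ> f) has_derivative (\<lambda>h. vector [u' h, \<tau>' h])) (at x within S)"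
    by (rule has_derivative_transform_within[OF _ e(1) assms(2)]) (use W(3) f e(2) in auto)
  show "\<exists>n::int. cyl_map b (f x) = vector [u x - n, \<tau> x]"
    using W(2,3) assms(2) f by (intro exI[of _ n]) auto
qed

lemma bdry_cyl: "bdry (cyl_surface v \<kappa>) = {p \<in> cylinder. snd p = 0}"
proof -
  have "cyl_map b p $ 2 = snd p" for b p by (simp add: cyl_map_def)
  then show ?thesis
    by (auto simp: bdry_def cyl_dom_nonempty) (auto simp: cyl_dom_def)
qed

lemma second_countable_euclidean: "second_countable (euclidean :: 'a::second_countable_topology topology)"
proof -
  obtain \<B> :: "'a set set" where B: "countable \<B>" "\<And>C. C \<in> \<B> \<Longrightarrow> open C"
    "\<And>S. open S \<Longrightarrow> \<exists>U. U \<subseteq> \<B> \<and> S = \<Union>U"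
    by (rule univ_second_countable) blast
  have "\<exists>V\<in>\<B>. x \<in> V \<and> V \<subseteq> U" if "open U" "x \<in> U" for U x
    using B(3)[OF that(1)] that(2) by blast
  with B(1,2) show ?thesis unfolding second_countable_def by (intro exI[of _ \<B>]) auto
qed

text \<open>The boundary data as functions of the parameter of the curve: \<open>v\<close> is its
  speed and \<open>\<kappa>\<close> the prescribed geodesic curvature.\<close>

locale fermi =
  fixes v \<kappa> :: "real \<Rightarrow> real"
  assumes smooth_v: "smooth_on UNIV v" and smooth_\<kappa>: "smooth_on UNIV \<kappa>"
    and per_v: "\<And>u. v (u + 1) = v u" and per_\<kappa>: "\<And>u. \<kappa> (u + 1) = \<kappa> u"
    and v_pos: "\<And>u. 0 < v u" and \<kappa>_nonneg: "\<And>u. 0 \<le> \<kappa> u"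
begin

abbreviation "M \<equiv> cyl_surface v \<kappa>"
abbreviation "\<rho> \<equiv> dens v \<kappa>"

text \<open>The sign of \<open>\<kappa>\<close> acts here: no leaf is shorter, even infinitesimally,
  than the boundary below it. Positivity of the metric and the length comparison both
  follow.\<close>

lemma factor_ge: "0 \<le> t \<Longrightarrow> 1 \<le> cosh t + \<kappa> u * sinh t"
  using \<kappa>_nonneg[of u] cosh_real_ge_1[of t] by (simp add: add_increasing2)

lemma dens_ge: "0 \<le> t \<Longrightarrow> v u \<le> \<rho> u t"
  using factor_ge[of t u] v_pos[of u] by (simp add: dens_def)

lemma dens_pos: "0 \<le> t \<Longrightarrow> 0 < \<rho> u t"
  using dens_ge[of t u] v_pos[of u] by linarith

lemma dens_shift: "\<rho> (u - of_int n) t = \<rho> u t"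
  using periodic_of_int[of v "u - of_int n" n] periodic_of_int[of \<kappa> "u - of_int n" n] per_v per_\<kappa>
  by (simp add: dens_def)

lemma smooth_dens: "smooth_on UNIV (\<lambda>x::real^2. \<rho> (x $ 1) (x $ 2))"
  unfolding dens_def
  by (intro smooth_on_mult smooth_on_add smooth_on_compose[OF _ smooth_v] smooth_on_compose[OF _ smooth_\<kappa>]
     smooth_on_compose[OF _ smooth_on_cosh] smooth_on_compose[OF _ smooth_on_sinh] smooth_on_nth smooth_on_id) auto

lemma smooth_metric: "smooth_on S (gmetric M c)"
proof -
  have "smooth_on UNIV (\<lambda>x::real^2. dmat ((\<rho> (x $ 1) (x $ 2))\<^sup>2) $ i $ j)" for i j
    using exhaust_2[of i] exhaust_2[of j]
    by (elim disjE) (simp_all add: smooth_on_const smooth_on_power smooth_dens)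
  then have "smooth_on UNIV (\<lambda>x::real^2. dmat ((\<rho> (x $ 1) (x $ 2))\<^sup>2))"
    by (intro smooth_on_vec)
  then have "smooth_on S (\<lambda>x::real^2. dmat ((\<rho> (x $ 1) (x $ 2))\<^sup>2))"
    by (rule smooth_on_subset) simp
  then show ?thesis by (simp add: cyl_surface_def)
qed

lemma smooth_surface_M: "smooth_surface M"
proof -
  have "smooth_on (cyl_map a ` (cyl_dom a \<inter> cyl_dom b)) (transition (cyl_dom a, cyl_map a) (cyl_dom b, cyl_map b))" for a b
  proof (rule smooth_on_cong)
    have "smooth_on {x\<in>halfplane. unroll x \<in> cyl_dom b} (cyl_map b \<circ> unroll)"
      using smooth_into_unroll[of v \<kappa>] unfolding smooth_into_def by auto
    moreover have "cyl_map a ` (cyl_dom a \<inter> cyl_dom b) \<subseteq> {x\<in>halfplane. unroll x \<in> cyl_dom b}"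
      using cyl_map_image[of a] by (auto simp: unroll_cyl_map strip_def halfplane_def)
    ultimately show "smooth_on (cyl_map a ` (cyl_dom a \<inter> cyl_dom b)) (cyl_map b \<circ> unroll)"
      by (rule smooth_on_subset)
  next
    fix x assume "x \<in> cyl_map a ` (cyl_dom a \<inter> cyl_dom b)"
    then have "x \<in> strip a" using cyl_map_image[of a] by auto
    then show "(cyl_map b \<circ> unroll) x = transition (cyl_dom a, cyl_map a) (cyl_dom b, cyl_map b) x"
      by (simp add: transition_def chart_inv_cyl)
  qed
  moreover have "Hausdorff_space (top_of_set cylinder)" "second_countable (top_of_set cylinder)"
    "connected_space (top_of_set cylinder)"
    by (auto simp: Hausdorff_space_subtopology second_countable_subtopology connected_cylinder
        second_countable_euclidean connected_space_subtopology)
  moreover have "(\<Union>b. cyl_dom b) = cylinder"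
    using cyl_dom_nonempty by (auto simp: cyl_dom_def)
  moreover have "subtopology (top_of_set cylinder) (cyl_dom b) = top_of_set (cyl_dom b)" for b
  proof -
    have "cylinder \<inter> cyl_dom b = cyl_dom b" by (auto simp: cyl_dom_def)
    then show ?thesis by (simp only: subtopology_subtopology)
  qed
  ultimately show ?thesis
    by (auto simp: smooth_surface_def openin_cyl_dom cyl_map_image openin_strip homeomorphic_map_cyl)
qed

lemma riemannian_surface_M: "riemannian_surface M"
proof -
  have pos: "0 < inner_g (dmat ((\<rho> (x $ 1) (x $ 2))\<^sup>2)) w w" if "x \<in> strip b" "w \<noteq> 0" for x w b
  proof -
    have r: "0 < (\<rho> (x $ 1) (x $ 2))\<^sup>2" using dens_pos[of "x $ 2" "x $ 1"] that by (simp add: strip_def)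
    have "w $ 1 \<noteq> 0 \<or> w $ 2 \<noteq> 0" using that(2) by (simp add: vec_eq_iff forall_2)
    then have "0 < (\<rho> (x $ 1) (x $ 2))\<^sup>2 * (w $ 1)\<^sup>2 + (w $ 2)\<^sup>2"
    proof
      assume "w $ 1 \<noteq> 0"
      then have "0 < (\<rho> (x $ 1) (x $ 2))\<^sup>2 * (w $ 1)\<^sup>2" using r by simp
      then show ?thesis by (simp add: add_pos_nonneg)
    next
      assume "w $ 2 \<noteq> 0" then show ?thesis using r by (simp add: add_nonneg_pos)
    qed
    then show ?thesis by (simp add: inner_g_dmat power2_eq_square mult_ac)
  qed
  have comp: "dmat ((\<rho> (x $ 1) (x $ 2))\<^sup>2) =
      transpose J ** dmat ((\<rho> (y $ 1) (y $ 2))\<^sup>2) ** J"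
    if x: "x \<in> cyl_map a ` (cyl_dom a \<inter> cyl_dom b)"
      and J: "J = jacobian (transition (cyl_dom a, cyl_map a) (cyl_dom b, cyl_map b)) (at x within halfplane)"
      and y: "y = transition (cyl_dom a, cyl_map a) (cyl_dom b, cyl_map b) x" for a b x y J
  proof -
    from x have xs: "x \<in> strip a" "x \<in> halfplane" "unroll x \<in> cyl_dom b"
      using cyl_map_image[of a] by (auto simp: strip_def halfplane_def unroll_cyl_map)
    have d: "((\<lambda>x. x $ i) has_derivative (\<lambda>h. h $ i)) (at x within halfplane)" for i :: 2
      by (rule bounded_linear_imp_has_derivative[OF bounded_linear_vec_nth])
    have c: "continuous_on halfplane (\<lambda>x. x $ 1)" by (intro continuous_intros)
    note cd = chart_has_derivative[where f=unroll and u="\<lambda>x. x $ 1" and \<tau>="\<lambda>x. x $ 2",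
        OF c xs(2,3) unroll_def d[of 1] d[of 2]]
    \<comment> \<open>\<open>chart_inv\<close> is controlled only on the image of the chart, so the
      two maps are compared near x and not on the whole half-plane.\<close>
    have ev: "\<forall>\<^sub>F x' in at x within halfplane. (cyl_map b \<circ> unroll) x'
          = transition (cyl_dom a, cyl_map a) (cyl_dom b, cyl_map b) x'"
    proof -
      have "open ({x'::real^2. a < x' $ 1} \<inter> {x'. x' $ 1 < a + 1})"
        by (intro open_Int open_Collect_less continuous_intros)
      then show ?thesis
        unfolding eventually_at_topological
        using xs(1) by (intro exI[of _ "{x'. a < x' $ 1} \<inter> {x'. x' $ 1 < a + 1}"])
          (auto simp: strip_def halfplane_def transition_def chart_inv_cyl)
    qed
    have yx: "y = (cyl_map b \<circ> unroll) x"
      using xs(1) by (simp add: y transition_def chart_inv_cyl)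
    have "(transition (cyl_dom a, cyl_map a) (cyl_dom b, cyl_map b) has_derivative
        (\<lambda>h. vector [h $ 1, h $ 2])) (at x within halfplane)"
      by (rule has_derivative_transform_eventually[OF cd(1) ev yx[unfolded y, symmetric] xs(2)])
    from upward_frechet_derivative[OF upward_halfplanes(1) xs(2) this]
    \<comment> \<open>The transition is locally a translation, so the transformation law reduces to
      periodicity of the density.\<close>
    have "J = mat 1"
      by (simp add: J jacobian_def vector2_nth matrix_id_mat_1[unfolded id_def])
    moreover from cd(2) obtain n :: int where "y = vector [x $ 1 - n, x $ 2]"
      unfolding yx by (auto simp: unroll_def)
    ultimately show ?thesis by (simp add: dens_shift transpose_mat)
  qed
  have "0 < inner_g (dmat ((\<rho> (cyl_map b p $ 1) (cyl_map b p $ 2))\<^sup>2)) w w"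
    if "p \<in> cyl_dom b" "w \<noteq> 0" for b p w
    by (rule pos[of _ b]) (use that cyl_map_image in auto)
  then show ?thesis
    unfolding riemannian_surface_def Let_def
    using smooth_surface_M smooth_metric comp[OF _ refl refl]
    by (auto simp: transpose_dmat)
qed

end

section \<open>Curvature of the collar, pullback metrics and speeds\<close>

lemma smooth_on_real_DERIV:
  fixes f :: "real \<Rightarrow> real"
  assumes "smooth_on UNIV f" shows "DERIV f u :> vector_derivative f (at u)"
  using smooth_on_real_derivD(1)[OF open_UNIV assms UNIV_I]
  by (simp add: has_real_derivative_iff_has_vector_derivative)

lemma nth_has_derivative: "((\<lambda>x. x $ i) has_derivative (\<lambda>h. h $ i)) (at (x::real^'n) within S)"
  by (rule bounded_linear_imp_has_derivative[OF bounded_linear_vec_nth])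

context fermi
begin

text \<open>The t-derivative of the logarithm of the density; the factor \<open>v\<close>
  cancels.\<close>

definition wcurv :: "real \<Rightarrow> real \<Rightarrow> real" where
  "wcurv u t = (sinh t + \<kappa> u * cosh t) / (cosh t + \<kappa> u * sinh t)"

text \<open>The offset c is 0 in the charts and \<open>r0\<close> in the coordinates of the
  foliation. The u-derivatives stay unnamed because the curvatures involve t-derivatives only. The
  second claim is the Riccati equation w_t = 1 - w^2, a consequence of cosh and sinh being each
  other's derivatives.\<close>

lemma fermi_derivs:
  fixes x :: "real^2"
  shows "\<exists>a. ((\<lambda>x. \<rho> (x $ 1) (x $ 2 - c)) has_derivative
       (\<lambda>h. h $ 1 * a + h $ 2 * (v (x $ 1) * (sinh (x $ 2 - c) + \<kappa> (x $ 1) * cosh (x $ 2 - c))))) (at x within S)"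
    and "c \<le> x $ 2 \<Longrightarrow> \<exists>b. ((\<lambda>x. wcurv (x $ 1) (x $ 2 - c)) has_derivative
       (\<lambda>h. h $ 1 * b + h $ 2 * (1 - (wcurv (x $ 1) (x $ 2 - c))\<^sup>2))) (at x within S)"
proof -
  define t where "t = x $ 2 - c"
  define u where "u = x $ 1"
  have d2: "((\<lambda>x. x $ 2 - c) has_derivative (\<lambda>h. h $ 2)) (at x within S)"
    by (auto intro!: derivative_eq_intros nth_has_derivative)
  define v' where "v' = vector_derivative v (at u)"
  define k' where "k' = vector_derivative \<kappa> (at u)"
  have dv: "((\<lambda>x. v (x $ 1)) has_derivative (\<lambda>h. h $ 1 * v')) (at x within S)"
    unfolding v'_def u_def by (rule DERIV_compose_FDERIV[OF smooth_on_real_DERIV[OF smooth_v] nth_has_derivative])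
  have dk: "((\<lambda>x. \<kappa> (x $ 1)) has_derivative (\<lambda>h. h $ 1 * k')) (at x within S)"
    unfolding k'_def u_def by (rule DERIV_compose_FDERIV[OF smooth_on_real_DERIV[OF smooth_\<kappa>] nth_has_derivative])
  have "DERIV cosh t :> sinh t" "DERIV sinh t :> cosh t"
    by (auto intro!: derivative_eq_intros)
  then have dc: "((\<lambda>x. cosh (x $ 2 - c)) has_derivative (\<lambda>h. h $ 2 * sinh t)) (at x within S)"
    and ds: "((\<lambda>x. sinh (x $ 2 - c)) has_derivative (\<lambda>h. h $ 2 * cosh t)) (at x within S)"
    using DERIV_compose_FDERIV[OF _ d2] by (auto simp: t_def)
  have n: "((\<lambda>x. cosh (x $ 2 - c) + \<kappa> (x $ 1) * sinh (x $ 2 - c)) has_derivative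
      (\<lambda>h. h $ 1 * (k' * sinh t) + h $ 2 * (sinh t + \<kappa> u * cosh t))) (at x within S)"
    using has_derivative_add[OF dc has_derivative_mult[OF dk ds]]
    by (simp add: t_def[symmetric] u_def[symmetric] k'_def algebra_simps)
  have m: "((\<lambda>x. sinh (x $ 2 - c) + \<kappa> (x $ 1) * cosh (x $ 2 - c)) has_derivative
      (\<lambda>h. h $ 1 * (k' * cosh t) + h $ 2 * (cosh t + \<kappa> u * sinh t))) (at x within S)"
    using has_derivative_add[OF ds has_derivative_mult[OF dk dc]]
    by (simp add: t_def[symmetric] u_def[symmetric] k'_def algebra_simps)
  have "((\<lambda>x. \<rho> (x $ 1) (x $ 2 - c)) has_derivative
      (\<lambda>h. h $ 1 * (v' * (cosh t + \<kappa> u * sinh t) + v u * k' * sinh t) + h $ 2 * (v u * (sinh t + \<kappa> u * cosh t)))) (at x within S)"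
    using has_derivative_mult[OF dv n] unfolding dens_def
    by (simp add: t_def[symmetric] u_def[symmetric] v'_def algebra_simps)
  then show "\<exists>a. ((\<lambda>x. \<rho> (x $ 1) (x $ 2 - c)) has_derivative
       (\<lambda>h. h $ 1 * a + h $ 2 * (v (x $ 1) * (sinh (x $ 2 - c) + \<kappa> (x $ 1) * cosh (x $ 2 - c))))) (at x within S)"
    unfolding t_def[symmetric] u_def[symmetric]
    by (intro exI[of _ "v' * (cosh t + \<kappa> u * sinh t) + v u * k' * sinh t"])
  show "\<exists>b. ((\<lambda>x. wcurv (x $ 1) (x $ 2 - c)) has_derivative
       (\<lambda>h. h $ 1 * b + h $ 2 * (1 - (wcurv (x $ 1) (x $ 2 - c))\<^sup>2))) (at x within S)" if "c \<le> x $ 2"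
  proof -
    define q where "q = cosh t + \<kappa> u * sinh t"
    define p where "p = sinh t + \<kappa> u * cosh t"
    have q: "q \<noteq> 0" using factor_ge[of t u] that by (simp add: t_def q_def)
    have q': "cosh (x $ 2 - c) + \<kappa> (x $ 1) * sinh (x $ 2 - c) \<noteq> 0"
      using q by (simp add: q_def t_def u_def)
    have w: "wcurv (x $ 1) (x $ 2 - c) = p / q" by (simp add: wcurv_def p_def q_def t_def u_def)
    have e: "((h $ 1 * (k' * cosh t) + h $ 2 * q) * q - p * (h $ 1 * (k' * sinh t) + h $ 2 * p)) / (q * q)
       = h $ 1 * ((k' * cosh t * q - p * k' * sinh t) / (q * q)) + h $ 2 * (1 - (p / q)\<^sup>2)" for h :: "real^2"
      using q by (simp add: field_simps power2_eq_square)
    have "((\<lambda>x. wcurv (x $ 1) (x $ 2 - c)) has_derivative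
       (\<lambda>h. ((h $ 1 * (k' * cosh t) + h $ 2 * q) * q - p * (h $ 1 * (k' * sinh t) + h $ 2 * p)) / (q * q))) (at x within S)"
      using has_derivative_divide'[OF m n q'] unfolding wcurv_def
      by (simp add: t_def[symmetric] u_def[symmetric] p_def[symmetric] q_def[symmetric])
    then show ?thesis
      unfolding e w[symmetric] by (intro exI[of _ "(k' * cosh t * q - p * k' * sinh t) / (q * q)"])
  qed
qed

lemma semigeodesic_fermi:
  assumes up: "upward S" and le: "\<forall>y\<in>S. c \<le> y $ 2"
    and G: "\<forall>y\<in>S. G y = dmat ((\<rho> (y $ 1) (y $ 2 - c))\<^sup>2)"
  shows "\<exists>D. semigeodesic S G (\<lambda>y. (\<rho> (y $ 1) (y $ 2 - c))\<^sup>2) D \<and>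
    (\<forall>y\<in>S. D y (axis 2 1) / (2 * (\<rho> (y $ 1) (y $ 2 - c))\<^sup>2) = wcurv (y $ 1) (y $ 2 - c)) \<and>
    (\<forall>y\<in>S. D y (axis 2 1) = 2 * \<rho> (y $ 1) (y $ 2 - c) * (v (y $ 1) * (sinh (y $ 2 - c) + \<kappa> (y $ 1) * cosh (y $ 2 - c))))"
proof -
  have "\<exists>D. \<forall>y. ((\<lambda>x. \<rho> (x $ 1) (x $ 2 - c)) has_derivative D y) (at y within S) \<and>
     D y (axis 2 1) = v (y $ 1) * (sinh (y $ 2 - c) + \<kappa> (y $ 1) * cosh (y $ 2 - c))"
  proof (rule choice, rule allI)
    fix y
    from fermi_derivs(1)[of c y S] obtain a where "((\<lambda>x. \<rho> (x $ 1) (x $ 2 - c)) has_derivative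
       (\<lambda>h. h $ 1 * a + h $ 2 * (v (y $ 1) * (sinh (y $ 2 - c) + \<kappa> (y $ 1) * cosh (y $ 2 - c))))) (at y within S)" ..
    then show "\<exists>D. ((\<lambda>x. \<rho> (x $ 1) (x $ 2 - c)) has_derivative D) (at y within S) \<and>
     D (axis 2 1) = v (y $ 1) * (sinh (y $ 2 - c) + \<kappa> (y $ 1) * cosh (y $ 2 - c))"
      by - (rule exI, rule conjI, assumption, simp add: axis_def)
  qed
  then obtain D where D: "\<And>y. ((\<lambda>x. \<rho> (x $ 1) (x $ 2 - c)) has_derivative D y) (at y within S)"
    "\<And>y. D y (axis 2 1) = v (y $ 1) * (sinh (y $ 2 - c) + \<kappa> (y $ 1) * cosh (y $ 2 - c))" by blast
  have r: "0 < \<rho> (y $ 1) (y $ 2 - c)" if "y \<in> S" for y using dens_pos le that by simp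
  show ?thesis
  proof (intro exI[of _ "\<lambda>y h. 2 * \<rho> (y $ 1) (y $ 2 - c) * D y h"] conjI ballI)
    show "semigeodesic S G (\<lambda>y. (\<rho> (y $ 1) (y $ 2 - c))\<^sup>2) (\<lambda>y h. 2 * \<rho> (y $ 1) (y $ 2 - c) * D y h)"
    proof
      fix y assume "y \<in> S"
      show "((\<lambda>y. (\<rho> (y $ 1) (y $ 2 - c))\<^sup>2) has_derivative (\<lambda>h. 2 * \<rho> (y $ 1) (y $ 2 - c) * D y h)) (at y within S)"
        using has_derivative_power[OF D(1)[of y], of 2] by (simp add: mult_ac)
      show "0 < (\<rho> (y $ 1) (y $ 2 - c))\<^sup>2" using r[OF \<open>y \<in> S\<close>] by simp
    qed (use up G in auto)
    show "2 * \<rho> (y $ 1) (y $ 2 - c) * D y (axis 2 1) / (2 * (\<rho> (y $ 1) (y $ 2 - c))\<^sup>2) = wcurv (y $ 1) (y $ 2 - c)"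
      if "y \<in> S" for y
      using r[OF that] v_pos[of "y $ 1"] unfolding D(2)
      by (simp add: wcurv_def dens_def power2_eq_square)
  qed (simp add: D(2))
qed

text \<open>The Gauss curvature is -(w_t + w^2) with w_t = 1 - w^2.\<close>

lemma gauss_fermi:
  assumes "upward S" "\<forall>y\<in>S. c \<le> y $ 2"
    "\<forall>y\<in>S. G y = dmat ((\<rho> (y $ 1) (y $ 2 - c))\<^sup>2)" "x \<in> S"
  shows "gauss_coord S G x = -1" and "geod_curv_coord S G x = wcurv (x $ 1) (x $ 2 - c)"
proof -
  from semigeodesic_fermi[where S=S and G=G and c=c, OF assms(1-3)]
  obtain D where H: "semigeodesic S G (\<lambda>y. (\<rho> (y $ 1) (y $ 2 - c))\<^sup>2) D"
    "\<And>y. y \<in> S \<Longrightarrow> D y (axis 2 1) / (2 * (\<rho> (y $ 1) (y $ 2 - c))\<^sup>2) = wcurv (y $ 1) (y $ 2 - c)"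
    by (elim exE conjE) (rule that, assumption, erule bspec)
  interpret semigeodesic S G "\<lambda>y. (\<rho> (y $ 1) (y $ 2 - c))\<^sup>2" D by (rule H(1))
  show "geod_curv_coord S G x = wcurv (x $ 1) (x $ 2 - c)"
    by (simp only: geod_curv_coord_eq[OF assms(4)] H(2)[OF assms(4)])
  have "c \<le> x $ 2" using assms by blast
  from fermi_derivs(2)[OF this, of S] obtain b where b: "((\<lambda>x. wcurv (x $ 1) (x $ 2 - c)) has_derivative
       (\<lambda>h. h $ 1 * b + h $ 2 * (1 - (wcurv (x $ 1) (x $ 2 - c))\<^sup>2))) (at x within S)" ..
  have "((\<lambda>y. D y (axis 2 1) / (2 * (\<rho> (y $ 1) (y $ 2 - c))\<^sup>2)) has_derivative
       (\<lambda>h. h $ 1 * b + h $ 2 * (1 - (wcurv (x $ 1) (x $ 2 - c))\<^sup>2))) (at x within S)"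
    by (rule has_derivative_transform[OF assms(4) H(2) b])
  from gauss_coord_eq[OF assms(4) this] show "gauss_coord S G x = -1"
    unfolding H(2)[OF assms(4)] by (simp add: axis_def)
qed

lemma gauss_curvature_M:
  assumes "p \<in> cylinder" shows "gauss_curvature M p = -1"
proof -
  obtain b where b: "chart_at M p = (cyl_dom b, cyl_map b)" "p \<in> cyl_dom b"
    using chart_at_cyl[OF assms] by metis
  have "cyl_map b p \<in> halfplane"
    using b(2) cyl_map_image[of b] by (auto simp: strip_def halfplane_def)
  then show ?thesis
    unfolding gauss_curvature_def b Let_def fst_conv snd_conv
    by (intro gauss_fermi[where c=0]) (auto simp: halfplane_def upward_halfplanes)
qed

lemma wcurv_shift: "wcurv (u - of_int n) t = wcurv u t"
  using periodic_of_int[of \<kappa> "u - of_int n" n] per_\<kappa> by (simp add: wcurv_def)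

lemma bdry_geod_curv_M: "bdry_geod_curv M (cis (2 * pi * u), 0) = \<kappa> u"
proof -
  have p: "(cis (2 * pi * u), 0) \<in> cylinder" by (simp add: cylinder_def)
  obtain b where b: "chart_at M (cis (2 * pi * u), 0) = (cyl_dom b, cyl_map b)" "(cis (2 * pi * u), 0) \<in> cyl_dom b"
    using chart_at_cyl[OF p] by metis
  then obtain n :: int where n: "b + n < u" "u < b + n + 1" using cis_in_cyl_dom_iff by blast
  note m = cyl_map_cis[OF this, of 0]
  have h: "cyl_map b (cis (2 * pi * u), 0) \<in> halfplane" by (simp add: m halfplane_def)
  have "bdry_geod_curv M (cis (2 * pi * u), 0) = wcurv (u - of_int n) (0 - 0)"
    unfolding bdry_geod_curv_def b Let_def fst_conv snd_conv
    by (subst gauss_fermi(2)[where c=0, OF _ _ _ h]) (auto simp: halfplane_def upward_halfplanes m)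
  then show ?thesis unfolding wcurv_shift by (simp add: wcurv_def)
qed

text \<open>Formulated for an arbitrary lift \<open>(u, \<tau>)\<close>, so that it covers the
  coordinates at infinity as well as those of the foliation.\<close>

lemma pullback_M:
  assumes "upward D" "x \<in> D" "continuous_on D u" "\<And>y. y \<in> D \<Longrightarrow> 0 \<le> \<tau> y"
    and f: "\<And>y. y \<in> D \<Longrightarrow> f y = (cis (2 * pi * u y), \<tau> y)"
    and d: "(u has_derivative u') (at x within D)" "(\<tau> has_derivative \<tau>') (at x within D)"
  shows "pullback_metric D M f x $ i $ j =
    (\<rho> (u x) (\<tau> x))\<^sup>2 * u' (axis i 1) * u' (axis j 1) + \<tau>' (axis i 1) * \<tau>' (axis j 1)"
proof -
  have "f x \<in> cylinder" using assms by (simp add: cylinder_def)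
  then obtain b where b: "chart_at M (f x) = (cyl_dom b, cyl_map b)" "f x \<in> cyl_dom b"
    using chart_at_cyl by metis
  note cd = chart_has_derivative[OF assms(3,2) b(2) f d]
  from cd(2) obtain n :: int where n: "cyl_map b (f x) = vector [u x - n, \<tau> x]" by blast
  have J: "jacobian (cyl_map b \<circ> f) (at x within D) = matrix (\<lambda>h. vector [u' h, \<tau>' h])"
    using upward_frechet_derivative[OF assms(1,2) cd(1)] by (simp add: jacobian_def)
  show ?thesis
    by (simp add: pullback_metric_def b J Let_def pull_dmat n dens_shift matrix_vector2)
qed

lemma speed_M:
  assumes "open W" "t \<in> W" "continuous_on W u" "\<And>s. s \<in> W \<Longrightarrow> 0 \<le> \<tau> s"
    and f: "\<And>s. s \<in> W \<Longrightarrow> \<gamma> s = (cis (2 * pi * u s), \<tau> s)"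
    and d: "(u has_real_derivative u') (at t)" "(\<tau> has_real_derivative \<tau>') (at t)"
  shows "speed M \<gamma> t = sqrt ((\<rho> (u t) (\<tau> t))\<^sup>2 * u'\<^sup>2 + \<tau>'\<^sup>2)"
proof -
  have "\<gamma> t \<in> cylinder" using assms by (simp add: cylinder_def)
  then obtain b where b: "chart_at M (\<gamma> t) = (cyl_dom b, cyl_map b)" "\<gamma> t \<in> cyl_dom b"
    using chart_at_cyl by metis
  have d': "(u has_derivative (*) u') (at t within W)" "(\<tau> has_derivative (*) \<tau>') (at t within W)"
    using d by (auto simp: has_field_derivative_def at_within_open[OF assms(2,1)])
  note cd = chart_has_derivative[OF assms(3,2) b(2) f d']
  from cd(2) obtain n :: int where n: "cyl_map b (\<gamma> t) = vector [u t - n, \<tau> t]" by blast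
  have "(\<lambda>h. vector [u' * h, \<tau>' * h]) = (\<lambda>h. h *\<^sub>R (vector [u', \<tau>'] :: real^2))"
    by (simp add: vec_eq_iff forall_2 fun_eq_iff)
  then have "((cyl_map b \<circ> \<gamma>) has_vector_derivative vector [u', \<tau>']) (at t)"
    using cd(1) unfolding at_within_open[OF assms(2,1)] has_vector_derivative_def by simp
  then have "vector_derivative (cyl_map b \<circ> \<gamma>) (at t) = vector [u', \<tau>']"
    by (rule vector_derivative_at)
  then show ?thesis
    by (simp add: speed_def b Let_def inner_g_dmat n dens_shift power2_eq_square mult_ac)
qed

end

section \<open>Lifts of curves and non-degeneracy\<close>

text \<open>On a contractible domain the circle component has a continuous logarithm; unit modulus
  makes it purely imaginary, and its imaginary part is the angle.\<close>

lemma continuous_lift_exists: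
  fixes \<gamma> :: "real \<Rightarrow> point"
  assumes "continuous_map (top_of_set D) (top_of_set cylinder) \<gamma>" "contractible D"
  obtains u where "continuous_on D u" "\<And>s. s \<in> D \<Longrightarrow> \<gamma> s = (cis (2 * pi * u s), snd (\<gamma> s))"
proof -
  have c: "continuous_on D \<gamma>" and m: "\<And>s. s \<in> D \<Longrightarrow> norm (fst (\<gamma> s)) = 1"
    using assms(1) by (auto simp: continuous_map_in_subtopology cylinder_def)
  have "continuous_on D (\<lambda>s. fst (\<gamma> s))" by (intro continuous_intros c)
  moreover have "fst (\<gamma> s) \<noteq> 0" if "s \<in> D" for s using m[OF that] by auto
  ultimately obtain g where g: "continuous_on D g" "\<And>s. s \<in> D \<Longrightarrow> fst (\<gamma> s) = exp (g s)"
    using continuous_logarithm_on_contractible[OF _ assms(2)] by metis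
  show thesis
  proof (rule that[of "\<lambda>s. Im (g s) / (2 * pi)"])
    show "continuous_on D (\<lambda>s. Im (g s) / (2 * pi))" by (intro continuous_intros g(1)) auto
    fix s assume s: "s \<in> D"
    then have "exp (Re (g s)) = 1" using m[OF s] g(2)[OF s] by simp
    then have "Re (g s) = 0" by simp
    then have "fst (\<gamma> s) = cis (Im (g s))" using g(2)[OF s] by (simp add: exp_eq_polar)
    then show "\<gamma> s = (cis (2 * pi * (Im (g s) / (2 * pi))), snd (\<gamma> s))" by (simp add: prod_eq_iff)
  qed
qed

text \<open>A continuous lift differs from a chart coordinate by a locally constant integer, so it
  inherits the smoothness of the map.\<close>

lemma smooth_lift:
  fixes \<gamma> :: "'d::euclidean_space \<Rightarrow> point"
  assumes "smooth_into D (cyl_surface v \<kappa>) \<gamma>" "continuous_on D u"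
    and f: "\<And>s. s \<in> D \<Longrightarrow> \<gamma> s = (cis (2 * pi * u s), \<tau> s)"
  shows "smooth_on D u" "smooth_on D \<tau>"
proof -
  have cm: "continuous_map (top_of_set D) (top_of_set cylinder) \<gamma>"
    and sm: "\<And>b. smooth_on {x\<in>D. \<gamma> x \<in> cyl_dom b} (cyl_map b \<circ> \<gamma>)"
    using assms(1) by (auto simp: smooth_into_def)
  have *: "\<exists>W. open W \<and> p \<in> W \<and> smooth_on (D \<inter> W) u \<and> smooth_on (D \<inter> W) \<tau>" if p: "p \<in> D" for p
  proof -
    have "\<gamma> q \<in> cylinder" if "q \<in> D" for q using that cm by (auto simp: continuous_map_in_subtopology)
    then have t0: "0 \<le> \<tau> q" if "q \<in> D" for q using that f by (auto simp: cylinder_def)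
    obtain b where "\<gamma> p \<in> cyl_dom b"
      using cyl_dom_nonempty[of "\<gamma> p"] p cm by (auto simp: continuous_map_in_subtopology)
    then have "(cis (2 * pi * u p), \<tau> p) \<in> cyl_dom b" using f[OF p] by simp
    with assms(2) p obtain n :: int and W where W: "open W" "p \<in> W"
      "\<And>q t. q \<in> D \<Longrightarrow> q \<in> W \<Longrightarrow> cyl_map b (cis (2 * pi * u q), t) = vector [u q - n, t]"
      "\<And>q t. q \<in> D \<Longrightarrow> q \<in> W \<Longrightarrow> 0 \<le> t \<Longrightarrow> (cis (2 * pi * u q), t) \<in> cyl_dom b"
      by (elim chart_of_lift) auto
    have "D \<inter> W \<subseteq> {x\<in>D. \<gamma> x \<in> cyl_dom b}" using W(4) f t0 by auto
    then have s: "smooth_on (D \<inter> W) (cyl_map b \<circ> \<gamma>)" by (rule smooth_on_subset[OF sm])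
    have "smooth_on (D \<inter> W) (\<lambda>x. (cyl_map b \<circ> \<gamma>) x $ 1 + n)"
      by (intro smooth_on_add smooth_on_const smooth_on_nth s)
    then have "smooth_on (D \<inter> W) u" by (rule smooth_on_cong) (use W(3) f in auto)
    moreover have "smooth_on (D \<inter> W) \<tau>"
      by (rule smooth_on_cong[OF smooth_on_nth[OF s, of 2]]) (use W(3) f in auto)
    ultimately show ?thesis using W(1,2) by blast
  qed
  show "smooth_on D u" by (rule smooth_on_local) (use * in blast)
  show "smooth_on D \<tau>" by (rule smooth_on_local) (use * in blast)
qed

text \<open>The ray is connected and unbounded, so it cannot avoid a set separating the boundary from infinity.\<close>

lemma enclosing_meets_rays:
  assumes "encloses_bdry (cyl_surface v \<kappa>) C"
  shows "\<exists>t\<ge>0. (cis (2 * pi * w), t) \<in> C"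
proof (rule ccontr)
  assume A: "\<not> (\<exists>t\<ge>0. (cis (2 * pi * w), t) \<in> C)"
  define R where "R = (\<lambda>t. (cis (2 * pi * w), t)) ` {0::real..}"
  define X where "X = subtopology (top_of_set cylinder) (cylinder - C)"
  define Y where "Y = connected_component_of_set X (cis (2 * pi * w), 0)"
  have X: "X = top_of_set (cylinder - C)"
    unfolding X_def subtopology_subtopology by (simp add: Int_Diff Int_absorb1 Diff_subset)
  have p: "(cis (2 * pi * w), 0) \<in> bdry (cyl_surface v \<kappa>) - C"
    using A by (auto simp: bdry_cyl cylinder_def)
  have "connected R" unfolding R_def
    by (intro connected_continuous_image continuous_intros) auto
  moreover have "R \<subseteq> cylinder - C" using A by (auto simp: R_def cylinder_def)
  ultimately have "connectedin X R" by (simp add: X connectedin_subtopology)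
  moreover have "(cis (2 * pi * w), 0) \<in> R" by (auto simp: R_def)
  ultimately have "R \<subseteq> Y" unfolding Y_def by (rule connected_component_of_maximal)
  moreover have "Y \<subseteq> topspace (top_of_set cylinder)"
    using connected_component_of_subset_topspace[of X] unfolding Y_def X by auto
  then have "Y \<subseteq> top_of_set cylinder closure_of Y" by (rule closure_of_subset)
  moreover have "compactin (top_of_set cylinder) (top_of_set cylinder closure_of Y)"
    using assms p unfolding encloses_bdry_def Y_def X_def by auto
  then have "compact (top_of_set cylinder closure_of Y)" by (simp add: compactin_subtopology)
  ultimately have "bounded (snd ` R)"
    using compact_imp_bounded bounded_subset bounded_snd by (metis subset_trans)
  moreover have "snd ` R = {0::real..}" by (auto simp: R_def image_image)
  ultimately obtain B where "\<And>x. x \<in> {0::real..} \<Longrightarrow> norm x \<le> B" by (auto simp: bounded_iff)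
  from this[of "\<bar>B\<bar> + 1"] show False by simp
qed

text \<open>Local extensions of f have continuous derivatives, and uniqueness of the derivative
  within the interval glues these. Continuity up to both ends makes the speed of a smooth piece
  integrable.\<close>

lemma smooth_on_interval_deriv:
  fixes f :: "real \<Rightarrow> real"
  assumes "smooth_on {a..b} f" "a < b"
  obtains f' where "continuous_on {a..b} f'" "\<And>s. s \<in> {a<..<b} \<Longrightarrow> DERIV f s :> f' s"
proof
  let ?f' = "\<lambda>s. vector_derivative f (at s within {a..b})"
  have loc: "\<exists>W g. open W \<and> p \<in> W \<and> continuous_on W g \<and>
      (\<forall>s\<in>{a..b} \<inter> W. (f has_vector_derivative g s) (at s within {a..b}))" if p: "p \<in> {a..b}" for p
  proof -
    from assms(1) p obtain W F where W: "open W" "p \<in> W" "\<And>n. ck_on n W F" "\<And>q. q \<in> {a..b} \<Longrightarrow> q \<in> W \<Longrightarrow> F q = f q"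
      by (rule smooth_onE) blast
    have F: "smooth_on W F" using W smooth_on_open_iff by blast
    note D = smooth_on_real_derivD[OF W(1) F]
    have "(f has_vector_derivative vector_derivative F (at s)) (at s within {a..b})" if s: "s \<in> {a..b} \<inter> W" for s
    proof -
      obtain e where e: "0 < e" "\<And>y. dist y s < e \<Longrightarrow> y \<in> W"
        using W(1) s open_dist by (metis IntD2)
      show ?thesis
        by (rule has_vector_derivative_transform_within[OF has_vector_derivative_at_within[OF D(1)] e(1)])
          (use s W(4) e(2) in auto)
    qed
    with W(1,2) smooth_on_imp_continuous_on[OF D(2)] show ?thesis by blast
  qed
  have eq: "g s = ?f' s" if "(f has_vector_derivative g s) (at s within {a..b})" "s \<in> {a..b}" for g s
    using vector_derivative_within_cbox[of a b s f "g s"] that assms(2) by simp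
  have "continuous (at p within {a..b}) ?f'" if p: "p \<in> {a..b}" for p
  proof -
    obtain W g where W: "open W" "p \<in> W" "continuous_on W g"
      "\<forall>s\<in>{a..b} \<inter> W. (f has_vector_derivative g s) (at s within {a..b})"
      using loc[OF p] by blast
    have "continuous (at p within {a..b}) g"
      using W by (simp add: continuous_on_eq_continuous_at continuous_at_imp_continuous_at_within)
    moreover have "eventually (\<lambda>q. g q = ?f' q) (at p within {a..b})"
      unfolding eventually_at_topological using W eq by blast
    moreover have "g p = ?f' p" using W p eq by blast
    ultimately show ?thesis
      unfolding continuous_within by (auto elim: Lim_transform_eventually)
  qed
  then show "continuous_on {a..b} ?f'" by (simp add: continuous_on_eq_continuous_within)
  show "DERIV f s :> ?f' s" if s: "s \<in> {a<..<b}" for s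
  proof -
    from s have "s \<in> {a..b}" by simp
    from loc[OF this] obtain W g where "s \<in> W"
      "\<forall>s\<in>{a..b} \<inter> W. (f has_vector_derivative g s) (at s within {a..b})" by blast
    with s have "(f has_vector_derivative g s) (at s within {a..b})" by auto
    then have "(f has_vector_derivative ?f' s) (at s within {a..b})" using eq s by force
    then have "(f has_vector_derivative ?f' s) (at s within {a<..<b})"
      by (rule has_vector_derivative_within_subset) auto
    then show ?thesis
      using at_within_open[OF s open_greaterThanLessThan] by (simp add: has_real_derivative_iff_has_vector_derivative)
  qed
qed

lemma real_antiderivative:
  fixes f :: "real \<Rightarrow> real"
  assumes "continuous_on UNIV f"
  obtains F where "\<And>x. DERIV F x :> f x"
  using einterval_antiderivative[of "-\<infinity>" "\<infinity>" f] assms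
  by (auto simp: has_real_derivative_iff_has_vector_derivative continuous_on_eq_continuous_at)

lemma real_const_if_DERIV_zero:
  fixes f :: "real \<Rightarrow> real"
  assumes "\<And>x. DERIV f x :> 0" shows "f x = f y"
  using DERIV_isconst_all assms by blast

lemma antiderivative_shift:
  fixes F :: "real \<Rightarrow> real"
  assumes "\<And>x. DERIV F x :> f x" "\<And>x. f (x + 1) = f x"
  shows "F (x + 1) = F x + (F 1 - F 0)"
proof -
  have "DERIV (\<lambda>x. F (x + 1) - F x) y :> 0" for y
    using DERIV_diff[OF DERIV_chain2[OF assms(1) DERIV_add[OF DERIV_ident DERIV_const[of 1]]] assms(1)[of y]]
    by (simp add: assms(2))
  from real_const_if_DERIV_zero[OF this, of x 0] show ?thesis by simp
qed

text \<open>By the mean value theorem the derivative vanishes somewhere in the period before t and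
  somewhere in the period after t; being monotone, it is squeezed to 0 at t.\<close>

lemma periodic_convex_deriv_zero:
  fixes f f' f'' :: "real \<Rightarrow> real"
  assumes d: "\<And>t. DERIV f t :> f' t" "\<And>t. DERIV f' t :> f'' t"
    and "\<And>t. 0 \<le> f'' t" "\<And>t. f (t + 1) = f t"
  shows "f' t = 0"
proof -
  have mono: "f' a \<le> f' b" if "a \<le> b" for a b
    using DERIV_nonneg_imp_nondecreasing[OF that] d(2) assms(3) by blast
  obtain x where x: "t < x" "x < t + 1" "f (t + 1) - f t = (t + 1 - t) * f' x"
    using MVT2[of t "t + 1" f f'] d(1) by auto
  obtain y where y: "t - 1 < y" "y < t" "f t - f (t - 1) = (t - (t - 1)) * f' y"
    using MVT2[of "t - 1" t f f'] d(1) by auto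
  have "f' x = 0" using x(3) assms(4)[of t] by simp
  moreover have "f' y = 0" using y(3) assms(4)[of "t - 1"] by simp
  ultimately show ?thesis using mono[of t x] mono[of y t] x y by simp
qed

section \<open>Closed geodesics and length comparison\<close>

context fermi
begin

lemma continuous_dens:
  assumes "continuous_on S u" "continuous_on S \<tau>"
  shows "continuous_on S (\<lambda>s. \<rho> (u s) (\<tau> s))"
proof -
  have "continuous_on UNIV v" "continuous_on UNIV \<kappa>"
    using smooth_v smooth_\<kappa> smooth_on_imp_continuous_on by blast+
  then have "continuous_on S (\<lambda>s. v (u s))" "continuous_on S (\<lambda>s. \<kappa> (u s))"
    using assms(1) by (auto intro: continuous_on_compose2)
  moreover have "continuous_on S (\<lambda>s. cosh (\<tau> s))" "continuous_on S (\<lambda>s. sinh (\<tau> s))"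
    using assms(2) by (auto intro!: continuous_intros)
  ultimately show ?thesis unfolding dens_def by (intro continuous_intros assms)
qed

text \<open>The upper index 2 selects the geodesic equation for the distance to the
  boundary.\<close>

lemma christoffel_M:
  assumes "x \<in> halfplane"
  shows "christoffel halfplane (gmetric M c) 2 1 1 x =
      - \<rho> (x $ 1) (x $ 2) * (v (x $ 1) * (sinh (x $ 2) + \<kappa> (x $ 1) * cosh (x $ 2)))"
    "christoffel halfplane (gmetric M c) 2 1 2 x = 0"
    "christoffel halfplane (gmetric M c) 2 2 1 x = 0"
    "christoffel halfplane (gmetric M c) 2 2 2 x = 0"
proof -
  have "\<forall>y\<in>halfplane. 0 \<le> y $ 2" "\<forall>y\<in>halfplane. gmetric M c y = dmat ((\<rho> (y $ 1) (y $ 2 - 0))\<^sup>2)"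
    by (auto simp: halfplane_def)
  from semigeodesic_fermi[OF upward_halfplanes(1) this]
  obtain D where H: "semigeodesic halfplane (gmetric M c) (\<lambda>y. (\<rho> (y $ 1) (y $ 2 - 0))\<^sup>2) D"
    "\<forall>y\<in>halfplane. D y (axis 2 1) = 2 * \<rho> (y $ 1) (y $ 2 - 0) * (v (y $ 1) * (sinh (y $ 2 - 0) + \<kappa> (y $ 1) * cosh (y $ 2 - 0)))"
    by blast
  note semigeodesic.christoffel_eq[OF H(1) assms]
  then show "christoffel halfplane (gmetric M c) 2 1 1 x =
      - \<rho> (x $ 1) (x $ 2) * (v (x $ 1) * (sinh (x $ 2) + \<kappa> (x $ 1) * cosh (x $ 2)))"
    "christoffel halfplane (gmetric M c) 2 1 2 x = 0"
    "christoffel halfplane (gmetric M c) 2 2 1 x = 0"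
    "christoffel halfplane (gmetric M c) 2 2 2 x = 0"
    using H(2) assms by auto
qed

text \<open>Along a geodesic the distance \<open>\<tau>\<close> to the boundary satisfies \<open>\<tau>'' \<ge> 0\<close>, so it is constant if the geodesic is closed.\<close>

lemma closed_geodesic_in_boundary:
  assumes "closed_geodesic M \<gamma>"
  shows "\<exists>u. \<gamma> t = (cis (2 * pi * u), 0)"
proof -
  have si: "smooth_into UNIV M \<gamma>" and per: "\<And>t. \<gamma> (t + 1) = \<gamma> t" and sp: "\<And>t. speed M \<gamma> t \<noteq> 0"
    and geo: "\<And>t c k. c \<in> charts M \<Longrightarrow> \<gamma> t \<in> fst c \<Longrightarrow>
      vector_derivative (\<lambda>s. vector_derivative (snd c \<circ> \<gamma>) (at s)) (at t) $ k +
       (\<Sum>i\<in>UNIV. \<Sum>j\<in>UNIV. christoffel halfplane (gmetric M c) k i j ((snd c \<circ> \<gamma>) t) *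
         vector_derivative (snd c \<circ> \<gamma>) (at t) $ i * vector_derivative (snd c \<circ> \<gamma>) (at t) $ j) = 0"
    using assms unfolding closed_geodesic_def Let_def by blast+
  have cm: "continuous_map (top_of_set UNIV) (top_of_set cylinder) \<gamma>"
    using si unfolding smooth_into_def cyl_surface_simps by blast
  obtain u where u: "continuous_on UNIV u" "\<And>s. \<gamma> s = (cis (2 * pi * u s), snd (\<gamma> s))"
    using continuous_lift_exists[OF cm contractible_UNIV] by auto
  define \<tau> where "\<tau> = (\<lambda>s. snd (\<gamma> s))"
  have f: "\<gamma> s = (cis (2 * pi * u s), \<tau> s)" for s using u(2) by (simp add: \<tau>_def)
  have cyl: "\<gamma> s \<in> cylinder" for s using cm by (auto simp: continuous_map_in_subtopology)
  then have \<tau>0: "0 \<le> \<tau> s" for s by (auto simp: \<tau>_def cylinder_def)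
  note sm = smooth_lift[OF si u(1) f]
  define u' where "u' = (\<lambda>s. vector_derivative u (at s))"
  define \<tau>' where "\<tau>' = (\<lambda>s. vector_derivative \<tau> (at s))"
  define u'' where "u'' = (\<lambda>s. vector_derivative u' (at s))"
  define \<tau>'' where "\<tau>'' = (\<lambda>s. vector_derivative \<tau>' (at s))"
  have du: "(u has_vector_derivative u' s) (at s)" "(\<tau> has_vector_derivative \<tau>' s) (at s)" for s
    unfolding u'_def \<tau>'_def by (intro smooth_on_real_derivD(1)[OF open_UNIV] sm UNIV_I)+
  have sm': "smooth_on UNIV u'" "smooth_on UNIV \<tau>'"
    unfolding u'_def \<tau>'_def by (intro smooth_on_real_derivD(2)[OF open_UNIV] sm)+
  have du': "(u' has_vector_derivative u'' s) (at s)" "(\<tau>' has_vector_derivative \<tau>'' s) (at s)" for s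
    unfolding u''_def \<tau>''_def by (intro smooth_on_real_derivD(1)[OF open_UNIV] sm' UNIV_I)+
  \<comment> \<open>In the second component of the geodesic equation only the symbol with lower
    indices 1, 1 contributes; its value is minus the density times the t-derivative of the
    density.\<close>
  have eq: "\<tau>'' t = \<rho> (u t) (\<tau> t) * (v (u t) * (sinh (\<tau> t) + \<kappa> (u t) * cosh (\<tau> t))) * (u' t)\<^sup>2" for t
  proof -
    obtain b where b: "\<gamma> t \<in> cyl_dom b" using cyl_dom_nonempty[OF cyl] by blast
    then have "(cis (2 * pi * u t), \<tau> t) \<in> cyl_dom b" using f by simp
    then obtain n :: int and W where W: "open W" "t \<in> W"
      "\<And>q t. q \<in> W \<Longrightarrow> cyl_map b (cis (2 * pi * u q), t) = vector [u q - n, t]"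
      by (rule chart_of_lift[OF u(1) UNIV_I]) auto
    let ?x = "cyl_map b \<circ> \<gamma>"
    have x: "?x s = vector [u s - n, \<tau> s]" if "s \<in> W" for s using W(3)[OF that] f by simp
    have "((\<lambda>s. vector [u s - n, \<tau> s] :: real^2) has_vector_derivative vector [u' s, \<tau>' s]) (at s)" for s
      unfolding vector2_eq by (auto intro!: derivative_eq_intros du[unfolded has_real_derivative_iff_has_vector_derivative[symmetric]])
    then have "(?x has_vector_derivative vector [u' s, \<tau>' s]) (at s)" if "s \<in> W" for s
      using has_vector_derivative_transform_within_open[OF _ W(1) that] x by (metis (no_types, lifting))
    then have vx: "vector_derivative ?x (at s) = vector [u' s, \<tau>' s]" if "s \<in> W" for s
      using that vector_derivative_at by blast
    have "((\<lambda>s. vector [u' s, \<tau>' s] :: real^2) has_vector_derivative vector [u'' t, \<tau>'' t]) (at t)"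
      unfolding vector2_eq by (auto intro!: derivative_eq_intros du'[unfolded has_real_derivative_iff_has_vector_derivative[symmetric]])
    then have "((\<lambda>s. vector_derivative ?x (at s)) has_vector_derivative vector [u'' t, \<tau>'' t]) (at t)"
      by (rule has_vector_derivative_transform_within_open[OF _ W(1,2)]) (simp add: vx)
    then have vv: "vector_derivative (\<lambda>s. vector_derivative ?x (at s)) (at t) = vector [u'' t, \<tau>'' t]"
      by (rule vector_derivative_at)
    have hp: "vector [u t - n, \<tau> t] \<in> halfplane" by (simp add: halfplane_def \<tau>0)
    have "(cyl_dom b, cyl_map b) \<in> charts M" by simp
    from geo[OF this, of t 2] b have
      "vector_derivative (\<lambda>s. vector_derivative ?x (at s)) (at t) $ 2 +
       (\<Sum>i\<in>UNIV. \<Sum>j\<in>UNIV. christoffel halfplane (gmetric M (cyl_dom b, cyl_map b)) 2 i j (?x t) *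
         vector_derivative ?x (at t) $ i * vector_derivative ?x (at t) $ j) = 0" by simp
    then have "\<tau>'' t = \<rho> (u t - n) (\<tau> t) * (v (u t - n) * (sinh (\<tau> t) + \<kappa> (u t - n) * cosh (\<tau> t))) * (u' t)\<^sup>2"
      unfolding vv vx[OF W(2)] x[OF W(2)] sum_2 christoffel_M[OF hp]
      by (simp add: power2_eq_square algebra_simps)
    then show ?thesis
      using periodic_of_int[of v "u t - of_int n" n] periodic_of_int[of \<kappa> "u t - of_int n" n] per_v per_\<kappa>
      by (simp add: dens_shift)
  qed
  have nn: "0 \<le> \<tau>'' t" for t
    unfolding eq using \<tau>0[of t] dens_pos[of "\<tau> t" "u t"] v_pos[of "u t"] \<kappa>_nonneg[of "u t"]
    by (intro mult_nonneg_nonneg add_nonneg_nonneg) auto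
  have p\<tau>: "\<tau> (s + 1) = \<tau> s" for s using per by (simp add: \<tau>_def)
  have z: "\<tau>' s = 0" for s
    by (rule periodic_convex_deriv_zero[OF
      du(2)[unfolded has_real_derivative_iff_has_vector_derivative[symmetric]]
      du'(2)[unfolded has_real_derivative_iff_has_vector_derivative[symmetric]] nn p\<tau>])
  have "\<tau>' = (\<lambda>s. 0)" using z by auto
  then have "\<tau>'' t = 0" by (simp add: \<tau>''_def)
  have "speed M \<gamma> t = sqrt ((\<rho> (u t) (\<tau> t))\<^sup>2 * (u' t)\<^sup>2 + (\<tau>' t)\<^sup>2)"
    by (rule speed_M[OF open_UNIV UNIV_I u(1) \<tau>0 f])
      (simp_all only: has_real_derivative_iff_has_vector_derivative du)
  \<comment> \<open>With no motion in the distance, non-zero speed means motion along the leaf, so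
    the equation forces the t-derivative of the density to vanish. Both of its summands are
    non-negative, hence \<open>sinh (\<tau> t) = 0\<close>.\<close>
  with sp[of t] z have "u' t \<noteq> 0" by auto
  with \<open>\<tau>'' t = 0\<close> eq[of t] dens_pos[OF \<tau>0, of "u t" t] v_pos[of "u t"]
  have "sinh (\<tau> t) + \<kappa> (u t) * cosh (\<tau> t) = 0" by simp
  moreover have "0 \<le> sinh (\<tau> t)" "0 \<le> \<kappa> (u t) * cosh (\<tau> t)"
    using \<tau>0[of t] \<kappa>_nonneg[of "u t"] by auto
  ultimately have "sinh (\<tau> t) = 0" by linarith
  then have "\<tau> t = 0" by simp
  then show ?thesis using f[of t] by auto
qed

text \<open>A closed geodesic lies in the boundary, and an enclosing one meets every ray; it can
  meet the rays only at t = 0, so it covers the whole boundary, which is the excluded case.\<close>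

lemma no_enclosing_geodesic_M: "no_enclosing_geodesic M"
  unfolding no_enclosing_geodesic_def
proof (intro notI, elim exE conjE)
  fix \<gamma> assume g: "closed_geodesic M \<gamma>" "range \<gamma> \<noteq> bdry M" "encloses_bdry M (range \<gamma>)"
  have sub: "range \<gamma> \<subseteq> bdry M"
  proof
    fix p assume "p \<in> range \<gamma>"
    then obtain t where "p = \<gamma> t" by blast
    with closed_geodesic_in_boundary[OF g(1), of t] show "p \<in> bdry M"
      by (auto simp: bdry_cyl cylinder_def)
  qed
  have "bdry M \<subseteq> range \<gamma>"
  proof
    fix p assume "p \<in> bdry M"
    then have p: "p \<in> cylinder" "snd p = 0" by (auto simp: bdry_cyl)
    then obtain w where w: "p = (cis (2 * pi * w), 0)" by (elim cylinder_cases) auto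
    obtain t where t: "(cis (2 * pi * w), t) \<in> range \<gamma>"
      using enclosing_meets_rays[OF g(3), of w] by blast
    with sub have "(cis (2 * pi * w), t) \<in> bdry M" by blast
    then have "t = 0" by (simp add: bdry_cyl)
    with t w show "p \<in> range \<gamma>" by simp
  qed
  with sub g(2) show False by blast
qed

text \<open>\<open>V\<close> measures arc length along the boundary, so \<open>V (u s)\<close>
  tracks the projection of the curve. Its derivative \<open>v (u s) * u' s\<close> is dominated by
  the speed, because the density is at least \<open>v\<close> and the distance component only adds
  to the speed.\<close>

lemma speed_smooth_piece:
  assumes "a < b" and si: "smooth_into {a..b} M \<gamma>" and u: "continuous_on {a..b} u"
    and f: "\<And>s. s \<in> {a..b} \<Longrightarrow> \<gamma> s = (cis (2 * pi * u s), \<tau> s)" and V: "\<And>x. DERIV V x :> v x"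
  shows "speed M \<gamma> integrable_on {a..b}" "\<bar>V (u b) - V (u a)\<bar> \<le> integral {a..b} (speed M \<gamma>)"
proof -
  have "\<gamma> s \<in> cylinder" if "s \<in> {a..b}" for s
    using that si by (auto simp: smooth_into_def continuous_map_in_subtopology)
  then have \<tau>0: "0 \<le> \<tau> s" if "s \<in> {a..b}" for s using that f by (force simp: cylinder_def)
  note sm = smooth_lift[OF si u f]
  obtain u' where u': "continuous_on {a..b} u'" "\<And>s. s \<in> {a<..<b} \<Longrightarrow> DERIV u s :> u' s"
    using smooth_on_interval_deriv[OF sm(1) assms(1)] by blast
  obtain \<tau>' where \<tau>': "continuous_on {a..b} \<tau>'" "\<And>s. s \<in> {a<..<b} \<Longrightarrow> DERIV \<tau> s :> \<tau>' s"
    using smooth_on_interval_deriv[OF sm(2) assms(1)] by blast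
  define S where "S = (\<lambda>s. sqrt ((\<rho> (u s) (\<tau> s))\<^sup>2 * (u' s)\<^sup>2 + (\<tau>' s)\<^sup>2))"
  have "continuous_on {a..b} S"
    unfolding S_def by (intro continuous_intros continuous_dens u u'(1) \<tau>'(1) smooth_on_imp_continuous_on[OF sm(2)])
  then have Si: "S integrable_on {a..b}" by (rule integrable_continuous_interval)
  \<comment> \<open>\<open>speed\<close> uses two-sided derivatives, which may be meaningless where
    two pieces meet; the end points are discarded as a finite set.\<close>
  have sp: "speed M \<gamma> s = S s" if "s \<in> {a..b} - {a, b}" for s
  proof -
    have s: "s \<in> {a<..<b}" using that by auto
    show ?thesis unfolding S_def
      by (rule speed_M[OF open_greaterThanLessThan s continuous_on_subset[OF u] _ _ u'(2)[OF s] \<tau>'(2)[OF s]])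
        (use f \<tau>0 in auto)
  qed
  show "speed M \<gamma> integrable_on {a..b}"
    by (rule integrable_spike_finite[OF _ _ Si, of "{a, b}"]) (use sp in auto)
  have Ieq: "integral {a..b} (speed M \<gamma>) = integral {a..b} S"
    by (rule integral_spike[of "{a, b}"]) (use sp in auto)
  have "isCont V x" for x using V DERIV_isCont by blast
  then have "continuous_on UNIV V" by (simp add: continuous_on_eq_continuous_at)
  then have cV: "continuous_on {a..b} (\<lambda>s. V (u s))"
    using continuous_on_compose2[OF _ u] by blast
  have I: "((\<lambda>s. v (u s) * u' s) has_integral V (u b) - V (u a)) {a..b}"
  proof (rule fundamental_theorem_of_calculus_interior)
    show "((\<lambda>s. V (u s)) has_vector_derivative v (u s) * u' s) (at s)" if "s \<in> {a<..<b}" for s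
      using DERIV_chain2[OF V u'(2)[OF that]] by (simp add: has_real_derivative_iff_has_vector_derivative)
  qed (use assms(1) cV in auto)
  have le: "\<bar>v (u s) * u' s\<bar> \<le> S s" if s: "s \<in> {a..b}" for s
  proof -
    have "\<bar>v (u s) * u' s\<bar> \<le> \<rho> (u s) (\<tau> s) * \<bar>u' s\<bar>"
      using dens_ge[OF \<tau>0[OF s], of "u s"] v_pos[of "u s"] by (simp add: abs_mult mult_right_mono)
    also have "\<dots> = sqrt ((\<rho> (u s) (\<tau> s))\<^sup>2 * (u' s)\<^sup>2)"
      using dens_pos[OF \<tau>0[OF s], of "u s"] by (simp add: real_sqrt_mult)
    also have "\<dots> \<le> S s" unfolding S_def by simp
    finally show ?thesis .
  qed
  note SI = integrable_integral[OF Si]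
  have "V (u b) - V (u a) \<le> integral {a..b} S"
    by (rule has_integral_le[OF I SI]) (use le in \<open>auto simp: abs_le_iff\<close>)
  moreover have "- (V (u b) - V (u a)) \<le> integral {a..b} S"
    by (rule has_integral_le[OF has_integral_neg[OF I] SI]) (use le in \<open>auto simp: abs_le_iff\<close>)
  ultimately show "\<bar>V (u b) - V (u a)\<bar> \<le> integral {a..b} (speed M \<gamma>)"
    unfolding Ieq by (simp add: abs_le_iff)
qed

text \<open>The bound by a difference of \<open>V\<close> is additive under the triangle inequality,
  so an interval can be split at a break point; the induction is on the number of break points in
  its interior.\<close>

lemma speed_piecewise:
  assumes T: "finite T" and pieces: "\<And>a b. 0 \<le> a \<Longrightarrow> a < b \<Longrightarrow> b \<le> 1 \<Longrightarrow> {a<..<b} \<inter> T = {} \<Longrightarrow> smooth_into {a..b} M \<gamma>"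
    and u: "continuous_on {0..1} u"
    and f: "\<And>s. s \<in> {0..1} \<Longrightarrow> \<gamma> s = (cis (2 * pi * u s), \<tau> s)" and V: "\<And>x. DERIV V x :> v x"
    and ab: "0 \<le> a" "a < b" "b \<le> 1"
  shows "speed M \<gamma> integrable_on {a..b} \<and> \<bar>V (u b) - V (u a)\<bar> \<le> integral {a..b} (speed M \<gamma>)"
  using ab
proof (induction "card ({a<..<b} \<inter> T)" arbitrary: a b rule: less_induct)
  case less
  show ?case
  proof (cases "{a<..<b} \<inter> T = {}")
    case True
    have "smooth_into {a..b} M \<gamma>" using pieces less.prems True by blast
    moreover have "continuous_on {a..b} u" by (rule continuous_on_subset[OF u]) (use less.prems in auto)
    ultimately show ?thesis
      using speed_smooth_piece[OF less.prems(2) _ _ _ V] f less.prems by force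
  next
    case False
    then obtain c where c: "c \<in> {a<..<b}" "c \<in> T" by blast
    have "{a<..<c} \<inter> T \<subset> {a<..<b} \<inter> T" "{c<..<b} \<inter> T \<subset> {a<..<b} \<inter> T" using c by auto
    then have "card ({a<..<c} \<inter> T) < card ({a<..<b} \<inter> T)" "card ({c<..<b} \<inter> T) < card ({a<..<b} \<inter> T)"
      using T by (auto intro: psubset_card_mono)
    with less.hyps[of a c] less.hyps[of c b] less.prems c
    have 1: "speed M \<gamma> integrable_on {a..c}" "\<bar>V (u c) - V (u a)\<bar> \<le> integral {a..c} (speed M \<gamma>)"
      and 2: "speed M \<gamma> integrable_on {c..b}" "\<bar>V (u b) - V (u c)\<bar> \<le> integral {c..b} (speed M \<gamma>)"
      by auto
    have i: "speed M \<gamma> integrable_on {a..b}"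
      by (rule Henstock_Kurzweil_Integration.integrable_combine[OF _ _ 1(1) 2(1)]) (use c in auto)
    have "integral {a..c} (speed M \<gamma>) + integral {c..b} (speed M \<gamma>) = integral {a..b} (speed M \<gamma>)"
      by (rule Henstock_Kurzweil_Integration.integral_combine[OF _ _ i]) (use c in auto)
    with 1(2) 2(2) i show ?thesis by linarith
  qed
qed

lemma speed_nonneg: "0 \<le> speed M \<gamma> t"
  by (simp add: speed_def Let_def inner_g_dmat mult.assoc)

lemma speed_boundary_curve: "speed M (\<lambda>s. (cis (2 * pi * s), 0)) t = v t"
  using speed_M[OF open_UNIV UNIV_I, of "\<lambda>s. s" "\<lambda>s. 0" "\<lambda>s. (cis (2 * pi * s), 0)" 1 t 0] v_pos[of t]
  by (simp add: dens_def)

text \<open>Between a minimum q and a maximum p of its lift, an enclosing curve sweeps at least one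
  period of the angle. Its projection therefore runs through the full length
  \<open>V 1 - V 0\<close> of the boundary.\<close>

lemma outer_minimising_M: "outer_minimising M"
proof -
  have "continuous_on UNIV v" using smooth_v smooth_on_imp_continuous_on by blast
  then obtain V where V: "\<And>x. DERIV V x :> v x" by (rule real_antiderivative) blast
  define \<beta> :: "real \<Rightarrow> point" where "\<beta> = (\<lambda>s. (cis (2 * pi * s), 0))"
  have sm: "smooth_into D M \<beta>" for D
    by (rule smooth_into_cyl[of _ "\<lambda>s. s" "\<lambda>s. 0"]) (auto simp: \<beta>_def intro: smooth_on_id smooth_on_const)
  then have "continuous_map (top_of_set {0..1}) (sspace M) \<beta>" by (simp add: smooth_into_def)
  moreover have "\<beta> 0 = \<beta> 1" by (simp add: \<beta>_def)
  ultimately have cl: "closed_curve M \<beta>"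
    unfolding closed_curve_def using sm by (intro conjI exI[of _ "{}"]) auto
  have inj: "inj_on \<beta> {0..<1}"
  proof (rule inj_onI)
    fix x y assume xy: "x \<in> {0..<1}" "y \<in> {0..<1}" "\<beta> x = \<beta> y"
    then obtain n :: int where n: "x = y + of_int n" using cis_2pi_eq_iff by (auto simp: \<beta>_def)
    with xy have "real_of_int n < 1" "-1 < real_of_int n" by auto
    then have "n = 0" by linarith
    with n show "x = y" by simp
  qed
  have img: "\<beta> ` {0..1} = bdry M"
  proof
    show "\<beta> ` {0..1} \<subseteq> bdry M" by (auto simp: \<beta>_def bdry_cyl cylinder_def)
    show "bdry M \<subseteq> \<beta> ` {0..1}"
    proof
      fix p assume "p \<in> bdry M"
      then obtain w where w: "p = (cis (2 * pi * w), 0)" by (auto simp: bdry_cyl elim!: cylinder_cases)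
      have "cis (2 * pi * w) = cis (2 * pi * frac w)"
        using cis_2pi_shift[of "frac w" "\<lfloor>w\<rfloor>"] by (simp add: frac_def)
      then have "p = \<beta> (frac w)" by (simp add: w \<beta>_def)
      moreover have "frac w \<in> {0..1}" using frac_lt_1[of w] by (auto simp: less_imp_le)
      ultimately show "p \<in> \<beta> ` {0..1}" by blast
    qed
  qed
  have "(v has_integral V 1 - V 0) {0..1}"
    by (rule fundamental_theorem_of_calculus)
      (auto intro: has_vector_derivative_at_within V[unfolded has_real_derivative_iff_has_vector_derivative])
  then have len: "len M \<beta> = V 1 - V 0"
    unfolding len_def \<beta>_def speed_boundary_curve by (simp add: integral_unique)
  have Vmono: "V x < V y" if "x < y" for x y
    using DERIV_pos_imp_increasing[OF that, of V] V v_pos by blast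
  have "len M \<beta> \<le> len M \<gamma>" if g: "closed_curve M \<gamma>" "encloses_bdry M (\<gamma> ` {0..1})" for \<gamma>
  proof -
    have cm: "continuous_map (top_of_set {0..1}) (top_of_set cylinder) \<gamma>"
      using g(1) by (simp add: closed_curve_def)
    obtain T where T: "finite T"
      "\<And>a b. 0 \<le> a \<Longrightarrow> a < b \<Longrightarrow> b \<le> 1 \<Longrightarrow> {a<..<b} \<inter> T = {} \<Longrightarrow> smooth_into {a..b} M \<gamma>"
      using g(1) unfolding closed_curve_def by blast
    have "contractible {0..1::real}" by (simp add: convex_imp_contractible)
    then obtain u where u: "continuous_on {0..1} u" "\<And>s. s \<in> {0..1} \<Longrightarrow> \<gamma> s = (cis (2 * pi * u s), snd (\<gamma> s))"
      using continuous_lift_exists[OF cm] by auto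
    have sp: "speed M \<gamma> integrable_on {a..b} \<and> \<bar>V (u b) - V (u a)\<bar> \<le> integral {a..b} (speed M \<gamma>)"
      if "0 \<le> a" "a < b" "b \<le> 1" for a b
      by (rule speed_piecewise[OF T(1) _ u(1) _ V that]) (fact T(2), fact u(2))
    have ne: "{0..1::real} \<noteq> {}" by simp
    obtain p where p: "p \<in> {0..1}" "\<And>s. s \<in> {0..1} \<Longrightarrow> u s \<le> u p"
      using continuous_attains_sup[OF compact_Icc ne u(1)] by blast
    obtain q where q: "q \<in> {0..1}" "\<And>s. s \<in> {0..1} \<Longrightarrow> u q \<le> u s"
      using continuous_attains_inf[OF compact_Icc ne u(1)] by blast
    \<comment> \<open>Otherwise there is a gap between \<open>u p\<close> and
      \<open>u q + 1\<close>. Its midpoint w exceeds every value of the lift by strictly between 0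
      and 1, so the curve misses the ray at w.\<close>
    have wide: "u q + 1 \<le> u p"
    proof (rule ccontr)
      assume A: "\<not> u q + 1 \<le> u p"
      define w where "w = (u p + u q + 1) / 2"
      obtain t where "(cis (2 * pi * w), t) \<in> \<gamma> ` {0..1}"
        using enclosing_meets_rays[OF g(2), of w] by blast
      then obtain s where s: "s \<in> {0..1}" "cis (2 * pi * w) = cis (2 * pi * u s)"
        using u(2) by (metis imageE prod.inject)
      then obtain n :: int where "w = u s + of_int n" using cis_2pi_eq_iff by blast
      with A p(2)[OF s(1)] q(2)[OF s(1)] have "0 < real_of_int n" "real_of_int n < 1"
        unfolding w_def by (auto simp: field_simps)
      then show False by simp
    qed
    then have "V 1 - V 0 \<le> V (u p) - V (u q)"
      using antiderivative_shift[OF V per_v, of "u q"] Vmono[of "u q + 1" "u p"] by (cases "u q + 1 = u p") auto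
    moreover have "\<bar>V (u b) - V (u a)\<bar> \<le> len M \<gamma>" if "0 \<le> a" "a < b" "b \<le> 1" for a b
    proof -
      have "integral {a..b} (speed M \<gamma>) \<le> integral {0..1} (speed M \<gamma>)"
        by (rule integral_subset_le) (use that sp[of a b] sp[of 0 1] speed_nonneg in auto)
      with sp[of a b] that show ?thesis by (simp add: len_def)
    qed
    \<comment> \<open>The maximum may be attained before or after the minimum, hence the absolute
      value.\<close>
    from this[of p q] this[of q p] have "\<bar>V (u p) - V (u q)\<bar> \<le> len M \<gamma>"
      using p(1) q(1) wide by (cases p q rule: linorder_cases) (auto simp: abs_minus_commute)
    ultimately show ?thesis unfolding len by linarith
  qed
  with cl inj img show ?thesis unfolding outer_minimising_def by blast
qed

end

section \<open>Coordinates at infinity and the mass\<close>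

text \<open>Since \<open>f x - p * x\<close> has period 1, f is unbounded in both directions and
  thus onto. The shift law of the inverse is what makes it descend to the circle.\<close>

lemma inverse_of_quasiperiodic:
  fixes f f' :: "real \<Rightarrow> real"
  assumes d: "\<And>x. DERIV f x :> f' x" and pos: "\<And>x. 0 < f' x"
    and shift: "\<And>x. f (x + 1) = f x + p" and p: "0 < p"
  obtains g where "\<And>x. g (f x) = x" "\<And>y. f (g y) = y" "\<And>y. DERIV g y :> 1 / f' (g y)"
    "\<And>y (n::int). g (y + p * n) = g y + n"
proof -
  have sm: "f x < f y" if "x < y" for x y
    using DERIV_pos_imp_increasing[OF that, of f] d pos by blast
  then have inj: "inj f" by (metis injI less_irrefl linorder_neqE)
  have shiftn: "f (x + of_int n) = f x + p * of_int n" for x and n :: int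
    using periodic_of_int[of "\<lambda>x. f x - p * x" x n] shift by (simp add: algebra_simps)
  have ic: "isCont f x" for x using d DERIV_isCont by blast
  \<comment> \<open>Integers m and n on either side of \<open>(y - f 0) / p\<close> give values of f
    on either side of y.\<close>
  have surj: "\<exists>x. f x = y" for y
  proof -
    obtain n :: int where n: "(y - f 0) / p < n" using ex_less_of_int by blast
    obtain m :: int where m: "m < (y - f 0) / p" using ex_of_int_less by blast
    have "f 0 + p * m \<le> y" "y \<le> f 0 + p * n" using n m p by (auto simp: field_simps)
    then have "f (of_int m) \<le> y" "y \<le> f (of_int n)" using shiftn[of 0] by auto
    moreover have "m < n" using n m by linarith
    ultimately show ?thesis using IVT[of f "of_int m" y "of_int n"] ic by auto
  qed
  define g where "g = inv f"
  have gf: "g (f x) = x" for x by (simp add: g_def inj)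
  have fg: "f (g y) = y" for y using surj unfolding g_def by (metis f_inv_into_f rangeI)
  have ig: "isCont g y" for y
    using isCont_inverse_function[of 1 "g y" g f] gf ic fg by simp
  show thesis
  proof (rule that[of g])
    show "DERIV g y :> 1 / f' (g y)" for y
      using DERIV_inverse_function[where f=f and g=g and x=y and D="f' (g y)" and a="y - 1" and b="y + 1"]
        d pos[of "g y"] fg ig
      by (simp add: inverse_eq_divide)
    show "g (y + p * n) = g y + n" for y and n :: int
      using shiftn[of "g y" n] gf fg by metis
  qed (use gf fg in auto)
qed

context fermi
begin

text \<open>The coefficients of \<open>exp t\<close> and, in \<open>decay\<close>, of
  \<open>exp (- t)\<close> in the density; \<open>decay\<close> is negative where
  \<open>\<kappa>\<close> exceeds 1.\<close>

definition grow :: "real \<Rightarrow> real" where "grow u = (1 + \<kappa> u) / 2 * v u"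
definition decay :: "real \<Rightarrow> real" where "decay u = (1 - \<kappa> u) / 2 * v u"

lemma grow_pos: "0 < grow u"
  using \<kappa>_nonneg[of u] v_pos[of u] by (simp add: grow_def add_pos_nonneg)

lemma smooth_grow: "smooth_on UNIV grow" and smooth_decay: "smooth_on UNIV decay"
proof -
  have "smooth_on UNIV (\<lambda>u. (1/2) * (1 + \<kappa> u) * v u)" "smooth_on UNIV (\<lambda>u. (1/2) * (1 - \<kappa> u) * v u)"
    by (intro smooth_on_mult smooth_on_add smooth_on_minus smooth_on_const smooth_v smooth_\<kappa>)+
  then show "smooth_on UNIV grow" "smooth_on UNIV decay"
    by (simp_all add: grow_def[abs_def] decay_def[abs_def])
qed

lemma dens_exp: "\<rho> u t = grow u * exp t + decay u * exp (- t)"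
  by (simp add: dens_def grow_def decay_def cosh_field_def sinh_field_def field_simps)

text \<open>From \<open>\<bar>1 - \<kappa> u\<bar> \<le> 1 + \<kappa> u\<close>. The bound is
  uniform in u, so a single constant controls the error at infinity in all directions.\<close>

lemma ratio_le: "\<bar>decay u / grow u\<bar> \<le> 1"
proof -
  have "\<bar>decay u\<bar> = \<bar>1 - \<kappa> u\<bar> / 2 * v u" "\<bar>1 - \<kappa> u\<bar> \<le> 1 + \<kappa> u"
    using \<kappa>_nonneg[of u] v_pos[of u] by (auto simp: decay_def abs_mult)
  then have "\<bar>decay u\<bar> \<le> grow u" using v_pos[of u] by (simp add: grow_def mult_right_mono)
  then show ?thesis using grow_pos[of u] by simp
qed

end

text \<open>
  The angle \<open>\<phi>\<close> at infinity is proportional to the length of the leaves as measured by the coefficient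
  of \<open>exp t\<close>, so that the leading term of the metric is round.
\<close>

locale fermi_end = fermi +
  fixes c :: real and \<phi> \<psi> :: "real \<Rightarrow> real"
  assumes c_pos: "0 < c"
    and D\<phi>: "\<And>u. DERIV \<phi> u :> grow u / c"
    and \<psi>\<phi>: "\<And>u. \<psi> (\<phi> u) = u" and \<phi>\<psi>: "\<And>x. \<phi> (\<psi> x) = x"
    and D\<psi>: "\<And>x. DERIV \<psi> x :> c / grow (\<psi> x)"
    and \<psi>_shift: "\<And>x (n::int). \<psi> (x + 2 * pi * n) = \<psi> x + n"
begin

text \<open>The inverse of (u, t) \<mapsto> (\<phi> u, c exp t), written through \<open>Arg\<close>
  because its argument is a point of the circle and not an angle.\<close>

definition Q :: "complex \<times> real \<Rightarrow> point" where
  "Q p = (cis (2 * pi * \<psi> (Arg (fst p))), ln (snd p / c))"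

text \<open>The entry 1 that \<open>dmat\<close> puts in position (2, 2) comes from (1 + r^2) / r^2
  = 1 + 1 / r^2; position (1, 1) holds the cross term of a square.\<close>

definition \<mu> :: "real \<Rightarrow> real^2^2" where
  "\<mu> x = dmat (2 * c\<^sup>2 * (decay (\<psi> x) / grow (\<psi> x)))"

text \<open>The condition r > c puts the points at positive distance \<open>ln (r / c)\<close> from
  the boundary, and r > 1 allows r^(-4) to be estimated by r^(-3).\<close>

definition R :: real where "R = max 1 c"

lemma R_pos: "0 < R" and R_ge: "1 \<le> R" "c \<le> R"
  by (auto simp: R_def)

text \<open>\<open>Arg\<close> returns x up to a multiple of 2 pi; \<open>\<psi>\<close> turns this
  into an integer, which the circle does not see.\<close>

lemma Q_cis: "Q (cis x, r) = (cis (2 * pi * \<psi> x), ln (r / c))"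
proof -
  have "cis (Arg (cis x)) = cis x" using rcis_cmod_Arg[of "cis x"] by (simp add: rcis_def)
  then have "cis (2 * pi * (Arg (cis x) / (2 * pi))) = cis (2 * pi * (x / (2 * pi)))" by simp
  then obtain n :: int where "Arg (cis x) / (2 * pi) = x / (2 * pi) + n" using cis_2pi_eq_iff by blast
  then have "Arg (cis x) = x + 2 * pi * n" by (simp add: field_simps)
  then show ?thesis by (simp add: Q_def \<psi>_shift cis_2pi_shift)
qed

lemma smooth_\<phi>: "smooth_on UNIV \<phi>"
proof (rule smooth_on_real_deriv[OF open_UNIV])
  show "(\<phi> has_vector_derivative (1 / c) * grow u) (at u)" for u
    using D\<phi>[of u] by (simp add: has_real_derivative_iff_has_vector_derivative)
qed (intro smooth_on_mult smooth_on_const smooth_grow)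

lemma smooth_\<psi>: "smooth_on UNIV \<psi>"
proof (rule smooth_on_autonomous[OF open_UNIV open_UNIV])
  show "smooth_on UNIV (\<lambda>u. c / grow u)"
    by (intro smooth_on_divide smooth_on_const smooth_grow grow_pos)
  show "(\<psi> has_vector_derivative c / grow (\<psi> x)) (at x)" for x
    using D\<psi>[of x] by (simp add: has_real_derivative_iff_has_vector_derivative)
qed auto

lemma ln_gt: "R \<le> R' \<Longrightarrow> R' < r \<Longrightarrow> ln (R' / c) < ln (r / c)" "R \<le> R' \<Longrightarrow> 0 \<le> ln (R' / c)"
  using R_ge c_pos by (auto simp: divide_strict_right_mono)

lemma Q_inverse:
  assumes "R \<le> R'" "ln (R' / c) < t"
  shows "Q (cis (\<phi> u), c * exp t) = (cis (2 * pi * u), t)" "R' < c * exp t"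
proof -
  show "Q (cis (\<phi> u), c * exp t) = (cis (2 * pi * u), t)" using c_pos by (simp add: Q_cis \<psi>\<phi>)
  have "R' / c < exp t"
    using assms R_pos c_pos by (metis exp_less_cancel_iff exp_ln divide_pos_pos order_less_le_trans)
  then show "R' < c * exp t" using c_pos by (simp add: field_simps)
qed

lemma Q_image:
  assumes "R \<le> R'"
  shows "Q ` (range cis \<times> {R'<..}) = {p \<in> cylinder. ln (R' / c) < snd p}"
proof
  show "Q ` (range cis \<times> {R'<..}) \<subseteq> {p \<in> cylinder. ln (R' / c) < snd p}"
    using ln_gt[OF assms] by (force simp: Q_cis cylinder_def)
  show "{p \<in> cylinder. ln (R' / c) < snd p} \<subseteq> Q ` (range cis \<times> {R'<..})"
  proof
    fix p assume p: "p \<in> {p \<in> cylinder. ln (R' / c) < snd p}"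
    then obtain u t where "p = (cis (2 * pi * u), t)" by (auto elim: cylinder_cases)
    with p Q_inverse(1)[OF assms, of t u] Q_inverse(2)[OF assms, of t] show "p \<in> Q ` (range cis \<times> {R'<..})"
      by (intro image_eqI[of _ _ "(cis (\<phi> u), c * exp t)"]) auto
  qed
qed

lemma inj_Q: "inj_on Q (range cis \<times> {R<..})"
proof (rule inj_onI)
  fix p q assume "p \<in> range cis \<times> {R<..}" "q \<in> range cis \<times> {R<..}" and eq: "Q p = Q q"
  then obtain x r y s where xy: "p = (cis x, r)" "q = (cis y, s)" "R < r" "R < s" by auto
  with eq have 1: "cis (2 * pi * \<psi> x) = cis (2 * pi * \<psi> y)" and 2: "ln (r / c) = ln (s / c)"
    by (auto simp: Q_cis)
  have "r / c = s / c" using 2 xy(3,4) R_pos c_pos by (subst (asm) ln_inj_iff) auto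
  moreover obtain n :: int where "\<psi> x = \<psi> y + n" using 1 cis_2pi_eq_iff by blast
  then have "\<psi> x = \<psi> (y + 2 * pi * n)" using \<psi>_shift by simp
  then have "x = y + 2 * pi * n" using \<phi>\<psi> by metis
  then have "x / (2 * pi) = y / (2 * pi) + n" by (simp add: field_simps)
  then have "cis (2 * pi * (x / (2 * pi))) = cis (2 * pi * (y / (2 * pi)))" using cis_2pi_eq_iff by blast
  then have "cis x = cis y" by simp
  ultimately show "p = q" using xy c_pos by simp
qed

lemma cyl_diffeo_Q: "cyl_diffeo cis {R<..} M (Q ` (range cis \<times> {R<..})) Q"
  unfolding cyl_diffeo_def
proof (intro conjI ballI)
  let ?U = "Q ` (range cis \<times> {R<..})"
  have U: "?U = {p \<in> cylinder. ln (R / c) < snd p}" by (rule Q_image) simp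
  have "?U = cylinder \<inter> {p. ln (R / c) < snd p}" using U by auto
  moreover have "open {p :: point. ln (R / c) < snd p}" by (intro open_Collect_less continuous_intros)
  ultimately show "openin (sspace M) ?U" by auto
  show "bij_betw Q (range cis \<times> {R<..}) ?U" using inj_Q by (simp add: bij_betw_def)
  show "smooth_into {x. x $ 2 \<in> {R<..}} M (cyl_coords cis Q)"
  proof (rule smooth_into_cyl)
    show "smooth_on {x. x $ 2 \<in> {R<..}} (\<lambda>x. \<psi> (x $ 1))"
      by (intro smooth_on_compose[OF _ smooth_\<psi>] smooth_on_nth smooth_on_id) auto
    show "smooth_on {x. x $ 2 \<in> {R<..}} (\<lambda>x. ln (x $ 2 / c))"
      by (intro smooth_on_compose[OF _ smooth_on_ln] smooth_on_divide smooth_on_const smooth_on_nth smooth_on_id c_pos)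
        (use R_pos c_pos in auto)
    show "0 \<le> ln (x $ 2 / c)" if "x \<in> {x. x $ 2 \<in> {R<..}}" for x
      using ln_gt(2)[of "x $ 2"] that by auto
  qed (simp add: cyl_coords_def Q_cis)
  fix ch assume "ch \<in> charts M"
  then obtain b where ch: "ch = (cyl_dom b, cyl_map b)" by auto
  show "smooth_on (snd ch ` (fst ch \<inter> ?U)) (inv_into (range cis \<times> {R<..}) Q \<circ> chart_inv ch)"
  proof (rule smooth_on_cong)
    show "smooth_on (snd ch ` (fst ch \<inter> ?U)) (\<lambda>x. (cis (\<phi> (x $ 1)), c * exp (x $ 2)))"
      by (intro smooth_on_Pair smooth_on_mult smooth_on_const smooth_on_compose[OF _ smooth_on_cis]
        smooth_on_compose[OF _ smooth_\<phi>] smooth_on_compose[OF _ smooth_on_exp] smooth_on_nth smooth_on_id) auto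
    fix x assume "x \<in> snd ch ` (fst ch \<inter> ?U)"
    then obtain p where p: "p \<in> cyl_dom b" "p \<in> ?U" "x = cyl_map b p" by (auto simp: ch)
    then have x: "x \<in> strip b" "unroll x = p" using cyl_map_image[of b] by (auto simp: unroll_cyl_map)
    with p(2) U have t: "ln (R / c) < x $ 2" by (auto simp: unroll_def)
    have "inv_into (range cis \<times> {R<..}) Q (unroll x) = (cis (\<phi> (x $ 1)), c * exp (x $ 2))"
      by (rule inv_into_f_eq[OF inj_Q]) (use Q_inverse(1)[OF order_refl t, of "x $ 1"] Q_inverse(2)[OF order_refl t] in \<open>auto simp: unroll_def\<close>)
    then show "(cis (\<phi> (x $ 1)), c * exp (x $ 2)) = (inv_into (range cis \<times> {R<..}) Q \<circ> chart_inv ch) x"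
      by (simp add: ch chart_inv_cyl[OF x(1)])
  qed
qed

text \<open>Here du = (c / \<open>grow\<close>) d\<phi> and dt = dr / r. Multiplied by c /
  \<open>grow\<close>, the growing part of the density becomes exactly r, and the decaying part
  becomes the correction of order 1 / r.\<close>

lemma pullback_Q:
  assumes "R < r"
  shows "pullback_metric {x. R < x $ 2} M (cyl_coords cis Q) (vector [x, r]) $ 1 $ 1
      = (r + c\<^sup>2 * (decay (\<psi> x) / grow (\<psi> x)) / r)\<^sup>2"
    "pullback_metric {x. R < x $ 2} M (cyl_coords cis Q) (vector [x, r]) $ 1 $ 2 = 0"
    "pullback_metric {x. R < x $ 2} M (cyl_coords cis Q) (vector [x, r]) $ 2 $ 1 = 0"
    "pullback_metric {x. R < x $ 2} M (cyl_coords cis Q) (vector [x, r]) $ 2 $ 2 = (1 / r)\<^sup>2"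
proof -
  let ?D = "{x :: real^2. R < x $ 2}" and ?x = "vector [x, r] :: real^2"
  have r: "0 < r" using assms R_pos by simp
  have "isCont \<psi> y" for y using D\<psi> DERIV_isCont by blast
  then have "continuous_on UNIV \<psi>" by (simp add: continuous_on_eq_continuous_at)
  then have 1: "continuous_on ?D (\<lambda>x. \<psi> (x $ 1))"
    by (rule continuous_on_compose2) (auto intro: continuous_intros)
  have 2: "0 \<le> ln (y $ 2 / c)" if "y \<in> ?D" for y using ln_gt(2)[of "y $ 2"] that by auto
  have 3: "cyl_coords cis Q y = (cis (2 * pi * \<psi> (y $ 1)), ln (y $ 2 / c))" for y
    by (simp add: cyl_coords_def Q_cis)
  have 4: "((\<lambda>y. \<psi> (y $ 1)) has_derivative (\<lambda>h. h $ 1 * (c / grow (\<psi> x)))) (at ?x within ?D)"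
    by (rule DERIV_compose_FDERIV[OF _ nth_has_derivative]) (simp add: D\<psi>)
  have "DERIV (\<lambda>r. ln (r / c)) r :> 1 / r"
    using r c_pos by (auto intro!: derivative_eq_intros)
  then have 5: "((\<lambda>y. ln (y $ 2 / c)) has_derivative (\<lambda>h. h $ 2 * (1 / r))) (at ?x within ?D)"
    by (intro DERIV_compose_FDERIV[OF _ nth_has_derivative]) simp
  have xD: "?x \<in> ?D" using assms by simp
  have pb: "pullback_metric ?D M (cyl_coords cis Q) ?x $ i $ j =
     (\<rho> (\<psi> x) (ln (r / c)))\<^sup>2 * (axis i 1 $ 1 * (c / grow (\<psi> x))) * (axis j 1 $ 1 * (c / grow (\<psi> x))) +
     (axis i 1 $ 2 * (1 / r)) * (axis j 1 $ 2 * (1 / r))" for i j :: 2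
    using pullback_M[OF upward_halfplanes(3) xD 1 2 3 4 5, of i j] by simp
  have e: "exp (ln (r / c)) = r / c" "exp (- ln (r / c)) = c / r"
    using r c_pos by (simp_all add: exp_minus)
  have "\<rho> (\<psi> x) (ln (r / c)) * (c / grow (\<psi> x)) = r + c\<^sup>2 * (decay (\<psi> x) / grow (\<psi> x)) / r"
    unfolding dens_exp e using r c_pos grow_pos[of "\<psi> x"] by (simp add: field_simps power2_eq_square)
  then have s: "(\<rho> (\<psi> x) (ln (r / c)))\<^sup>2 * (c / grow (\<psi> x)) * (c / grow (\<psi> x))
      = (r + c\<^sup>2 * (decay (\<psi> x) / grow (\<psi> x)) / r)\<^sup>2"
    by (metis (no_types, lifting) mult.assoc mult.left_commute power2_eq_square)
  show "pullback_metric ?D M (cyl_coords cis Q) ?x $ 1 $ 1 = (r + c\<^sup>2 * (decay (\<psi> x) / grow (\<psi> x)) / r)\<^sup>2"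
    "pullback_metric ?D M (cyl_coords cis Q) ?x $ 1 $ 2 = 0"
    "pullback_metric ?D M (cyl_coords cis Q) ?x $ 2 $ 1 = 0"
    "pullback_metric ?D M (cyl_coords cis Q) ?x $ 2 $ 2 = (1 / r)\<^sup>2"
    unfolding pb s[symmetric] by (simp_all add: axis_def power2_eq_square)
qed

lemma alh_M: "alh M Q \<mu>"
  unfolding alh_def
proof (intro exI conjI allI impI)
  show "0 < R" by (rule R_pos)
  show "cyl_diffeo cis {R<..} M (Q ` (range cis \<times> {R<..})) Q" by (rule cyl_diffeo_Q)
next
  fix R' assume "R \<le> R'"
  have "topspace (sspace M) - Q ` (range cis \<times> {R'<..}) = sphere 0 1 \<times> {0..ln (R' / c)}"
    unfolding Q_image[OF \<open>R \<le> R'\<close>] by (auto simp: cylinder_def)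
  moreover have "compact (sphere (0::complex) 1 \<times> {0..ln (R' / c)})"
    by (intro compact_Times compact_sphere compact_Icc)
  ultimately show "compactin (sspace M) (topspace (sspace M) - Q ` (range cis \<times> {R'<..}))"
    by (auto simp: compactin_subtopology)
next
  fix x r and i j :: 2 assume r: "R < r"
  then have r1: "1 < r" using R_ge by simp
  define q where "q = decay (\<psi> x) / grow (\<psi> x)"
  have q: "q\<^sup>2 \<le> 1" using ratio_le[of "\<psi> x"] by (simp add: q_def abs_square_le_1)
  have s: "sqrt (1 + r\<^sup>2) * sqrt (1 + r\<^sup>2) = 1 + r\<^sup>2"
    by (rule real_sqrt_mult_self[THEN trans]) simp
  \<comment> \<open>After removal of the leading term and the cross term only the last square
    remains. It is of order r^(-4), and \<open>q\<^sup>2 \<le> 1\<close> allows the constant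
    \<open>c^4\<close>.\<close>
  have "1 / r * (1 / r) * (r + c\<^sup>2 * q / r)\<^sup>2 - 1 - 2 * c\<^sup>2 * q / r\<^sup>2 = c^4 * q\<^sup>2 / r^4"
    using r1 by (simp add: field_simps power2_eq_square power4_eq_xxxx)
  moreover have "c^4 * q\<^sup>2 / r^4 \<le> c^4 / r^3"
  proof -
    have "c^4 * q\<^sup>2 \<le> c^4 * 1" using q by (intro mult_left_mono) auto
    moreover have "r^3 \<le> r^4" using r1 by (intro power_increasing) auto
    ultimately show ?thesis using r1 by (intro frac_le) auto
  qed
  moreover have "0 \<le> c^4 * q\<^sup>2 / r^4" by simp
  ultimately have 11: "\<bar>1 / r * (1 / r) * (r + c\<^sup>2 * q / r)\<^sup>2 - 1 - 2 * c\<^sup>2 * q / r\<^sup>2\<bar> \<le> c^4 / r^3" by linarith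
  \<comment> \<open>The radial component agrees with its expansion without any error.\<close>
  have "(1 + r\<^sup>2) * (1 / r)\<^sup>2 - 1 - 1 / r\<^sup>2 = 0" using r1 by (simp add: field_simps power2_eq_square)
  then have 22: "\<bar>sqrt (1 + r\<^sup>2) * sqrt (1 + r\<^sup>2) * (1 / r)\<^sup>2 - 1 - 1 / r\<^sup>2\<bar> \<le> c^4 / r^3"
    unfolding s using r1 by simp
  have n: "0 \<le> c^4 / r^3" using r1 by simp
  show "\<bar>coframe_scale r i * coframe_scale r j *
         pullback_metric {x. R < x $ 2} M (cyl_coords cis Q) (vector [x, r]) $ i $ j
         - mat 1 $ i $ j - \<mu> x $ i $ j / r^2\<bar> \<le> c^4 / r^3"
    using exhaust_2[of i] exhaust_2[of j] 11 22 n
    by (elim disjE) (simp_all add: coframe_scale_def pullback_Q[OF r] \<mu>_def mat_def q_def[symmetric] del: real_sqrt_mult_self)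
qed

text \<open>The substitution x = \<phi> u cancels \<open>grow\<close>, so the mass depends on the
  ratio \<open>decay\<close> / \<open>grow\<close> only through the integral of \<open>decay\<close>
  over a period, which is \<open>J\<close> below.\<close>

lemma mass_M:
  assumes "(v has_integral L) {0..1}"
    and grow: "\<And>x. DERIV A x :> grow x" and A: "A 1 - A 0 = 2 * pi * c"
  shows "hamiltonian_mass \<mu> \<le> 1 + (L / (2 * pi))\<^sup>2"
proof -
  have "continuous_on UNIV decay" using smooth_decay smooth_on_imp_continuous_on by blast
  then obtain B where B: "\<And>x. DERIV B x :> decay x" by (rule real_antiderivative) blast
  have per: "decay (u + 1) = decay u" for u by (simp add: decay_def per_v per_\<kappa>)
  define J where "J = B 1 - B 0"
  have "decay u + grow u = v u" for u by (simp add: grow_def decay_def field_simps)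
  then have "DERIV (\<lambda>x. B x + A x) x :> v x" for x using DERIV_add[OF B grow, of x] by simp
  then have "(v has_integral (B 1 + A 1) - (B 0 + A 0)) {0..1}"
    by (intro fundamental_theorem_of_calculus)
      (auto intro: has_vector_derivative_at_within simp only: has_real_derivative_iff_has_vector_derivative)
  then have L: "L = J + 2 * pi * c"
    using has_integral_unique[OF assms(1)] A by (simp add: J_def)
  \<comment> \<open>An explicit antiderivative of the mass integrand carries out the substitution;
    over an interval of length 2 pi the argument \<open>\<psi> x\<close> advances by exactly
    1.\<close>
  have "DERIV (\<lambda>x. x + (4 * c) * B (\<psi> x)) x :> 1 + (4 * c) * (decay (\<psi> x) * (c / grow (\<psi> x)))" for x
    by (intro DERIV_add DERIV_ident DERIV_cmult DERIV_chain2[OF B D\<psi>])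
  then have "((\<lambda>x. 1 + (4 * c) * (decay (\<psi> x) * (c / grow (\<psi> x)))) has_integral
     (2 * pi + (4 * c) * B (\<psi> (2 * pi))) - (0 + (4 * c) * B (\<psi> 0))) {0..2*pi}"
    by (intro fundamental_theorem_of_calculus mult_nonneg_nonneg pi_ge_zero zero_le_numeral)
      (auto intro: has_vector_derivative_at_within simp only: has_real_derivative_iff_has_vector_derivative)
  moreover have "\<psi> (2 * pi) = \<psi> 0 + 1" using \<psi>_shift[of 0 1] by simp
  then have "B (\<psi> (2 * pi)) = B (\<psi> 0) + J" using antiderivative_shift[OF B per] by (simp add: J_def)
  moreover have "1 + (4 * c) * (decay (\<psi> x) * (c / grow (\<psi> x))) = \<mu> x $ 2 $ 2 + 2 * \<mu> x $ 1 $ 1" for x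
    by (simp add: \<mu>_def power2_eq_square)
  ultimately have "((\<lambda>x. \<mu> x $ 2 $ 2 + 2 * \<mu> x $ 1 $ 1) has_integral (2 * pi + 4 * c * J)) {0..2*pi}"
    by (simp add: algebra_simps)
  then have "hamiltonian_mass \<mu> = (2 * pi + 4 * c * J) / (2 * pi)"
    by (simp add: hamiltonian_mass_def integral_unique)
  also have "\<dots> = 1 + 4 * (c * (J / (2 * pi)))" by (simp add: field_simps)
  \<comment> \<open>4 x y \<le> (x + y)^2, with no condition on the sign of
    \<open>J\<close>.\<close>
  also have "\<dots> \<le> 1 + (J / (2 * pi) + c)\<^sup>2"
    using zero_le_power2[of "J / (2 * pi) - c"] by (simp add: power2_eq_square algebra_simps)
  also have "J / (2 * pi) + c = L / (2 * pi)" by (simp add: L field_simps)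
  finally show ?thesis .
qed

end

context fermi
begin

lemma alh_exists:
  assumes "(v has_integral L) {0..1}"
  obtains Q \<mu> where "alh M Q \<mu>" "hamiltonian_mass \<mu> \<le> 1 + (L / (2 * pi))\<^sup>2"
proof -
  have "continuous_on UNIV grow" using smooth_grow smooth_on_imp_continuous_on by blast
  then obtain A where A: "\<And>x. DERIV A x :> grow x" by (rule real_antiderivative) blast
  \<comment> \<open>This normalisation makes \<open>A / c\<close> gain exactly 2 pi per period of
    the curve.\<close>
  define c where "c = (A 1 - A 0) / (2 * pi)"
  have "A 0 < A 1" using DERIV_pos_imp_increasing[of 0 1 A] A grow_pos by auto
  then have c: "0 < c" by (simp add: c_def)
  have per: "grow (u + 1) = grow u" for u by (simp add: grow_def per_v per_\<kappa>)
  define \<phi> where "\<phi> = (\<lambda>u. A u / c)"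
  have D\<phi>: "DERIV \<phi> u :> grow u / c" for u unfolding \<phi>_def by (intro DERIV_cdivide A)
  have "\<phi> (u + 1) = \<phi> u + 2 * pi" for u
  proof -
    have "A (u + 1) = A u + 2 * pi * c" using antiderivative_shift[OF A per, of u] by (simp add: c_def)
    then show ?thesis using c by (simp add: \<phi>_def add_divide_distrib)
  qed
  from inverse_of_quasiperiodic[OF D\<phi> _ this]
  obtain \<psi> where \<psi>: "\<And>x. \<psi> (\<phi> x) = x" "\<And>y. \<phi> (\<psi> y) = y" "\<And>y. DERIV \<psi> y :> 1 / (grow (\<psi> y) / c)"
    "\<And>y (n::int). \<psi> (y + 2 * pi * n) = \<psi> y + n"
    using grow_pos c by auto
  interpret fermi_end v \<kappa> c \<phi> \<psi>
    by unfold_locales (use c D\<phi> \<psi> in auto)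
  show thesis
    using that[OF alh_M mass_M[OF assms A]] by (simp add: c_def)
qed

end

section \<open>The main theorem\<close>

text \<open>Regularity keeps the argument of the square root positive, where the root is
  smooth.\<close>

lemma smooth_on_norm_deriv:
  fixes \<sigma> :: "real \<Rightarrow> 'e::euclidean_space"
  assumes "smooth_on UNIV \<sigma>" "\<And>t. vector_derivative \<sigma> (at t) \<noteq> 0"
  shows "smooth_on UNIV (\<lambda>t. norm (vector_derivative \<sigma> (at t)))"
  unfolding norm_eq_sqrt_inner
  by (intro smooth_on_compose[OF _ smooth_on_sqrt] smooth_on_bilinear[OF bounded_bilinear_inner]
      smooth_on_real_derivD(2)[OF open_UNIV] assms) (use assms(2) in auto)

lemma vector_derivative_periodic:
  fixes \<sigma> :: "real \<Rightarrow> 'e::real_normed_vector"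
  assumes "(\<sigma> has_vector_derivative d) (at (t + 1))" "\<And>t. \<sigma> (t + 1) = \<sigma> t"
  shows "(\<sigma> has_vector_derivative d) (at t)"
proof -
  have "((\<lambda>s. s + 1) has_vector_derivative 1) (at t)" by (auto intro!: derivative_eq_intros)
  from vector_diff_chain_at[OF this assms(1)] show ?thesis
    using assms(2) by (simp add: o_def)
qed

text \<open>\<open>\<sigma>\<close> is injective only on a half-open period, so it is inverted
  there; passing to the circle makes the angle independent of the period.\<close>

definition curve_angle :: "(real \<Rightarrow> 'e) \<Rightarrow> 'e \<Rightarrow> complex" where
  "curve_angle \<sigma> q = cis (2 * pi * inv_into {0..<1} \<sigma> q)"

lemma curve_angle_eq:
  assumes "\<And>t. \<sigma> (t + 1) = \<sigma> t" "inj_on \<sigma> {0..<1}"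
  shows "curve_angle \<sigma> (\<sigma> u) = cis (2 * pi * u)"
proof -
  have u: "u = frac u + of_int \<lfloor>u\<rfloor>" by (simp add: frac_def)
  have "\<sigma> u = \<sigma> (frac u)" using periodic_of_int[of \<sigma> "frac u" "\<lfloor>u\<rfloor>"] assms(1) u by simp
  moreover have "frac u \<in> {0..<1}" by (simp add: frac_lt_1)
  ultimately have "inv_into {0..<1} \<sigma> (\<sigma> u) = frac u" using inv_into_f_f[OF assms(2)] by simp
  then show ?thesis using cis_2pi_shift[of "frac u" "\<lfloor>u\<rfloor>"] u by (simp add: curve_angle_def)
qed

theorem theorem2:
  fixes \<sigma> :: "real \<Rightarrow> 'e::euclidean_space" and r0 :: real and k :: "'e \<Rightarrow> real"
  assumes "0 < r0"
    and "simple_closed_curve \<sigma>"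
    and "curve_length \<sigma> = 2 * pi * r0"
    and "smooth_on UNIV (k \<circ> \<sigma>)"
    and "(\<forall>q\<in>range \<sigma>. 0 < k q) \<or> (\<forall>q\<in>range \<sigma>. k q = 0)"
  shows "(\<exists>(M :: point surface) Q \<mu> \<Phi>.
      riemannian_surface M \<and> alh M Q \<mu> \<and>
      cyl_diffeo \<sigma> {r0..} M (topspace (sspace M)) \<Phi> \<and>
      (\<forall>p\<in>topspace (sspace M). gauss_curvature M p = -1) \<and>
      boundary_data M \<sigma> k \<and>
      (\<forall>u \<tau>. r0 \<le> \<tau> \<and> \<not> (\<tau> = r0 \<and> (\<forall>q\<in>range \<sigma>. k q = 0)) \<longrightarrow> 0 < leaf_geod_curv \<sigma> r0 M \<Phi> u \<tau>) \<and>
      hamiltonian_mass \<mu> \<le> 1 + r0^2)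
    \<and> bartnik_mass no_enclosing_geodesic \<sigma> r0 k \<le> ereal (1 + r0^2)
    \<and> bartnik_mass outer_minimising \<sigma> r0 k \<le> ereal (1 + r0^2)"
proof -
  define v where "v = (\<lambda>t. norm (vector_derivative \<sigma> (at t)))"
  define \<kappa> where "\<kappa> = (\<lambda>t. k (\<sigma> t))"
  have sm: "smooth_on UNIV \<sigma>" and reg: "\<And>t. vector_derivative \<sigma> (at t) \<noteq> 0"
    and per: "\<And>t. \<sigma> (t + 1) = \<sigma> t" and inj: "inj_on \<sigma> {0..<1}"
    using assms(2) by (auto simp: simple_closed_curve_def)
  have pern: "\<sigma> (t + of_int n) = \<sigma> t" for t and n :: int by (rule periodic_of_int) (rule per)
  note angle = curve_angle_eq[OF per inj]
  interpret fermi v \<kappa>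
  proof
    show "smooth_on UNIV v" unfolding v_def by (rule smooth_on_norm_deriv[OF sm reg])
    show "smooth_on UNIV \<kappa>" using assms(4) by (simp add: \<kappa>_def o_def)
    show "v (u + 1) = v u" for u
      using vector_derivative_periodic[OF smooth_on_real_derivD(1)[OF open_UNIV sm UNIV_I] per, of u]
      by (simp add: v_def vector_derivative_at)
    show "\<kappa> (u + 1) = \<kappa> u" for u by (simp add: \<kappa>_def per)
    show "0 < v u" for u by (simp add: v_def reg)
    show "0 \<le> \<kappa> u" for u using assms(5) by (auto simp: \<kappa>_def intro: less_imp_le)
  qed
  have "continuous_on {0..1} v"
    using smooth_on_imp_continuous_on[OF smooth_v] continuous_on_subset by blast
  from integrable_integral[OF integrable_continuous_interval[OF this]]
  have "(v has_integral 2 * pi * r0) {0..1}"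
    using assms(3) by (simp add: curve_length_def v_def)
  then obtain Q \<mu> where Q: "alh M Q \<mu>" "hamiltonian_mass \<mu> \<le> 1 + r0\<^sup>2"
    by (rule alh_exists) simp
  \<comment> \<open>The leaf labelled \<open>\<tau>\<close> is the curve at distance
    \<open>\<tau> - r0\<close> from the boundary, so the labels start at \<open>r0\<close>.\<close>
  define \<Phi> where "\<Phi> = (\<lambda>(q, \<tau>). (curve_angle \<sigma> q, \<tau> - r0))"
  have \<Phi>: "\<Phi> (\<sigma> u, \<tau>) = (cis (2 * pi * u), \<tau> - r0)" for u \<tau> by (simp add: \<Phi>_def angle)
  have inj\<Phi>: "inj_on \<Phi> (range \<sigma> \<times> {r0..})"
  proof (rule inj_onI)
    fix p q assume "p \<in> range \<sigma> \<times> {r0..}" "q \<in> range \<sigma> \<times> {r0..}" and eq: "\<Phi> p = \<Phi> q"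
    then obtain u s w t where pq: "p = (\<sigma> u, s)" "q = (\<sigma> w, t)" by auto
    with eq have "cis (2 * pi * u) = cis (2 * pi * w)" "s = t" by (auto simp: \<Phi>)
    then show "p = q" using pern pq by (auto simp: cis_2pi_eq_iff)
  qed
  have img\<Phi>: "\<Phi> ` (range \<sigma> \<times> {r0..}) = cylinder"
  proof
    show "\<Phi> ` (range \<sigma> \<times> {r0..}) \<subseteq> cylinder" by (auto simp: \<Phi> cylinder_def)
    show "cylinder \<subseteq> \<Phi> ` (range \<sigma> \<times> {r0..})"
    proof
      fix p assume "p \<in> cylinder"
      then obtain u t where "p = (cis (2 * pi * u), t)" "0 \<le> t" by (rule cylinder_cases)
      then show "p \<in> \<Phi> ` (range \<sigma> \<times> {r0..})"
        by (intro image_eqI[of _ _ "(\<sigma> u, t + r0)"]) (auto simp: \<Phi>)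
    qed
  qed
  have coords: "cyl_coords \<sigma> \<Phi> x = (cis (2 * pi * x $ 1), x $ 2 - r0)" for x
    by (simp add: cyl_coords_def \<Phi>)
  have diffeo: "cyl_diffeo \<sigma> {r0..} M (topspace (sspace M)) \<Phi>"
    unfolding cyl_diffeo_def
  proof (intro conjI ballI)
    show "openin (sspace M) (topspace (sspace M))" by (rule openin_topspace)
    show "bij_betw \<Phi> (range \<sigma> \<times> {r0..}) (topspace (sspace M))"
      using inj\<Phi> img\<Phi> by (simp add: bij_betw_def)
    show "smooth_into {x. x $ 2 \<in> {r0..}} M (cyl_coords \<sigma> \<Phi>)"
      by (rule smooth_into_cyl[OF smooth_on_nth[OF smooth_on_id]
            smooth_on_minus[OF smooth_on_nth[OF smooth_on_id] smooth_on_const] _ coords]) simp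
    fix ch assume "ch \<in> charts M"
    then obtain b where ch: "ch = (cyl_dom b, cyl_map b)" by auto
    show "smooth_on (snd ch ` (fst ch \<inter> topspace (sspace M))) (inv_into (range \<sigma> \<times> {r0..}) \<Phi> \<circ> chart_inv ch)"
    proof (rule smooth_on_cong)
      show "smooth_on (snd ch ` (fst ch \<inter> topspace (sspace M))) (\<lambda>x. (\<sigma> (x $ 1), x $ 2 + r0))"
        by (intro smooth_on_Pair smooth_on_add smooth_on_const smooth_on_compose[OF _ sm] smooth_on_nth smooth_on_id) auto
      fix x assume "x \<in> snd ch ` (fst ch \<inter> topspace (sspace M))"
      then have x: "x \<in> strip b" using cyl_map_image[of b] by (auto simp: ch)
      have "inv_into (range \<sigma> \<times> {r0..}) \<Phi> (unroll x) = (\<sigma> (x $ 1), x $ 2 + r0)"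
        by (rule inv_into_f_eq[OF inj\<Phi>]) (use x in \<open>auto simp: \<Phi> unroll_def strip_def\<close>)
      then show "(\<sigma> (x $ 1), x $ 2 + r0) = (inv_into (range \<sigma> \<times> {r0..}) \<Phi> \<circ> chart_inv ch) x"
        by (simp add: ch chart_inv_cyl[OF x])
    qed
  qed
  have curv: "0 < leaf_geod_curv \<sigma> r0 M \<Phi> u \<tau>"
    if \<tau>: "r0 \<le> \<tau>" "\<not> (\<tau> = r0 \<and> (\<forall>q\<in>range \<sigma>. k q = 0))" for u \<tau>
  proof -
    let ?D = "{x :: real^2. r0 \<le> x $ 2}"
    have "pullback_metric ?D M (cyl_coords \<sigma> \<Phi>) y = dmat ((\<rho> (y $ 1) (y $ 2 - r0))\<^sup>2)" if y: "y \<in> ?D" for y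
    proof -
      have 1: "continuous_on ?D (\<lambda>x. x $ 1)" by (intro continuous_intros)
      have 2: "0 \<le> x $ 2 - r0" if "x \<in> ?D" for x :: "real^2" using that by simp
      have 3: "((\<lambda>x. x $ 2 - r0) has_derivative (\<lambda>h. h $ 2)) (at y within ?D)"
        by (auto intro!: derivative_eq_intros nth_has_derivative)
      have "pullback_metric ?D M (cyl_coords \<sigma> \<Phi>) y $ i $ j =
          (\<rho> (y $ 1) (y $ 2 - r0))\<^sup>2 * axis i 1 $ 1 * axis j 1 $ 1 + axis i 1 $ 2 * axis j 1 $ 2" for i j
        using pullback_M[OF upward_halfplanes(2) y 1 2 coords nth_has_derivative 3, of i j] by simp
      then show ?thesis by (simp add: vec_eq_iff forall_2 axis_def)
    qed
    then have "leaf_geod_curv \<sigma> r0 M \<Phi> u \<tau> = wcurv u (\<tau> - r0)"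
      using gauss_fermi(2)[OF upward_halfplanes(2)[of r0], where c=r0 and x="vector [u, \<tau>]"] \<tau>(1)
      by (simp add: leaf_geod_curv_def)
    moreover have "0 < sinh (\<tau> - r0) + \<kappa> u * cosh (\<tau> - r0)"
    \<comment> \<open>On the boundary leaf sinh vanishes and positivity comes from
      \<open>\<kappa>\<close>, which the alternative makes positive everywhere once it is not
      identically zero. On the other leaves sinh alone is positive.\<close>
    proof (cases "\<tau> = r0")
      case True
      then show ?thesis using \<tau>(2) assms(5) by (auto simp: \<kappa>_def)
    next
      case False
      then show ?thesis using \<tau>(1) \<kappa>_nonneg[of u] by (intro add_pos_nonneg) auto
    qed
    ultimately show ?thesis
      using factor_ge[of "\<tau> - r0" u] \<tau>(1) by (simp add: wcurv_def)
  qed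
  have bd: "boundary_data M \<sigma> k"
    unfolding boundary_data_def
  proof (intro exI conjI ballI allI)
    let ?F = "\<lambda>q. (curve_angle \<sigma> q, 0)"
    have F\<sigma>: "?F \<circ> \<sigma> = (\<lambda>t. (cis (2 * pi * t), 0))" by (simp add: fun_eq_iff angle)
    show "smooth_into UNIV M (?F \<circ> \<sigma>)"
      unfolding F\<sigma> by (rule smooth_into_cyl[OF smooth_on_id smooth_on_const]) auto
    show "speed M (?F \<circ> \<sigma>) t = norm (vector_derivative \<sigma> (at t))" for t
      unfolding F\<sigma> speed_boundary_curve by (simp add: v_def)
    show "bdry_geod_curv M (?F q) = k q" if "q \<in> range \<sigma>" for q
    proof -
      from that obtain u where u: "q = \<sigma> u" by blast
      show ?thesis unfolding u angle bdry_geod_curv_M by (simp add: \<kappa>_def)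
    qed
    show "bij_betw ?F (range \<sigma>) (bdry M)"
      unfolding bij_betw_def
    proof
      show "inj_on ?F (range \<sigma>)"
        using pern by (auto simp: inj_on_def angle cis_2pi_eq_iff)
      show "?F ` range \<sigma> = bdry M"
      proof
        show "?F ` range \<sigma> \<subseteq> bdry M" by (auto simp: angle bdry_cyl cylinder_def)
        show "bdry M \<subseteq> ?F ` range \<sigma>"
        proof
          fix p assume "p \<in> bdry M"
          then obtain w where "p = (cis (2 * pi * w), 0)" by (auto simp: bdry_cyl elim!: cylinder_cases)
          then have "p = ?F (\<sigma> w)" by (simp add: angle)
          then show "p \<in> ?F ` range \<sigma>" by blast
        qed
      qed
    qed
  qed
  have gauss: "\<forall>p\<in>topspace (sspace M). gauss_curvature M p = -1"
    by (simp add: gauss_curvature_M)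
  \<comment> \<open>One surface serves both conditions: it is a competitor in the infimum for any
    \<open>nondeg\<close> that it satisfies.\<close>
  have bm: "bartnik_mass nondeg \<sigma> r0 k \<le> ereal (1 + r0\<^sup>2)" if "nondeg M" for nondeg
  proof -
    have "admissible_extension nondeg \<sigma> r0 k M Q \<mu>"
      unfolding admissible_extension_def
      using riemannian_surface_M Q(1) gauss assms(3) bd that by auto
    then have "bartnik_mass nondeg \<sigma> r0 k \<le> ereal (hamiltonian_mass \<mu>)"
      unfolding bartnik_mass_def by (intro Inf_lower) blast
    with Q(2) show ?thesis by (meson ereal_less_eq(3) order_trans)
  qed
  show ?thesis
    using riemannian_surface_M Q diffeo gauss bd curv bm[of no_enclosing_geodesic, OF no_enclosing_geodesic_M] bm[of outer_minimising, OF outer_minimising_M]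
    by blast
qed

end
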